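(* Suppose Assumptions $(\mathbf{W^*})$ and $(\underline{\mathbf{B}})$ hold. Then the graph $\mathrm{Gr}(A^{app})=\{(x,a):x\in\mathbb{X},a\in A^{app}(x)\}$ is a Borel subset of $\mathrm{Gr}(A^* )$, and for each $x\in\mathbb{X}$ the set $A^{app}(x)$ is nonempty and compact. Furthermore, there exists a stationary policy $\phi^{app}$ such that $\phi^{app}(x)\in A^{app}(x)$ for all $x\in\mathbb{X}$, and any such policy is average-cost optimal.
   Context: **MDP.** The state space $\mathbb{X}$ and the action space $\mathbb{A}$ are Borel subsets of Polish spaces, with metrics $\rho$ and $\gamma$ respectively. For each $x\in\mathbb{X}$ a nonempty Borel set $A(x)\subseteq\mathbb{A}$ of available actions is given; $\mathrm{Gr}(A)=\{(x,a):x\in\mathbb{X},a\in A(x)\}$ is a Borel subset of $\mathbb{X}\times\mathbb{A}$, and there exists a Borel map $\phi:\mathbb{X}\to\mathbb{A}$ with $\phi(x)\in A(x)$ for all $x$. The one-step cost $c:\mathrm{Gr}(A)\to(-\infty,+\infty]$ is Borel and bounded below. The transition kernel $q$ is such that $q(\cdot|x,a)$ is a Borel probability measure on $\mathbb{X}$ for each $(x,a)$ and $q(B|\cdot,\cdot)$ is Borel on $\mathrm{Gr}(A)$ for each Borel $B\subseteq\mathbb{X}$. **Policies.** A policy $\pi=\{\pi_n\}_{n\ge0}$ is a sequence of regular transition probabilities $\pi_n$ from histories $h_n=(\xi_0,u_0,\dots,u_{n-1},\xi_n)\in(\mathbb{X}\times\mathbb{A})^n\times\mathbb{X}$ to $\mathbb{A}$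 with $\pi_n(A(\xi_n)|h_n)=1$; $\Pi$ is the set of all policies. A stationary policy is a Borel map $\phi:\mathbb{X}\to\mathbb{A}$ with $\phi(x)\in A(x)$ for all $x$ (the action $\phi(\xi_n)$ is used at every time $n$). An initial state $x$ and a policy $\pi$ define a probability $P_x^\pi$ on trajectories $(\xi_0,u_0,\xi_1,u_1,\dots)$ with expectation $\mathbb{E}_x^\pi$. **Costs.** $v_N^\pi(x)=\mathbb{E}_x^\pi\sum_{n=0}^{N-1}c(\xi_n,u_n)$; for $\alpha\in[0,1)$, $v_\alpha^\pi(x)=\mathbb{E}_x^\pi\sum_{n=0}^{\infty}\alpha^n c(\xi_n,u_n)$ (with $\alpha^0=1$); $w^\pi(x)=\limsup_{N\to\infty}\frac1N v_N^\pi(x)$. Optimal values: $v_\alpha(x)=\inf_{\pi\in\Pi}v_\alpha^\pi(x)$, $w(x)=\inf_{\pi\in\Pi}w^\pi(x)$. A policy $\pi$ is average-cost optimal if $w^\pi(x)=w(x)$ for all $x\in\mathbb{X}$. Set $w^*=\inf_{x\in\mathbb{X}}w(x)$ and, for $\alpha\in[0,1)$, $m_\alpha=\inf_{x\in\mathbb{X}}v_\alpha(x)$, $u_\alpha(x)=v_\alpha(x)-m_\alpha$, and $\overline{w}=\limsup_{\alpha\uparrow1}(1-\alpha)m_\alpha$. **Assumption $(\mathbf{W^*})$:** (i) $c$ is lower semi-continuous and bounded below on $\mathrm{Gr}(A)$; (ii) if a sequence $\{x_n\}$ in $\mathbb{X}$ converges to $x\in\mathbb{X}$, then any sequence $\{a_n\}$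 with $a_n\in A(x_n)$, such that $\{c(x_n,a_n)\}$ is bounded above, has a limit point (limit of a subsequence) $a\in A(x)$; (iii) $q(\cdot|x,a)$ is weakly continuous in $(x,a)\in\mathrm{Gr}(A)$, i.e. $\int f(z)q(dz|x_k,a_k)\to\int f(z)q(dz|x,a)$ for every bounded continuous $f:\mathbb{X}\to\mathbb{R}$ whenever $(x_k,a_k)\to(x,a)$ in $\mathrm{Gr}(A)$. **Assumption $(\underline{\mathbf{B}})$:** (i) $w^*<+\infty$; (ii) $\liminf_{\alpha\uparrow1}u_\alpha(x)<\infty$ for all $x\in\mathbb{X}$. **Action sets.** Let $$u(x)=\liminf_{\alpha\uparrow1,\,y\to x}u_\alpha(y):=\sup_{\beta\in[0,1),\,R>0}\ \inf\{u_\alpha(y):\alpha\in[\beta,1),\ y\in\mathbb{X},\ \rho(y,x)<R\},$$ $$A^*(x)=\Big\{a\in A(x):\ \overline{w}+u(x)\ge c(x,a)+\int_{\mathbb{X}}u(y)q(dy|x,a)\Big\},\qquad \mathrm{Gr}(A^* )=\{(x,a):x\in\mathbb{X},a\in A^*(x)\},$$ and for $\alpha\in(0,1)$ $$A_\alpha(x)=\Big\{a\in A(x):\ v_\alpha(x)=c(x,a)+\alpha\int_{\mathbb{X}}v_\alpha(y)q(dy|x,a)\Big\},\qquad \mathrm{Gr}(A_\alpha)=\{(x,a):x\in\mathbb{X},a\in A_\alpha(x)\}.$$ The upper topological limit $\overline{\mathrm{Lim}}_{\alpha\uparrow1}\mathrm{Gr}(A_\alpha)$ is the set of all $(x,a)\in\mathbb{X}\times\mathbb{A}$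 for which there exist $\alpha_n\uparrow1$ (with $\alpha_n\in(0,1)$) and $(x_n,a_n)\in\mathrm{Gr}(A_{\alpha_n})$, $n\ge1$, with $(x_n,a_n)\to(x,a)$. Finally $$A^{app}(x)=\big\{a\in A^*(x):\ (x,a)\in\overline{\mathrm{Lim}}_{\alpha\uparrow1}\mathrm{Gr}(A_\alpha)\big\},\qquad x\in\mathbb{X}.$$ *)

theory Defs
  imports "HOL-Probability.Probability"
begin

section \<open>The model\<close>

text \<open>The metrics of the state and action space are those of the ambient Polish spaces. Costs and
  transition probabilities are only meaningful on the graph of the available actions; their values
  elsewhere are unconstrained.\<close>

record ('x, 'a) mdp =
  states :: "'x set"
  actions :: "'a set"
  avail :: "'x \<Rightarrow> 'a set"
  cost :: "'x \<times> 'a \<Rightarrow> ereal"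
  trans_prob :: "'x \<times> 'a \<Rightarrow> 'x measure"

definition gr :: "('x, 'a) mdp \<Rightarrow> ('x \<Rightarrow> 'a set) \<Rightarrow> ('x \<times> 'a) set" where
  "gr M B = Sigma (states M) B"

abbreviation states_borel :: "('x::polish_space, 'a::polish_space) mdp \<Rightarrow> 'x measure" where
  "states_borel M \<equiv> restrict_space borel (states M)"

abbreviation actions_borel :: "('x::polish_space, 'a::polish_space) mdp \<Rightarrow> 'a measure" where
  "actions_borel M \<equiv> restrict_space borel (actions M)"

abbreviation steps_borel :: "('x::polish_space, 'a::polish_space) mdp \<Rightarrow> ('x \<times> 'a) measure" where
  "steps_borel M \<equiv> states_borel M \<Otimes>\<^sub>M actions_borel M"

definition stationary :: "('x::polish_space, 'a::polish_space) mdp \<Rightarrow> ('x \<Rightarrow> 'a) \<Rightarrow> bool" where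
  "stationary M \<phi> \<longleftrightarrow>
     \<phi> \<in> measurable (states_borel M) (actions_borel M) \<and> (\<forall>x\<in>states M. \<phi> x \<in> avail M x)"

definition bounded_below_on :: "'z set \<Rightarrow> ('z \<Rightarrow> ereal) \<Rightarrow> bool" where
  "bounded_below_on S f \<longleftrightarrow> (\<exists>K::real. \<forall>z\<in>S. ereal K \<le> f z)"

locale MDP =
  fixes M :: "('x::polish_space, 'a::polish_space) mdp"
  assumes states_in_borel: "states M \<in> sets borel"
    and actions_in_borel: "actions M \<in> sets borel"
    and avail_subset: "\<And>x. x \<in> states M \<Longrightarrow> avail M x \<subseteq> actions M"
    and avail_nonempty: "\<And>x. x \<in> states M \<Longrightarrow> avail M x \<noteq> {}"
    and avail_in_borel: "\<And>x. x \<in> states M \<Longrightarrow> avail M x \<in> sets borel"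
    and gr_in_borel: "gr M (avail M) \<in> sets borel"
    and ex_stationary: "\<exists>\<phi>. stationary M \<phi>"
    and cost_borel: "cost M \<in> borel_measurable (restrict_space borel (gr M (avail M)))"
    and cost_bounded_below: "bounded_below_on (gr M (avail M)) (cost M)"
    and trans_prob_kernel:
      "trans_prob M \<in> measurable (restrict_space borel (gr M (avail M))) (prob_algebra (states_borel M))"


section \<open>Policies and the induced process\<close>

text \<open>A history \<open>(\<xi>\<^sub>0, u\<^sub>0, \<dots>, u\<^bsub>n-1\<^esub>, \<xi>\<^sub>n)\<close> is represented by the pair of the sequence
  \<open>k \<mapsto> (\<xi>\<^sub>k, u\<^sub>k)\<close> on \<open>{0..<n}\<close> and the current state \<open>\<xi>\<^sub>n\<close>.\<close>

definition histories ::
  "('x::polish_space, 'a::polish_space) mdp \<Rightarrow> nat \<Rightarrow> ((nat \<Rightarrow> 'x \<times> 'a) \<times> 'x) measure" where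
  "histories M n = PiM {0..<n} (\<lambda>_. steps_borel M) \<Otimes>\<^sub>M states_borel M"

type_synonym ('x, 'a) policy = "nat \<Rightarrow> (nat \<Rightarrow> 'x \<times> 'a) \<times> 'x \<Rightarrow> 'a measure"

definition policies :: "('x::polish_space, 'a::polish_space) mdp \<Rightarrow> ('x, 'a) policy set" where
  "policies M = {\<pi>. \<forall>n. \<pi> n \<in> measurable (histories M n) (prob_algebra (actions_borel M)) \<and>
     (\<forall>(h, x) \<in> space (histories M n). measure (\<pi> n (h, x)) (avail M x) = 1)}"

definition stationary_policy ::
  "('x::polish_space, 'a::polish_space) mdp \<Rightarrow> ('x \<Rightarrow> 'a) \<Rightarrow> ('x, 'a) policy" where
  "stationary_policy M \<phi> = (\<lambda>n (h, x). return (actions_borel M) (\<phi> x))"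

text \<open>Law of the \<open>n\<close>-th state given the previous state-action pairs. Histories leaving the graph of
  the available actions have probability zero; on these the transition kernel is completed
  arbitrarily (here: the state does not move), since the library's Ionescu-Tulcea theorem wants
  kernels defined on the full product space.\<close>

definition state_law ::
  "('x::polish_space, 'a::polish_space) mdp \<Rightarrow> 'x \<Rightarrow> nat \<Rightarrow> (nat \<Rightarrow> 'x \<times> 'a) \<Rightarrow> 'x measure" where
  "state_law M x n h =
     (if n = 0 then return (states_borel M) x
      else if h (n - 1) \<in> gr M (avail M) then trans_prob M (h (n - 1))
      else return (states_borel M) (fst (h (n - 1))))"

definition step_law ::
  "('x::polish_space, 'a::polish_space) mdp \<Rightarrow> ('x, 'a) policy \<Rightarrow> 'x \<Rightarrow>
   nat \<Rightarrow> (nat \<Rightarrow> 'x \<times> 'a) \<Rightarrow> ('x \<times> 'a) measure" where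
  "step_law M \<pi> x n h =
     state_law M x n h \<bind> (\<lambda>y. \<pi> n (h, y) \<bind> (\<lambda>a. return (steps_borel M) (y, a)))"

text \<open>The strategic measure \<open>P\<^sub>x\<^sup>\<pi>\<close> on trajectories \<open>n \<mapsto> (\<xi>\<^sub>n, u\<^sub>n)\<close>, as the limit measure
  of the Ionescu-Tulcea theorem.\<close>

definition trajectory_law ::
  "('x::polish_space, 'a::polish_space) mdp \<Rightarrow> ('x, 'a) policy \<Rightarrow> 'x \<Rightarrow> (nat \<Rightarrow> 'x \<times> 'a) measure" where
  "trajectory_law M \<pi> x =
     projective_family.lim UNIV
       (Ionescu_Tulcea.CI (step_law M \<pi> x) (\<lambda>_. steps_borel M)) (\<lambda>_. steps_borel M)"

text \<open>The hypotheses of the Ionescu-Tulcea theorem are met, so \<^const>\<open>trajectory_law\<close> is indeed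
  the measure that theorem provides.\<close>

lemma (in MDP) Ionescu_Tulcea_step_law:
  assumes \<pi>: "\<pi> \<in> policies M" and x: "x \<in> states M"
  shows "Ionescu_Tulcea (step_law M \<pi> x) (\<lambda>_. steps_borel M)"
proof -
  have emb: "(\<lambda>z. z) \<in> measurable (steps_borel M) borel"
  proof -
    have 1: "fst \<in> measurable (steps_borel M) borel" "snd \<in> measurable (steps_borel M) borel"
      by (auto intro!: measurable_compose[OF measurable_fst] measurable_compose[OF measurable_snd]
               measurable_restrict_space1)
    have "(\<lambda>z. (fst z, snd z)) \<in> measurable (steps_borel M) (borel \<Otimes>\<^sub>M borel)"
      by (intro measurable_Pair 1)
    then show ?thesis by (simp add: borel_prod)
  qed
  have gr_sets: "{z \<in> space (steps_borel M). z \<in> gr M (avail M)} \<in> sets (steps_borel M)"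
    using measurable_sets[OF emb gr_in_borel] by (simp add: vimage_def Int_def conj_commute)
  have kern: "(\<lambda>z. if z \<in> gr M (avail M) then trans_prob M z else return (states_borel M) (fst z))
      \<in> measurable (steps_borel M) (prob_algebra (states_borel M))"
  proof (subst measurable_If_restrict_space_iff[OF gr_sets], intro conjI)
    have "(\<lambda>z. z) \<in> measurable (restrict_space (steps_borel M) {z. z \<in> gr M (avail M)})
        (restrict_space borel (gr M (avail M)))"
      by (intro measurable_restrict_space2 measurable_restrict_space1 emb)
         (auto simp: space_restrict_space)
    from measurable_compose[OF this trans_prob_kernel]
    show "trans_prob M \<in> measurable (restrict_space (steps_borel M) {z. z \<in> gr M (avail M)})
        (prob_algebra (states_borel M))" .
    show "(\<lambda>z. return (states_borel M) (fst z)) \<in> measurable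
        (restrict_space (steps_borel M) {z. z \<notin> gr M (avail M)}) (prob_algebra (states_borel M))"
      by (intro measurable_restrict_space1 measurable_compose[OF measurable_fst measurable_return_prob_space])
  qed
  have law: "step_law M \<pi> x n \<in> measurable (PiM {0..<n} (\<lambda>_. steps_borel M))
      (prob_algebra (steps_borel M))" for n
  proof -
    have "state_law M x n \<in> measurable (PiM {0..<n} (\<lambda>_. steps_borel M)) (prob_algebra (states_borel M))"
    proof (cases n)
      case 0
      have "return (states_borel M) x \<in> space (prob_algebra (states_borel M))"
        using x by (intro measurable_space[OF measurable_return_prob_space]) (simp add: space_restrict_space)
      with 0 show ?thesis by (simp add: state_law_def[abs_def])
    next
      case (Suc m)
      have "(\<lambda>h. h m) \<in> measurable (PiM {0..<n} (\<lambda>_. steps_borel M)) (steps_borel M)"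
        using Suc by (intro measurable_component_singleton) auto
      from measurable_compose[OF this kern] show ?thesis
        using Suc by (simp add: state_law_def[abs_def] cong: if_cong)
    qed
    moreover have "(\<lambda>(h, y). \<pi> n (h, y) \<bind> (\<lambda>a. return (steps_borel M) (y, a)))
        \<in> measurable (PiM {0..<n} (\<lambda>_. steps_borel M) \<Otimes>\<^sub>M states_borel M) (prob_algebra (steps_borel M))"
    proof -
      have "\<pi> n \<in> measurable (PiM {0..<n} (\<lambda>_. steps_borel M) \<Otimes>\<^sub>M states_borel M)
          (prob_algebra (actions_borel M))"
        using \<pi> by (auto simp: policies_def histories_def)
      then have "(\<lambda>p. \<pi> n p \<bind> (\<lambda>a. return (steps_borel M) (snd p, a)))
        \<in> measurable (PiM {0..<n} (\<lambda>_. steps_borel M) \<Otimes>\<^sub>M states_borel M) (prob_algebra (steps_borel M))"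
        by (rule measurable_bind_prob_space2)
           (auto intro!: measurable_compose[OF _ measurable_return_prob_space] simp: case_prod_beta)
      then show ?thesis by (simp add: case_prod_beta')
    qed
    ultimately show ?thesis
      unfolding step_law_def[abs_def] by (rule measurable_bind_prob_space2)
  qed
  show ?thesis
  proof (rule Ionescu_Tulcea.intro)
    show "step_law M \<pi> x n \<in> measurable (PiM {0..<n} (\<lambda>_. steps_borel M))
        (subprob_algebra (steps_borel M))" for n
      by (rule measurable_prob_algebraD[OF law])
    show "prob_space (step_law M \<pi> x n h)" if "h \<in> space (PiM {0..<n} (\<lambda>_. steps_borel M))" for n h
      using measurable_space[OF law that] by (simp add: space_prob_algebra)
  qed
qed


section \<open>Cost criteria\<close>

text \<open>Integral of an extended-real function as positive minus negative part (\<^const>\<open>e2ennreal\<close>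
  truncates negative values to \<open>0\<close>). It is only applied to functions bounded below
  and to probability measures, so the subtrahend is finite.\<close>

definition ereal_integral :: "'z measure \<Rightarrow> ('z \<Rightarrow> ereal) \<Rightarrow> ereal" where
  "ereal_integral \<mu> f =
     enn2ereal (\<integral>\<^sup>+z. e2ennreal (f z) \<partial>\<mu>) - enn2ereal (\<integral>\<^sup>+z. e2ennreal (- f z) \<partial>\<mu>)"

definition horizon_cost ::
  "('x::polish_space, 'a::polish_space) mdp \<Rightarrow> ('x, 'a) policy \<Rightarrow> nat \<Rightarrow> 'x \<Rightarrow> ereal" where
  "horizon_cost M \<pi> N x = ereal_integral (trajectory_law M \<pi> x) (\<lambda>\<omega>. \<Sum>n<N. cost M (\<omega> n))"

definition discounted_cost ::
  "('x::polish_space, 'a::polish_space) mdp \<Rightarrow> ('x, 'a) policy \<Rightarrow> real \<Rightarrow> 'x \<Rightarrow> ereal" where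
  "discounted_cost M \<pi> \<alpha> x =
     ereal_integral (trajectory_law M \<pi> x) (\<lambda>\<omega>. \<Sum>n. ereal (\<alpha> ^ n) * cost M (\<omega> n))"

definition average_cost ::
  "('x::polish_space, 'a::polish_space) mdp \<Rightarrow> ('x, 'a) policy \<Rightarrow> 'x \<Rightarrow> ereal" where
  "average_cost M \<pi> x = limsup (\<lambda>N. ereal (1 / real N) * horizon_cost M \<pi> N x)"

definition discounted_value ::
  "('x::polish_space, 'a::polish_space) mdp \<Rightarrow> real \<Rightarrow> 'x \<Rightarrow> ereal" where
  "discounted_value M \<alpha> x = (INF \<pi>\<in>policies M. discounted_cost M \<pi> \<alpha> x)"

definition average_value :: "('x::polish_space, 'a::polish_space) mdp \<Rightarrow> 'x \<Rightarrow> ereal" where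
  "average_value M x = (INF \<pi>\<in>policies M. average_cost M \<pi> x)"

definition average_optimal ::
  "('x::polish_space, 'a::polish_space) mdp \<Rightarrow> ('x, 'a) policy \<Rightarrow> bool" where
  "average_optimal M \<pi> \<longleftrightarrow>
     \<pi> \<in> policies M \<and> (\<forall>x\<in>states M. average_cost M \<pi> x = average_value M x)"

definition w_star :: "('x::polish_space, 'a::polish_space) mdp \<Rightarrow> ereal" where
  "w_star M = (INF x\<in>states M. average_value M x)"

definition min_value :: "('x::polish_space, 'a::polish_space) mdp \<Rightarrow> real \<Rightarrow> ereal" where
  "min_value M \<alpha> = (INF x\<in>states M. discounted_value M \<alpha> x)"

definition relative_value ::
  "('x::polish_space, 'a::polish_space) mdp \<Rightarrow> real \<Rightarrow> 'x \<Rightarrow> ereal" where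
  "relative_value M \<alpha> x = discounted_value M \<alpha> x - min_value M \<alpha>"

definition w_upper :: "('x::polish_space, 'a::polish_space) mdp \<Rightarrow> ereal" where
  "w_upper M = Limsup (at_left (1::real)) (\<lambda>\<alpha>. ereal (1 - \<alpha>) * min_value M \<alpha>)"


section \<open>Assumptions\<close>

definition lsc_on :: "'z::topological_space set \<Rightarrow> ('z \<Rightarrow> ereal) \<Rightarrow> bool" where
  "lsc_on S f \<longleftrightarrow> (\<forall>z\<in>S. f z \<le> Liminf (at z within S) f)"

definition assumption_W :: "('x::polish_space, 'a::polish_space) mdp \<Rightarrow> bool" where
  "assumption_W M \<longleftrightarrow>
     lsc_on (gr M (avail M)) (cost M) \<and> bounded_below_on (gr M (avail M)) (cost M) \<and>
     (\<forall>xs x as. range xs \<subseteq> states M \<longrightarrow> x \<in> states M \<longrightarrow> xs \<longlonglongrightarrow> x \<longrightarrow>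
        (\<forall>n. as n \<in> avail M (xs n)) \<longrightarrow> (\<exists>K::real. \<forall>n. cost M (xs n, as n) \<le> ereal K) \<longrightarrow>
        (\<exists>a\<in>avail M x. \<exists>r. strict_mono (r :: nat \<Rightarrow> nat) \<and> (as \<circ> r) \<longlonglongrightarrow> a)) \<and>
     (\<forall>f :: 'x \<Rightarrow> real. continuous_on (states M) f \<longrightarrow> bounded (f ` states M) \<longrightarrow>
        (\<forall>zs z. range zs \<subseteq> gr M (avail M) \<longrightarrow> z \<in> gr M (avail M) \<longrightarrow> zs \<longlonglongrightarrow> z \<longrightarrow>
           (\<lambda>k. \<integral>y. f y \<partial>trans_prob M (zs k)) \<longlonglongrightarrow> (\<integral>y. f y \<partial>trans_prob M z)))"

definition assumption_B_lower :: "('x::polish_space, 'a::polish_space) mdp \<Rightarrow> bool" where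
  "assumption_B_lower M \<longleftrightarrow>
     w_star M < \<infinity> \<and>
     (\<forall>x\<in>states M. Liminf (at_left (1::real)) (\<lambda>\<alpha>. relative_value M \<alpha> x) < \<infinity>)"


section \<open>Action sets\<close>

text \<open>The joint lower limit of \<open>u\<^sub>\<alpha>(y)\<close> as \<open>\<alpha>\<close> increases to \<open>1\<close> and \<open>y \<rightarrow> x\<close>;
  \<open>y = x\<close> is allowed, so this is not a \<^const>\<open>Liminf\<close> along a punctured filter in \<open>y\<close>.\<close>

definition u_lim :: "('x::polish_space, 'a::polish_space) mdp \<Rightarrow> 'x \<Rightarrow> ereal" where
  "u_lim M x = (SUP (\<beta>, R) \<in> {0..<1} \<times> {0<..}.
     INF (\<alpha>, y) \<in> {\<beta>..<1} \<times> {y \<in> states M. dist y x < R}. relative_value M \<alpha> y)"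

definition A_star :: "('x::polish_space, 'a::polish_space) mdp \<Rightarrow> 'x \<Rightarrow> 'a set" where
  "A_star M x = {a \<in> avail M x.
     w_upper M + u_lim M x \<ge> cost M (x, a) + ereal_integral (trans_prob M (x, a)) (u_lim M)}"

definition A_disc :: "('x::polish_space, 'a::polish_space) mdp \<Rightarrow> real \<Rightarrow> 'x \<Rightarrow> 'a set" where
  "A_disc M \<alpha> x = {a \<in> avail M x. discounted_value M \<alpha> x =
     cost M (x, a) + ereal \<alpha> * ereal_integral (trans_prob M (x, a)) (discounted_value M \<alpha>)}"

definition upper_Lim_gr_A_disc :: "('x::polish_space, 'a::polish_space) mdp \<Rightarrow> ('x \<times> 'a) set" where
  "upper_Lim_gr_A_disc M = {z \<in> states M \<times> actions M. \<exists>\<alpha> zs.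
     range \<alpha> \<subseteq> {0<..<1} \<and> incseq \<alpha> \<and> \<alpha> \<longlonglongrightarrow> (1::real) \<and>
     (\<forall>n. zs n \<in> gr M (A_disc M (\<alpha> n))) \<and> zs \<longlonglongrightarrow> z}"

definition A_app :: "('x::polish_space, 'a::polish_space) mdp \<Rightarrow> 'x \<Rightarrow> 'a set" where
  "A_app M x = {a \<in> A_star M x. (x, a) \<in> upper_Lim_gr_A_disc M}"

end

theory Submission
  imports Defs
begin

text \<open>Adding a constant \<open>L\<close> to the cost turns every quantity into an integral of a function with values
in the extended nonnegative reals (\<open>pcost\<close> is the shifted cost), and all criteria change by
explicit constants. Everything analytic then rests on one limit principle, \<open>limit_action\<close>: let
\<open>x\<^sub>n \<rightarrow> x\<close>, let \<open>a\<^sub>n\<close> be actions at \<open>x\<^sub>n\<close> whose one-step values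
\<open>pcost (x\<^sub>n, a\<^sub>n) + \<gamma>\<^sub>n \<integral> F\<^sub>n dq(x\<^sub>n, a\<^sub>n)\<close> are bounded by numbers converging to \<open>K' < \<infinity>\<close>. Then the
costs are bounded, so the \<open>a\<^sub>n\<close> have a limit point \<open>a\<close>, and
\<open>pcost (x, a) + \<gamma> \<integral> f dq(x, a) \<le> K'\<close> whenever \<open>f\<close> lies below the joint lower limit of the \<open>F\<^sub>n\<close>. The
integral part is a Fatou lemma for weakly convergent kernels; it is reduced to weak convergence by
approximating \<open>f\<close> from below by the bounded Lipschitz functions \<open>lip_env\<close>.

The limit principle gives, one after the other:
the infimum of a one-step operator is attained and lower semicontinuous;
sublevel sets of one-step values are compact and, since their hitting sets are then Borel, have
Borel selectors (\<open>compact_selection\<close>);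
value iteration from \<open>0\<close> converges to a fixed point of the Bellman operator, which is the
discounted value function \<open>v\<^sub>\<alpha>\<close>. Thus \<open>v\<^sub>\<alpha>\<close> is Borel and \<open>A\<^sub>\<alpha>(x)\<close> is nonempty where \<open>v\<^sub>\<alpha>(x)\<close> is finite.

For the average cost write \<open>m\<^sub>\<alpha>\<close> for the least discounted value, \<open>u\<^sub>\<alpha> = v\<^sub>\<alpha> - m\<^sub>\<alpha>\<close> and \<open>u\<close> for the joint
lower limit of the \<open>u\<^sub>\<alpha>\<close>. For the shifted cost, \<open>disc_val\<close> and \<open>least_disc_val\<close> are \<open>v\<^sub>\<alpha>\<close> and \<open>m\<^sub>\<alpha>\<close>; in
their difference the shift cancels, so \<open>rel_val\<close> and \<open>rel_lim\<close> are \<open>u\<^sub>\<alpha>\<close> and \<open>u\<close>. An Abelian estimate shows \<open>w_upper \<le> w\<^sup>\<pi>(x)\<close> for every policy and every state.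
To find an element of \<open>A\<^sup>a\<^sup>p\<^sup>p(x)\<close>, choose \<open>\<alpha>\<^sub>n \<rightarrow> 1\<close> and \<open>y\<^sub>n \<rightarrow> x\<close> along which \<open>u\<^sub>\<alpha>(y\<^sub>n)\<close>, with
\<open>\<alpha> = \<alpha>\<^sub>n\<close>, tends to \<open>u(x)\<close>, and \<open>a\<^sub>n \<in> A\<^sub>\<alpha>(y\<^sub>n)\<close>. The discounted optimality
equation reads
\<open>(1 - \<alpha>) m\<^sub>\<alpha> + u\<^sub>\<alpha>(y\<^sub>n) = c(y\<^sub>n, a\<^sub>n) + \<alpha> \<integral> u\<^sub>\<alpha> dq(y\<^sub>n, a\<^sub>n)\<close>,
so the limit principle yields a limit point \<open>a\<close> with \<open>w_upper + u(x) \<ge> c(x, a) + \<integral> u dq(x, a)\<close>; as a limit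
of points of the graphs of the \<open>A\<^sub>\<alpha>\<close> it belongs to \<open>A\<^sup>a\<^sup>p\<^sup>p(x)\<close>. The upper topological limit is closed, so
\<open>A\<^sup>a\<^sup>p\<^sup>p(x)\<close> is a sublevel set of the kind above: compact, with Borel graph and a Borel selector.
Iterating the optimality inequality along a selector of \<open>A\<^sup>*\<close> bounds its average cost by \<open>w_upper\<close>,
which is a lower bound for the cost of every policy, and this is optimality.\<close>

section \<open>Lower limits of extended nonnegative functions\<close>

lemma liminf_add_ennreal: "liminf f + liminf g \<le> liminf (\<lambda>n. f n + g n :: ennreal)"
proof -
  have "liminf f + liminf g = (SUP n. (INF m\<in>{n..}. f m) + (INF m\<in>{n..}. g m))"
    unfolding liminf_SUP_INF
    by (rule ennreal_SUP_add[symmetric]) (auto simp: incseq_def intro!: INF_superset_mono)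
  also have "\<dots> \<le> liminf (\<lambda>n. f n + g n)"
    unfolding liminf_SUP_INF
    by (intro SUP_mono, rule bexI) (auto intro!: INF_greatest add_mono INF_lower)
  finally show ?thesis .
qed

lemma liminf_mult_ennreal: "liminf f * liminf g \<le> liminf (\<lambda>n. f n * g n :: ennreal)"
proof -
  have "liminf f * liminf g = (SUP n. SUP k. (INF m\<in>{n..}. f m) * (INF m\<in>{k..}. g m))"
    unfolding liminf_SUP_INF SUP_mult_left_ennreal SUP_mult_right_ennreal by (rule SUP_commute)
  also have "\<dots> \<le> liminf (\<lambda>n. f n * g n)"
  proof (intro SUP_least)
    fix n k
    have "(INF m\<in>{n..}. f m) * (INF m\<in>{k..}. g m) \<le> (INF m\<in>{max n k..}. f m * g m)"
      by (intro INF_greatest mult_mono INF_lower) auto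
    also have "\<dots> \<le> liminf (\<lambda>n. f n * g n)"
      unfolding liminf_SUP_INF by (rule SUP_upper) simp
    finally show "(INF m\<in>{n..}. f m) * (INF m\<in>{k..}. g m) \<le> liminf (\<lambda>n. f n * g n)" .
  qed
  finally show ?thesis .
qed

lemma INF_add_const_ennreal:
  fixes c :: ennreal
  assumes "I \<noteq> {}"
  shows "(INF i\<in>I. f i + c) = (INF i\<in>I. f i) + c"
  using assms continuous_at_Inf_mono[of "\<lambda>x. x + c" "f ` I"]
    continuous_add[of "at_right (Inf (f ` I))" "\<lambda>x. x" "\<lambda>x. c"]
  by (auto simp: mono_def image_comp add_right_mono)

section \<open>Lipschitz approximation from below\<close>

text \<open>The largest \<open>k\<close>-Lipschitz minorant of \<open>f\<close> on \<open>S\<close>, cut off at \<open>k\<close> so that it is bounded.\<close>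

definition lip_env :: "'z::metric_space set \<Rightarrow> nat \<Rightarrow> ('z \<Rightarrow> ennreal) \<Rightarrow> 'z \<Rightarrow> ennreal" where
  "lip_env S k f x = min (of_nat k) (INF z\<in>S. f z + ennreal (real k * dist x z))"

lemma lip_env_le: "x \<in> S \<Longrightarrow> lip_env S k f x \<le> f x"
  unfolding lip_env_def by (rule min.coboundedI2, rule INF_lower2[of x]) auto

lemma lip_env_le_of_nat: "lip_env S k f x \<le> of_nat k"
  unfolding lip_env_def by simp

lemma lip_env_mono:
  assumes "k \<le> l" "\<And>z. z \<in> S \<Longrightarrow> f z \<le> g z"
  shows "lip_env S k f x \<le> lip_env S l g x"
  unfolding lip_env_def using assms
  by (intro min.mono INF_mono) (auto intro!: add_mono ennreal_leI mult_right_mono bexI)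

lemma lip_env_lipschitz: "lip_env S k f x \<le> lip_env S k f y + ennreal (real k * dist x y)"
proof -
  have "(INF z\<in>S. f z + ennreal (real k * dist x z))
      \<le> (INF z\<in>S. (f z + ennreal (real k * dist y z)) + ennreal (real k * dist x y))"
  proof (intro INF_mono bexI)
    fix z assume "z \<in> S"
    have "ennreal (real k * dist x z) \<le> ennreal (real k * dist y z + real k * dist x y)"
      using dist_triangle[of x z y]
      by (intro ennreal_leI) (metis add.commute distrib_left mult_left_mono of_nat_0_le_iff)
    then show "f z + ennreal (real k * dist x z)
        \<le> f z + ennreal (real k * dist y z) + ennreal (real k * dist x y)"
      by (simp add: add.assoc add_left_mono ennreal_plus)
  qed
  also have "\<dots> = (INF z\<in>S. f z + ennreal (real k * dist y z)) + ennreal (real k * dist x y)"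
    by (cases "S = {}") (simp_all add: INF_add_const_ennreal)
  finally show ?thesis
    unfolding lip_env_def
    by (cases "of_nat k \<le> (INF z\<in>S. f z + ennreal (real k * dist y z))")
      (auto simp: min_def add_increasing2 intro: order_trans)
qed

lemma lip_env_continuous: "continuous_on A (\<lambda>x. enn2real (lip_env S k f x))"
proof (rule continuous_onI)
  have 1: "enn2real (lip_env S k f x) \<le> enn2real (lip_env S k f y) + real k * dist x y" for x y
  proof -
    have "lip_env S k f y < top"
      using lip_env_le_of_nat[of S k f y] by (simp add: le_less_trans of_nat_less_top)
    then have "enn2real (lip_env S k f x)
        \<le> enn2real (lip_env S k f y + ennreal (real k * dist x y))"
      by (intro enn2real_mono lip_env_lipschitz) (simp add: ennreal_add_eq_top less_top)
    also have "\<dots> = enn2real (lip_env S k f y) + real k * dist x y"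
      using \<open>lip_env S k f y < top\<close> by (subst enn2real_plus) auto
    finally show ?thesis .
  qed
  fix x e assume "x \<in> A" "(0::real) < e"
  have "dist (enn2real (lip_env S k f y)) (enn2real (lip_env S k f x)) \<le> e"
    if "dist y x < e / (real k + 1)" for y
  proof -
    have "real k * dist x y \<le> (real k + 1) * dist y x"
      by (simp add: dist_commute mult_right_mono)
    also have "\<dots> \<le> e"
      using that by (simp add: field_simps)
    finally show ?thesis
      using 1[of x y] 1[of y x] by (simp add: dist_real_def dist_commute)
  qed
  then show "\<exists>d>0. \<forall>y\<in>A. dist y x < d \<longrightarrow>
      dist (enn2real (lip_env S k f y)) (enn2real (lip_env S k f x)) \<le> e"
    using \<open>0 < e\<close> by (intro exI[of _ "e / (real k + 1)"]) auto
qed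

text \<open>For an increasing sequence \<open>\<phi>\<close>, this says that \<open>f\<close> is bounded on \<open>S\<close> by the joint lower limit of
\<open>\<phi> j z\<close> as \<open>j \<rightarrow> \<infinity>\<close> and \<open>z \<rightarrow> x\<close>. For a constant sequence with value \<open>f\<close> it is lower semicontinuity of
\<open>f\<close>, so that one Fatou lemma covers a single lower semicontinuous function, an increasing sequence
of them, and the relative value functions as the discount factor tends to \<open>1\<close>.\<close>

definition joint_lower :: "'z::metric_space set \<Rightarrow> (nat \<Rightarrow> 'z \<Rightarrow> ennreal) \<Rightarrow> ('z \<Rightarrow> ennreal) \<Rightarrow> bool" where
  "joint_lower S \<phi> f \<longleftrightarrow> (\<forall>j k. j \<le> k \<longrightarrow> (\<forall>z\<in>S. \<phi> j z \<le> \<phi> k z)) \<and>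
     (\<forall>x\<in>S. \<forall>t<f x. \<exists>j. \<exists>R>0. \<forall>z\<in>S. dist z x < R \<longrightarrow> t \<le> \<phi> j z)"

abbreviation lsc_enn :: "'z::metric_space set \<Rightarrow> ('z \<Rightarrow> ennreal) \<Rightarrow> bool" where
  "lsc_enn S f \<equiv> joint_lower S (\<lambda>_. f) f"

lemma joint_lower_incseq:
  "joint_lower S \<phi> f \<Longrightarrow> incseq (\<lambda>j. lip_env S j (\<phi> j))"
  by (intro incseq_SucI le_funI lip_env_mono) (auto simp: joint_lower_def)

text \<open>If \<open>\<phi> j\<close> is at least \<open>t\<close> on a ball of radius \<open>R\<close> around \<open>x\<close>, then points inside the ball contribute at
least \<open>t\<close> to the infimum defining the envelope, and points outside contribute the penalty, which is at
least \<open>j R\<close> and exceeds \<open>t\<close> for large \<open>j\<close>.\<close>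

lemma joint_lower_le_SUP:
  assumes "joint_lower S \<phi> f" and x: "x \<in> S"
  shows "f x \<le> (SUP j. lip_env S j (\<phi> j) x)"
proof (rule dense_le)
  fix t assume t: "t < f x"
  then obtain j0 R where R: "R > 0" "\<And>z. z \<in> S \<Longrightarrow> dist z x < R \<Longrightarrow> t \<le> \<phi> j0 z"
    using assms by (auto simp: joint_lower_def) metis
  from t have "t \<noteq> top" by auto
  then obtain r where r: "t = ennreal r" "0 \<le> r" by (cases t) auto
  \<comment> \<open>large enough for the cut-off, for the penalty outside the ball, and for the given index\<close>
  obtain j where j: "j \<ge> j0" "real j \<ge> r" "real j * R \<ge> r"
  proof -
    obtain j1 :: nat where "r / R \<le> real j1" using real_arch_simple by blast
    moreover obtain j2 :: nat where "r \<le> real j2" using real_arch_simple by blast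
    ultimately have "r / R \<le> real (max j0 (max j1 j2))" "r \<le> real (max j0 (max j1 j2))" by linarith+
    then show thesis using R(1) by (intro that[of "max j0 (max j1 j2)"]) (auto simp: field_simps)
  qed
  have "t \<le> \<phi> j z + ennreal (real j * dist x z)" if "z \<in> S" for z
  proof (cases "dist z x < R")
    case True
    then have "t \<le> \<phi> j0 z" using R that by auto
    also have "\<dots> \<le> \<phi> j z" using assms(1) j(1) that by (auto simp: joint_lower_def)
    finally show ?thesis by (rule order_trans) simp
  next
    case False
    then have "r \<le> real j * dist x z"
      using j(3) by (smt (verit, best) dist_commute mult_left_mono of_nat_0_le_iff)
    then have "t \<le> ennreal (real j * dist x z)" unfolding r by (rule ennreal_leI)
    then show ?thesis by (rule order_trans) simp
  qed
  moreover have "t \<le> of_nat j" using j(2) r by (metis ennreal_leI ennreal_of_nat_eq_real_of_nat)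
  ultimately have "t \<le> lip_env S j (\<phi> j) x" unfolding lip_env_def by (auto intro!: INF_greatest)
  also have "\<dots> \<le> (SUP j. lip_env S j (\<phi> j) x)" by (rule SUP_upper) simp
  finally show "t \<le> (SUP j. lip_env S j (\<phi> j) x)" .
qed

lemma lip_env_measurable [measurable]: "lip_env S k f \<in> borel_measurable borel"
proof -
  have "(\<lambda>x. ennreal (enn2real (lip_env S k f x))) \<in> borel_measurable borel"
    by (intro measurable_compose[OF borel_measurable_continuous_onI measurable_ennreal]
        lip_env_continuous)
  moreover have "ennreal (enn2real (lip_env S k f x)) = lip_env S k f x" for x
    using lip_env_le_of_nat[of S k f x]
    by (intro ennreal_enn2real) (simp add: le_less_trans of_nat_less_top)
  ultimately show ?thesis by simp
qed

text \<open>A lower semicontinuous function is the supremum of its continuous envelopes.\<close>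

lemma lsc_enn_measurable:
  assumes "lsc_enn S f"
  shows "f \<in> borel_measurable (restrict_space borel S)"
proof -
  have "(\<lambda>x. SUP j. lip_env S j f x) \<in> borel_measurable (restrict_space borel S)"
    by (intro borel_measurable_SUP measurable_restrict_space1) auto
  then show ?thesis
  proof (rule measurable_cong[THEN iffD1, rotated])
    fix x assume "x \<in> space (restrict_space borel S)"
    then have "x \<in> S" by (auto simp: space_restrict_space)
    then show "(SUP j. lip_env S j f x) = f x"
      using joint_lower_le_SUP[OF assms] by (intro antisym SUP_least lip_env_le) auto
  qed
qed

text \<open>Lower semicontinuity from closedness of the sublevel sets under sequences, the form in which the limit
principle delivers it.\<close>

lemma lsc_enn_seqI:
  assumes "\<And>x xs K. x \<in> S \<Longrightarrow> (\<And>n. xs n \<in> S) \<Longrightarrow> xs \<longlonglongrightarrow> x \<Longrightarrow> K < top \<Longrightarrow> (\<And>n. f (xs n) \<le> K) \<Longrightarrow> f x \<le> K"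
  shows "lsc_enn S f"
  unfolding joint_lower_def
proof (intro conjI ballI allI impI)
  fix x t assume x: "x \<in> S" and t: "t < f x"
  show "\<exists>j::nat. \<exists>R>0. \<forall>z\<in>S. dist z x < R \<longrightarrow> t \<le> f z"
  proof (rule ccontr)
    assume "\<not> ?thesis"
    then have "\<forall>n. \<exists>z. z \<in> S \<and> dist z x < inverse (Suc n) \<and> f z < t"
      by (metis inverse_positive_iff_positive of_nat_0_less_iff zero_less_Suc not_le)
    then obtain xs where xs: "\<And>n. xs n \<in> S" "\<And>n. dist (xs n) x < inverse (Suc n)" "\<And>n. f (xs n) < t"
      by metis
    have "(\<lambda>n. dist (xs n) x) \<longlonglongrightarrow> 0"
      using xs(2) by (intro tendsto_sandwich[OF _ _ tendsto_const LIMSEQ_inverse_real_of_nat])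
        (auto intro!: always_eventually less_imp_le)
    then have "xs \<longlonglongrightarrow> x" by (rule tendsto_dist_iff[THEN iffD2])
    moreover have "t < top" using t by (rule less_le_trans) simp
    ultimately have "f x \<le> t"
      using assms[OF x xs(1)] xs(3) by (simp add: less_imp_le)
    then show False using t by auto
  qed
qed auto

lemma lsc_enn_SUP:
  assumes "\<And>j. lsc_enn S (\<phi> j)" "\<And>j k x. j \<le> k \<Longrightarrow> x \<in> S \<Longrightarrow> \<phi> j x \<le> \<phi> k x"
  shows "joint_lower S \<phi> (\<lambda>x. SUP j. \<phi> j x)"
  unfolding joint_lower_def
proof (intro conjI ballI allI impI)
  fix x t assume x: "x \<in> S" and "t < (SUP j. \<phi> j x)"
  then obtain j where "t < \<phi> j x" by (auto simp: less_SUP_iff)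
  then have "\<exists>R>0. \<forall>z\<in>S. dist z x < R \<longrightarrow> t \<le> \<phi> j z"
    using assms(1)[of j] x unfolding joint_lower_def by blast
  then show "\<exists>j. \<exists>R>0. \<forall>z\<in>S. dist z x < R \<longrightarrow> t \<le> \<phi> j z" by (rule exI)
qed (use assms in auto)

lemma joint_lower_lsc:
  assumes "joint_lower S \<phi> f" "\<And>j z. z \<in> S \<Longrightarrow> \<phi> j z \<le> g z"
  shows "joint_lower S (\<lambda>_. g) f"
  using assms unfolding joint_lower_def by (meson order_trans order_refl)

section \<open>Borel selection from compact sets\<close>

text \<open>A selection theorem of Kuratowski and Ryll-Nardzewski for compact values: the hypothesis that hitting
sets of closed sets are measurable survives intersecting \<open>F x\<close> with the first closed ball of radius
\<open>1 / (n + 1)\<close> around a point of a countable dense set that meets it. The nested intersection shrinks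
to one point, and by compactness that point lies in a closed \<open>D\<close> exactly if all the approximating
sets meet \<open>D\<close>.\<close>

lemma compact_selection:
  fixes F :: "'x \<Rightarrow> 'a::polish_space set"
  assumes compact: "\<And>x. x \<in> space N \<Longrightarrow> compact (F x)"
    and nonempty: "\<And>x. x \<in> space N \<Longrightarrow> F x \<noteq> {}"
    and hit: "\<And>D. closed D \<Longrightarrow> {x\<in>space N. F x \<inter> D \<noteq> {}} \<in> sets N"
  shows "\<exists>\<psi>. \<psi> \<in> borel_measurable N \<and> (\<forall>x\<in>space N. \<psi> x \<in> F x)"
proof -
  obtain X :: "'a set" where X: "countable X" "\<And>p U. open U \<Longrightarrow> U \<noteq> {} \<Longrightarrow> \<exists>d\<in>X. d \<in> U"
    using countable_dense_setE by metis
  then have "X \<noteq> {}" by (metis UNIV_not_empty open_UNIV empty_iff)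
  define d where "d = from_nat_into X"
  have dense: "\<exists>i. dist y (d i) \<le> e" if "e > 0" for y e
  proof -
    have "ball y e \<noteq> {}" using that by (metis centre_in_ball empty_iff)
    then obtain z where z: "z \<in> X" "z \<in> ball y e" using X(2)[OF open_ball] by blast
    obtain i where "d i = z" using from_nat_into_surj[OF X(1) z(1)] by (auto simp: d_def)
    then have "dist y (d i) \<le> e" using z(2) by simp
    then show ?thesis by (rule exI)
  qed
  define B where "B n i = cball (d i) (inverse (real (Suc n)))" for n i
  \<comment> \<open>the first ball of the \<open>n\<close>-th family that meets the set\<close>
  define step where "step n A = A \<inter> B n (LEAST i. A \<inter> B n i \<noteq> {})" for n A
  define Fn where "Fn x = rec_nat (F x) step" for x
  have Fn_0: "Fn x 0 = F x" and Fn_Suc: "Fn x (Suc n) = step n (Fn x n)" for x n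
    by (auto simp: Fn_def)
  have ex_ball: "\<exists>i. A \<inter> B n i \<noteq> {}" if ne: "A \<noteq> {}" for A n
  proof -
    obtain y where "y \<in> A" using ne by auto
    moreover obtain i where "dist y (d i) \<le> inverse (real (Suc n))"
      using dense[of "inverse (real (Suc n))" y] by auto
    ultimately have "y \<in> A \<inter> B n i" by (simp add: B_def dist_commute)
    then show ?thesis by blast
  qed
  have step_ne: "step n A \<noteq> {}" if "A \<noteq> {}" for n A
    using LeastI_ex[OF ex_ball[OF that]] by (auto simp: step_def)
  have ne: "Fn x n \<noteq> {}" if "x \<in> space N" for x n
    using that by (induction n) (auto simp: Fn_0 Fn_Suc nonempty step_ne)
  have comp: "compact (Fn x n)" if "x \<in> space N" for x n
    using that by (induction n) (auto simp: Fn_0 Fn_Suc compact step_def B_def intro!: compact_Int_closed)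
  have dec: "decseq (Fn x)" for x
    by (rule decseq_SucI) (auto simp: Fn_Suc step_def)
  have hit_n: "{x\<in>space N. Fn x n \<inter> D \<noteq> {}} \<in> sets N" if "closed D" for n D
    using that
  proof (induction n arbitrary: D)
    case 0 then show ?case using hit by (simp add: Fn_0)
  next
    case (Suc n)
    have "{x\<in>space N. Fn x (Suc n) \<inter> D \<noteq> {}} =
      (\<Union>i. ({x\<in>space N. Fn x n \<inter> B n i \<inter> D \<noteq> {}}) \<inter> {x\<in>space N. Fn x n \<inter> B n i \<noteq> {}}
         - (\<Union>j\<in>{..<i}. {x\<in>space N. Fn x n \<inter> B n j \<noteq> {}}))" (is "?L = ?R")
    proof (intro equalityI subsetI)
      fix x assume x: "x \<in> ?L"
      define i where "i = (LEAST i. Fn x n \<inter> B n i \<noteq> {})"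
      have "Fn x n \<inter> B n i \<noteq> {}"
        unfolding i_def using x by (rule_tac LeastI_ex[OF ex_ball[OF ne]]) auto
      moreover have "Fn x n \<inter> B n j = {}" if "j < i" for j
        using not_less_Least[OF that[unfolded i_def]] by auto
      ultimately show "x \<in> ?R"
        using x by (intro UN_I[of i]) (auto simp: Fn_Suc step_def i_def[symmetric])
    next
      fix x assume "x \<in> ?R"
      then obtain i where i: "x \<in> space N" "Fn x n \<inter> B n i \<inter> D \<noteq> {}"
         "\<And>j. j < i \<Longrightarrow> Fn x n \<inter> B n j = {}" by auto
      then have "(LEAST i. Fn x n \<inter> B n i \<noteq> {}) = i"
        by (intro Least_equality) (auto intro: leI)
      then show "x \<in> ?L" using i by (auto simp: Fn_Suc step_def)
    qed
    moreover have "{x\<in>space N. Fn x n \<inter> B n i \<noteq> {}} \<in> sets N"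
      "{x\<in>space N. Fn x n \<inter> B n i \<inter> D \<noteq> {}} \<in> sets N" for i
      using Suc.IH[of "B n i"] Suc.IH[of "B n i \<inter> D"] Suc.prems
      by (simp_all add: B_def closed_Int Int_assoc)
    then have "?R \<in> sets N"
      by (intro sets.countable_UN' sets.Diff sets.Int) auto
    ultimately show ?case by simp
  qed
  define \<psi> where "\<psi> x = (SOME a. a \<in> (\<Inter>n. Fn x n))" for x
  have \<psi>: "\<psi> x \<in> Fn x n" if "x \<in> space N" for x n
  proof -
    have "Fn x 0 \<inter> \<Inter>(Fn x ` UNIV) \<noteq> {}"
    proof (rule compact_imp_fip_image[OF comp[OF that]])
      show "closed (Fn x i)" for i using comp[OF that] by (rule compact_imp_closed)
      fix I :: "nat set" assume "finite I"
      then have "Fn x (Max (insert 0 I)) \<subseteq> Fn x 0 \<inter> \<Inter>(Fn x ` I)"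
        by (intro Int_greatest INT_greatest decseqD[OF dec]) auto
      then show "Fn x 0 \<inter> \<Inter>(Fn x ` I) \<noteq> {}" using ne[OF that] by blast
    qed
    then have "(\<Inter>n. Fn x n) \<noteq> {}" by auto
    then have "\<psi> x \<in> (\<Inter>n. Fn x n)" unfolding \<psi>_def by (metis (lifting) ex_in_conv someI_ex)
    then show ?thesis by auto
  qed
  have \<psi>_in: "\<psi> x \<in> D \<longleftrightarrow> (\<forall>n. Fn x n \<inter> D \<noteq> {})" if x: "x \<in> space N" and D: "closed D" for x D
  proof
    assume "\<psi> x \<in> D" then show "\<forall>n. Fn x n \<inter> D \<noteq> {}" using \<psi>[OF x] by auto
  next
    assume hits: "\<forall>n. Fn x n \<inter> D \<noteq> {}"
    have "\<exists>a. \<forall>n. a n \<in> Fn x (Suc n) \<inter> D" by (rule choice) (use hits in blast)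
    then obtain a where a: "\<And>n. a n \<in> Fn x (Suc n)" "\<And>n. a n \<in> D" by blast
    have "dist (a n) (\<psi> x) \<le> 2 * inverse (real (Suc n))" for n
    proof -
      obtain c where c: "Fn x (Suc n) \<subseteq> cball c (inverse (real (Suc n)))"
        by (auto simp: Fn_Suc step_def B_def)
      have "dist c (a n) \<le> inverse (real (Suc n))" "dist c (\<psi> x) \<le> inverse (real (Suc n))"
        using a(1) \<psi>[OF x, of "Suc n"] c by (auto simp: subset_eq)
      then show ?thesis using dist_triangle3[of "a n" "\<psi> x" c] by linarith
    qed
    note le = this
    have "(\<lambda>n. 2 * inverse (real (Suc n))) \<longlonglongrightarrow> 2 * 0"
      by (intro tendsto_mult_left LIMSEQ_inverse_real_of_nat)
    then have "(\<lambda>n. 2 * inverse (real (Suc n))) \<longlonglongrightarrow> 0" by simp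
    then have "(\<lambda>n. dist (a n) (\<psi> x)) \<longlonglongrightarrow> 0"
      by (rule Lim_null_comparison[rotated]) (use le in simp)
    then have "a \<longlonglongrightarrow> \<psi> x" by (rule tendsto_dist_iff[THEN iffD2])
    then show "\<psi> x \<in> D" using D a(2) by (rule_tac closed_sequentially)
  qed
  have "\<psi> \<in> borel_measurable N"
  proof (rule borel_measurableI)
    fix U :: "'a set" assume "open U"
    then have cl: "closed (- U)" by (simp add: closed_Compl)
    have "\<psi> -` U \<inter> space N = space N - (\<Inter>n. {x\<in>space N. Fn x n \<inter> - U \<noteq> {}})"
    proof (intro equalityI subsetI)
      fix x assume "x \<in> \<psi> -` U \<inter> space N"
      then have "x \<in> space N" "\<psi> x \<notin> - U" by auto
      then show "x \<in> space N - (\<Inter>n. {x\<in>space N. Fn x n \<inter> - U \<noteq> {}})"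
        using \<psi>_in[OF _ cl] by blast
    next
      fix x assume x: "x \<in> space N - (\<Inter>n. {x\<in>space N. Fn x n \<inter> - U \<noteq> {}})"
      then have "\<psi> x \<notin> - U" using \<psi>_in[OF _ cl] by blast
      then show "x \<in> \<psi> -` U \<inter> space N" using x by auto
    qed
    also have "\<dots> \<in> sets N"
      using hit_n[OF cl] by (intro sets.Diff sets.countable_INT) auto
    finally show "\<psi> -` U \<inter> space N \<in> sets N" .
  qed
  then show ?thesis using \<psi>[of _ 0] by (auto simp: Fn_0)
qed

section \<open>The limit principle for actions\<close>

text \<open>The constant \<open>L\<close> makes \<open>cost + L\<close> nonnegative; it is itself taken nonnegative so that the negative
part of the cost is bounded by \<open>L\<close>.\<close>

locale shifted_MDP = MDP M for M :: "('x::polish_space, 'a::polish_space) mdp" +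
  fixes L :: real
  assumes W: "assumption_W M"
    and L_nonneg: "0 \<le> L"
    and cost_ge: "z \<in> gr M (avail M) \<Longrightarrow> ereal (- L) \<le> cost M z"
begin

abbreviation S where "S \<equiv> states M"
abbreviation G where "G \<equiv> gr M (avail M)"

text \<open>The cost is arbitrary outside the graph of the available actions. The value \<open>0\<close> there makes \<open>pcost\<close>
Borel on the whole product, which the integrals along trajectories need.\<close>

definition pcost :: "'x \<times> 'a \<Rightarrow> ennreal" where
  "pcost z = (if z \<in> G then e2ennreal (cost M z + ereal L) else 0)"

abbreviation Q :: "('x \<Rightarrow> ennreal) \<Rightarrow> 'x \<times> 'a \<Rightarrow> ennreal" where
  "Q f z \<equiv> \<integral>\<^sup>+y. f y \<partial>trans_prob M z"

lemma mem_G: "(x, a) \<in> G \<longleftrightarrow> x \<in> S \<and> a \<in> avail M x"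
  by (simp add: gr_def)

lemma pcost_shift: "z \<in> G \<Longrightarrow> enn2ereal (pcost z) - ereal L = cost M z"
  using cost_ge[of z]
  by (cases "cost M z") (auto simp: pcost_def enn2ereal_e2ennreal)

lemma cost_eq: "z \<in> G \<Longrightarrow> cost M z + ereal L = enn2ereal (pcost z)"
  using cost_ge[of z]
  by (cases "cost M z") (auto simp: pcost_def enn2ereal_e2ennreal)

lemma pcost_measurable [measurable]: "pcost \<in> borel_measurable borel"
proof -
  have "(\<lambda>z. e2ennreal (cost M z + ereal L)) \<in> borel_measurable (restrict_space borel G)"
    using cost_borel by measurable
  then show ?thesis
    unfolding pcost_def[abs_def] using gr_in_borel
    by (subst measurable_If_restrict_space_iff) (auto simp: Int_def)
qed

lemma trans_prob_space:
  assumes "z \<in> G"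
  shows "prob_space (trans_prob M z)" "sets (trans_prob M z) = sets (states_borel M)"
    "space (trans_prob M z) = S"
proof -
  have "trans_prob M z \<in> space (prob_algebra (states_borel M))"
    using assms by (intro measurable_space[OF trans_prob_kernel]) (simp add: space_restrict_space)
  then show "prob_space (trans_prob M z)" and *: "sets (trans_prob M z) = sets (states_borel M)"
    by (auto simp: space_prob_algebra)
  show "space (trans_prob M z) = S"
    using sets_eq_imp_space_eq[OF *] by (simp add: space_restrict_space)
qed

lemma borel_measurable_trans_prob:
  assumes "z \<in> G" "f \<in> borel_measurable (states_borel M)"
  shows "f \<in> borel_measurable (trans_prob M z)"
  using assms trans_prob_space(2)[OF assms(1)] by (simp cong: measurable_cong_sets)

lemma Q_mono: "z \<in> G \<Longrightarrow> (\<And>y. y \<in> S \<Longrightarrow> f y \<le> g y) \<Longrightarrow> Q f z \<le> Q g z"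
  by (rule nn_integral_mono) (simp add: trans_prob_space)

lemma Q_cong: "z \<in> G \<Longrightarrow> (\<And>y. y \<in> S \<Longrightarrow> f y = g y) \<Longrightarrow> Q f z = Q g z"
  by (rule nn_integral_cong) (simp add: trans_prob_space)

lemma weakly_continuous:
  assumes "continuous_on S (f :: 'x \<Rightarrow> real)" "bounded (f ` S)" "\<And>n. zs n \<in> G" "z \<in> G" "zs \<longlonglongrightarrow> z"
  shows "(\<lambda>k. \<integral>y. f y \<partial>trans_prob M (zs k)) \<longlonglongrightarrow> (\<integral>y. f y \<partial>trans_prob M z)"
  using W assms unfolding assumption_W_def by (meson image_subset_iff)

text \<open>The envelopes are bounded and continuous, so weak continuity of the kernel applies to them after
passing to their real values.\<close>

lemma Q_lip_env_tendsto:
  assumes "\<And>n. zs n \<in> G" "z \<in> G" "zs \<longlonglongrightarrow> z"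
  shows "(\<lambda>n. Q (lip_env S j \<phi>) (zs n)) \<longlonglongrightarrow> Q (lip_env S j \<phi>) z"
proof -
  let ?e = "\<lambda>y. enn2real (lip_env S j \<phi> y)"
  have fin: "lip_env S j \<phi> y < top" for y
    using lip_env_le_of_nat[of S j \<phi> y] by (simp add: le_less_trans of_nat_less_top)
  have bnd: "?e y \<le> real j" for y
    using enn2real_mono[OF lip_env_le_of_nat[of S j \<phi> y]] by (simp add: of_nat_less_top)
  have eq: "Q (lip_env S j \<phi>) w = ennreal (\<integral>y. ?e y \<partial>trans_prob M w)" if w: "w \<in> G" for w
  proof -
    interpret prob_space "trans_prob M w" by (rule trans_prob_space[OF w])
    have "Q (lip_env S j \<phi>) w = (\<integral>\<^sup>+y. ennreal (?e y) \<partial>trans_prob M w)"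
      using fin by (intro nn_integral_cong) simp
    also have "\<dots> = ennreal (\<integral>y. ?e y \<partial>trans_prob M w)"
    proof (rule nn_integral_eq_integral)
      have "?e \<in> borel_measurable (trans_prob M w)"
        by (intro borel_measurable_trans_prob w measurable_restrict_space1) simp
      then show "integrable (trans_prob M w) ?e"
        using bnd by (intro integrable_const_bound[of _ "real j"]) auto
    qed auto
    finally show ?thesis .
  qed
  have "bounded (?e ` S)"
    using bnd by (intro boundedI[of _ "real j"]) auto
  then have "(\<lambda>k. \<integral>y. ?e y \<partial>trans_prob M (zs k)) \<longlonglongrightarrow> (\<integral>y. ?e y \<partial>trans_prob M z)"
    by (intro weakly_continuous lip_env_continuous assms)
  then show ?thesis
    using assms by (simp add: eq tendsto_ennrealI)
qed

text \<open>Fatou's lemma with varying functions and varying measures. Each envelope of \<open>\<phi> j\<close> is eventually below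
\<open>F n\<close> and its integrals converge; monotone convergence over \<open>j\<close> then reaches \<open>f\<close>.\<close>

lemma fatou_kernel:
  assumes jl: "joint_lower S \<phi> f"
    and ev: "\<And>j. eventually (\<lambda>n. \<forall>z\<in>S. \<phi> j z \<le> F n z) sequentially"
    and zs: "\<And>n. zs n \<in> G" "z \<in> G" "zs \<longlonglongrightarrow> z"
  shows "Q f z \<le> liminf (\<lambda>n. Q (F n) (zs n))"
proof -
  have "Q f z \<le> Q (\<lambda>y. SUP j. lip_env S j (\<phi> j) y) z"
    using joint_lower_le_SUP[OF jl] by (intro Q_mono zs)
  also have "\<dots> = (SUP j. Q (lip_env S j (\<phi> j)) z)"
    by (intro nn_integral_monotone_convergence_SUP joint_lower_incseq[OF jl]
        borel_measurable_trans_prob zs measurable_restrict_space1) simp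
  also have "\<dots> \<le> liminf (\<lambda>n. Q (F n) (zs n))"
  proof (rule SUP_least)
    fix j
    have "Q (lip_env S j (\<phi> j)) z = liminf (\<lambda>n. Q (lip_env S j (\<phi> j)) (zs n))"
      using Q_lip_env_tendsto[OF zs] by (intro lim_imp_Liminf[symmetric]) auto
    also have "\<dots> \<le> liminf (\<lambda>n. Q (F n) (zs n))"
    proof (rule Liminf_mono)
      show "\<forall>\<^sub>F n in sequentially. Q (lip_env S j (\<phi> j)) (zs n) \<le> Q (F n) (zs n)"
        using ev[of j]
      proof eventually_elim
        case (elim n)
        then show ?case
          by (intro Q_mono zs) (auto intro: order_trans[OF lip_env_le])
      qed
    qed
    finally show "Q (lip_env S j (\<phi> j)) z \<le> liminf (\<lambda>n. Q (F n) (zs n))" .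
  qed
  finally show ?thesis .
qed

lemma pcost_lsc:
  assumes zs: "\<And>n. zs n \<in> G" "z \<in> G" "zs \<longlonglongrightarrow> z"
  shows "pcost z \<le> liminf (\<lambda>n. pcost (zs n))"
  unfolding le_Liminf_iff
proof (intro allI impI)
  fix t assume t: "t < pcost z"
  have le: "cost M z \<le> Liminf (at z within G) (cost M)"
    using W zs(2) by (auto simp: assumption_W_def lsc_on_def)
  have pos: "0 \<le> cost M w + ereal L" if "w \<in> G" for w
    using cost_ge[OF that] by (cases "cost M w") auto
  have conv: "t < pcost w \<longleftrightarrow> enn2ereal t - ereal L < cost M w" if "w \<in> G" for w
  proof -
    have "t < pcost w \<longleftrightarrow> enn2ereal t < cost M w + ereal L"
      using that by (simp add: less_ennreal.rep_eq cost_eq)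
    also have "\<dots> \<longleftrightarrow> enn2ereal t - ereal L < cost M w"
      by (cases "enn2ereal t"; cases "cost M w") auto
    finally show ?thesis .
  qed
  have "enn2ereal t - ereal L < cost M z" using t conv[OF zs(2)] by simp
  then have "\<forall>\<^sub>F w in at z within G. enn2ereal t - ereal L < cost M w"
    using le by (simp add: le_Liminf_iff)
  then have "\<forall>\<^sub>F w in at z within G. t < pcost w"
    using conv by (simp add: eventually_at_filter)
  then obtain U where U: "open U" "z \<in> U" "\<And>w. w \<in> U \<Longrightarrow> w \<noteq> z \<Longrightarrow> w \<in> G \<Longrightarrow> t < pcost w"
    by (auto simp: eventually_at_topological)
  have "\<forall>\<^sub>F n in sequentially. zs n \<in> U"
    using zs(3) U(1,2) by (rule topological_tendstoD)
  then show "\<forall>\<^sub>F n in sequentially. t < pcost (zs n)"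
    by eventually_elim (use U(3) zs(1) t in metis)
qed

text \<open>The central compactness argument. Bounded one-step values force bounded costs, so the second part of
the assumption on the model supplies a convergent subsequence of actions with admissible limit; along it
the cost and the integral are lower semicontinuous by \<open>pcost_lsc\<close> and \<open>fatou_kernel\<close>.\<close>

lemma limit_action:
  assumes jl: "joint_lower S \<phi> f"
    and ev: "\<And>j. eventually (\<lambda>n. \<forall>z\<in>S. \<phi> j z \<le> F n z) sequentially"
    and x: "\<And>n. xs n \<in> S" "x \<in> S" "xs \<longlonglongrightarrow> x"
    and a: "\<And>n. as n \<in> avail M (xs n)"
    and le: "\<And>n. pcost (xs n, as n) + \<gamma> n * Q (F n) (xs n, as n) \<le> K n"
    and lim: "\<gamma> \<longlonglongrightarrow> \<gamma>'" "K \<longlonglongrightarrow> K'" "K' < top"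
  shows "\<exists>a r. a \<in> avail M x \<and> strict_mono r \<and> (as \<circ> r) \<longlonglongrightarrow> a \<and> pcost (x, a) + \<gamma>' * Q f (x, a) \<le> K'"
proof -
  \<comment> \<open>any finite number above the limit eventually bounds the one-step values\<close>
  obtain k where k: "K' < ennreal k" "0 \<le> k"
  proof -
    from lim(3) obtain k where "K' = ennreal k" "0 \<le> k" by (cases K') auto
    then show thesis by (intro that[of "k + 1"]) (auto simp: ennreal_less_iff)
  qed
  obtain N where N: "\<And>n. n \<ge> N \<Longrightarrow> K n < ennreal k"
    using order_tendstoD(2)[OF lim(2) k(1)] by (auto simp: eventually_sequentially)
  have "cost M (xs (N + n), as (N + n)) \<le> ereal k" for n
  proof -
    have z: "(xs (N + n), as (N + n)) \<in> G" using x a by (simp add: mem_G)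
    have "pcost (xs (N + n), as (N + n)) \<le> K (N + n)"
      using le[of "N + n"] by (rule order_trans[rotated]) simp
    also have "\<dots> \<le> ennreal k" using N[of "N + n"] by simp
    finally have "enn2ereal (pcost (xs (N + n), as (N + n))) \<le> ereal k"
      using k(2) by (simp add: less_eq_ennreal.rep_eq enn2ereal_ennreal)
    then show ?thesis
      using L_nonneg cost_eq[OF z, symmetric] by (cases "cost M (xs (N + n), as (N + n))") auto
  qed
  moreover have "(\<lambda>n. xs (N + n)) \<longlonglongrightarrow> x"
    using x(3) LIMSEQ_ignore_initial_segment[of xs x N] by (simp add: add.commute)
  ultimately have "\<exists>a\<in>avail M x. \<exists>r. strict_mono (r :: nat \<Rightarrow> nat) \<and> ((\<lambda>n. as (N + n)) \<circ> r) \<longlonglongrightarrow> a"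
    using W x(1,2) a unfolding assumption_W_def
    by (elim conjE allE[of _ "\<lambda>n. xs (N + n)"] allE[of _ x] allE[of _ "\<lambda>n. as (N + n)"]) blast
  then obtain b s where b: "b \<in> avail M x" "strict_mono s" "((\<lambda>n. as (N + n)) \<circ> s) \<longlonglongrightarrow> b"
    by blast
  define r where "r n = N + s n" for n
  have r: "strict_mono r" using b(2) by (auto simp: r_def strict_mono_def)
  have r_top: "filterlim r sequentially sequentially" by (rule filterlim_subseq[OF r])
  have asr: "(as \<circ> r) \<longlonglongrightarrow> b" using b(3) by (simp add: r_def comp_def)
  have xsr: "(xs \<circ> r) \<longlonglongrightarrow> x" using x(3) r by (rule LIMSEQ_subseq_LIMSEQ)
  define zs where "zs n = (xs (r n), as (r n))" for n
  have zs: "\<And>n. zs n \<in> G" "(x, b) \<in> G" "zs \<longlonglongrightarrow> (x, b)"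
    using x a b(1) tendsto_Pair[OF xsr asr] by (auto simp: zs_def[abs_def] mem_G comp_def)
  have "\<gamma>' = liminf (\<lambda>n. \<gamma> (r n))"
    using filterlim_compose[OF lim(1) r_top] by (intro lim_imp_Liminf[symmetric]) auto
  moreover have "Q f (x, b) \<le> liminf (\<lambda>n. Q (F (r n)) (zs n))"
    using zs by (intro fatou_kernel[OF jl] eventually_compose_filterlim[OF ev r_top])
  ultimately have "\<gamma>' * Q f (x, b) \<le> liminf (\<lambda>n. \<gamma> (r n)) * liminf (\<lambda>n. Q (F (r n)) (zs n))"
    by (simp add: mult_left_mono)
  then have "pcost (x, b) + \<gamma>' * Q f (x, b)
      \<le> liminf (\<lambda>n. pcost (zs n)) + liminf (\<lambda>n. \<gamma> (r n) * Q (F (r n)) (zs n))"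
    by (intro add_mono pcost_lsc zs order_trans[OF _ liminf_mult_ennreal])
  also have "\<dots> \<le> liminf (\<lambda>n. pcost (zs n) + \<gamma> (r n) * Q (F (r n)) (zs n))"
    by (rule liminf_add_ennreal)
  also have "\<dots> \<le> liminf (\<lambda>n. K (r n))"
    using le by (intro Liminf_mono always_eventually) (simp add: zs_def)
  also have "\<dots> = K'"
    using filterlim_compose[OF lim(2) r_top] by (intro lim_imp_Liminf) auto
  finally show ?thesis using b(1) r asr by blast
qed

lemma limit_action_lsc:
  assumes f: "lsc_enn S f" and D: "closed D"
    and x: "\<And>n. xs n \<in> S" "x \<in> S" "xs \<longlonglongrightarrow> x"
    and a: "\<And>n. as n \<in> avail M (xs n)" "\<And>n. (xs n, as n) \<in> D"
    and le: "\<And>n. pcost (xs n, as n) + \<gamma> * Q f (xs n, as n) \<le> K n"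
    and K: "K \<longlonglongrightarrow> K'" "K' < top"
  shows "\<exists>a r. a \<in> avail M x \<and> (x, a) \<in> D \<and> strict_mono r \<and> (as \<circ> r) \<longlonglongrightarrow> a \<and>
    pcost (x, a) + \<gamma> * Q f (x, a) \<le> K'"
proof -
  have "\<exists>a r. a \<in> avail M x \<and> strict_mono r \<and> (as \<circ> r) \<longlonglongrightarrow> a \<and> pcost (x, a) + \<gamma> * Q f (x, a) \<le> K'"
    by (rule limit_action[OF f _ x a(1) le tendsto_const K]) simp
  then obtain b r where b: "b \<in> avail M x" "strict_mono r" "(as \<circ> r) \<longlonglongrightarrow> b"
      "pcost (x, b) + \<gamma> * Q f (x, b) \<le> K'" by blast
  have "(\<lambda>n. (xs (r n), as (r n))) \<longlonglongrightarrow> (x, b)"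
    using tendsto_Pair[OF LIMSEQ_subseq_LIMSEQ[OF x(3) b(2)] b(3)] by (simp add: comp_def)
  then have "(x, b) \<in> D" by (rule closed_sequentially[OF D, rotated]) (rule a(2))
  with b show ?thesis by blast
qed

section \<open>One-step minimisation\<close>

text \<open>The constraint set \<open>D\<close> on state-action pairs serves two purposes: with \<open>D = UNIV\<close> this is the Bellman
operator, and with a closed \<open>D\<close> it decides whether a sublevel set of actions meets a given closed set,
as selection requires.\<close>

definition bellman :: "('x \<times> 'a) set \<Rightarrow> ennreal \<Rightarrow> ('x \<Rightarrow> ennreal) \<Rightarrow> 'x \<Rightarrow> ennreal" where
  "bellman D \<gamma> f x = (INF a\<in>{a\<in>avail M x. (x, a) \<in> D}. pcost (x, a) + \<gamma> * Q f (x, a))"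

lemma bellman_attained:
  assumes f: "lsc_enn S f" and D: "closed D" and x: "x \<in> S" and fin: "bellman D \<gamma> f x < top"
  shows "\<exists>a\<in>avail M x. (x, a) \<in> D \<and> pcost (x, a) + \<gamma> * Q f (x, a) = bellman D \<gamma> f x"
proof -
  \<comment> \<open>a minimising sequence of actions at the fixed state\<close>
  let ?K = "\<lambda>n. bellman D \<gamma> f x + ennreal (inverse (Suc n))"
  have "\<exists>a. a \<in> avail M x \<and> (x, a) \<in> D \<and> pcost (x, a) + \<gamma> * Q f (x, a) \<le> ?K n" for n
  proof -
    have "bellman D \<gamma> f x < ?K n"
      using fin by (cases "bellman D \<gamma> f x") (auto simp: ennreal_plus[symmetric] ennreal_less_iff simp del: ennreal_plus)
    then show ?thesis unfolding bellman_def INF_less_iff by (auto intro: less_imp_le)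
  qed
  then obtain as where as: "\<And>n. as n \<in> avail M x" "\<And>n. (x, as n) \<in> D"
     "\<And>n. pcost (x, as n) + \<gamma> * Q f (x, as n) \<le> ?K n" by metis
  have "?K \<longlonglongrightarrow> bellman D \<gamma> f x + ennreal 0"
    by (intro tendsto_add tendsto_const tendsto_ennrealI LIMSEQ_inverse_real_of_nat)
  then have "?K \<longlonglongrightarrow> bellman D \<gamma> f x" by simp
  then have "\<exists>a r. a \<in> avail M x \<and> (x, a) \<in> D \<and> strict_mono r \<and> (as \<circ> r) \<longlonglongrightarrow> a \<and>
      pcost (x, a) + \<gamma> * Q f (x, a) \<le> bellman D \<gamma> f x"
    by (rule limit_action_lsc[OF f D x x tendsto_const as _ fin])
  then obtain a where a: "a \<in> avail M x" "(x, a) \<in> D"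
      "pcost (x, a) + \<gamma> * Q f (x, a) \<le> bellman D \<gamma> f x" by blast
  from a have "bellman D \<gamma> f x \<le> pcost (x, a) + \<gamma> * Q f (x, a)"
    unfolding bellman_def by (intro INF_lower) auto
  then show ?thesis using a by (auto intro: antisym)
qed

lemma bellman_lsc:
  assumes f: "lsc_enn S f" and D: "closed D"
  shows "lsc_enn S (bellman D \<gamma> f)"
proof (rule lsc_enn_seqI)
  fix x xs K
  assume x: "x \<in> S" and xs: "\<And>n. xs n \<in> S" and lim: "xs \<longlonglongrightarrow> x" and K: "K < top"
    and le: "\<And>n. bellman D \<gamma> f (xs n) \<le> K"
  have "\<exists>a\<in>avail M (xs n). (xs n, a) \<in> D \<and> pcost (xs n, a) + \<gamma> * Q f (xs n, a) = bellman D \<gamma> f (xs n)" for n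
    using le[of n] K by (intro bellman_attained[OF f D] xs) (rule le_less_trans)
  then obtain as where as: "\<And>n. as n \<in> avail M (xs n)" "\<And>n. (xs n, as n) \<in> D"
     "\<And>n. pcost (xs n, as n) + \<gamma> * Q f (xs n, as n) \<le> K" using le by metis
  have "\<exists>a r. a \<in> avail M x \<and> (x, a) \<in> D \<and> strict_mono r \<and> (as \<circ> r) \<longlonglongrightarrow> a \<and>
      pcost (x, a) + \<gamma> * Q f (x, a) \<le> K"
    by (rule limit_action_lsc[OF f D xs x lim as tendsto_const K])
  then obtain a where a: "a \<in> avail M x" "(x, a) \<in> D" "pcost (x, a) + \<gamma> * Q f (x, a) \<le> K"
    by blast
  then have "bellman D \<gamma> f x \<le> pcost (x, a) + \<gamma> * Q f (x, a)"
    unfolding bellman_def using a by (intro INF_lower) auto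
  then show "bellman D \<gamma> f x \<le> K" using a(3) by (rule order_trans)
qed

text \<open>A sequence of actions in the sublevel set has a limit point in it by the limit principle applied to a
constant sequence of states.\<close>

lemma sublevel_compact:
  assumes f: "lsc_enn S f" and D: "closed D" and x: "x \<in> S" and K: "K < top"
  shows "compact {a \<in> avail M x. (x, a) \<in> D \<and> pcost (x, a) + \<gamma> * Q f (x, a) \<le> K}" (is "compact ?A")
  unfolding compact_eq_seq_compact_metric seq_compact_def
proof (intro allI impI)
  fix as :: "nat \<Rightarrow> 'a" assume as: "\<forall>n. as n \<in> ?A"
  then have "\<exists>a r. a \<in> avail M x \<and> (x, a) \<in> D \<and> strict_mono r \<and> (as \<circ> r) \<longlonglongrightarrow> a \<and>
      pcost (x, a) + \<gamma> * Q f (x, a) \<le> K"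
    by (intro limit_action_lsc[OF f D x x tendsto_const _ _ _ tendsto_const K]) auto
  then show "\<exists>l\<in>?A. \<exists>r. strict_mono r \<and> (as \<circ> r) \<longlonglongrightarrow> l" by blast
qed

text \<open>The sublevel set at \<open>x\<close> meets a closed \<open>E\<close> exactly if the minimum over \<open>D\<close> and \<open>E\<close> is at most \<open>g x\<close>,
which is a Borel condition because that minimum is lower semicontinuous and attained. Where \<open>g\<close> is
infinite the sublevel set need not be compact, and the given stationary policy is used instead.\<close>

lemma sublevel_selection:
  assumes f: "lsc_enn S f" and D: "closed D" and g: "g \<in> borel_measurable (states_borel M)"
    and ne: "\<And>x. x \<in> S \<Longrightarrow> g x < top \<Longrightarrow>
      {a \<in> avail M x. (x, a) \<in> D \<and> pcost (x, a) + \<gamma> * Q f (x, a) \<le> g x} \<noteq> {}"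
  shows "\<exists>\<psi>. stationary M \<psi> \<and> (\<forall>x\<in>S. g x < top \<longrightarrow>
     (x, \<psi> x) \<in> D \<and> pcost (x, \<psi> x) + \<gamma> * Q f (x, \<psi> x) \<le> g x)"
proof -
  obtain \<phi>0 where \<phi>0: "stationary M \<phi>0" using ex_stationary by blast
  let ?F = "\<lambda>x. {a \<in> avail M x. (x, a) \<in> D \<and> pcost (x, a) + \<gamma> * Q f (x, a) \<le> g x}"
  have sp: "space (states_borel M) = S" by (simp add: space_restrict_space)
  define S' where "S' = {x \<in> space (states_borel M). g x < top}"
  have S'_sets: "S' \<in> sets (states_borel M)" unfolding S'_def using g by measurable
  let ?N = "restrict_space (states_borel M) S'"
  have spN: "space ?N = S'" by (auto simp: space_restrict_space S'_def)
  have N: "x \<in> S" "g x < top" if "x \<in> space ?N" for x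
    using that by (simp_all only: spN) (simp_all add: S'_def sp)
  have "\<exists>\<psi>. \<psi> \<in> borel_measurable ?N \<and> (\<forall>x\<in>space ?N. \<psi> x \<in> ?F x)"
  proof (rule compact_selection)
    show "compact (?F x)" if "x \<in> space ?N" for x
      using N[OF that] by (intro sublevel_compact f D)
    show "?F x \<noteq> {}" if "x \<in> space ?N" for x
      using N[OF that] by (rule ne)
    fix E :: "'a set" assume E: "closed E"
    have D': "closed (D \<inter> UNIV \<times> E)" by (intro closed_Int D closed_Times closed_UNIV E)
    have m: "bellman (D \<inter> UNIV \<times> E) \<gamma> f \<in> borel_measurable ?N"
      by (intro measurable_restrict_space1 lsc_enn_measurable bellman_lsc f D')
    have "{x \<in> space ?N. ?F x \<inter> E \<noteq> {}} = {x \<in> space ?N. bellman (D \<inter> UNIV \<times> E) \<gamma> f x \<le> g x}"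
    proof (intro Collect_cong conj_cong refl iffI)
      fix x assume "x \<in> space ?N" "?F x \<inter> E \<noteq> {}"
      then obtain a where a: "a \<in> avail M x" "(x, a) \<in> D" "a \<in> E" "pcost (x, a) + \<gamma> * Q f (x, a) \<le> g x"
        by auto
      then have "bellman (D \<inter> UNIV \<times> E) \<gamma> f x \<le> pcost (x, a) + \<gamma> * Q f (x, a)"
        unfolding bellman_def by (intro INF_lower) auto
      then show "bellman (D \<inter> UNIV \<times> E) \<gamma> f x \<le> g x" using a by order
    next
      fix x assume x: "x \<in> space ?N" and le: "bellman (D \<inter> UNIV \<times> E) \<gamma> f x \<le> g x"
      have "bellman (D \<inter> UNIV \<times> E) \<gamma> f x < top"
        using le N(2)[OF x] by (rule le_less_trans)
      then show "?F x \<inter> E \<noteq> {}"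
        using bellman_attained[OF f D' N(1)[OF x], of \<gamma>] le by auto
    qed
    also have "\<dots> \<in> sets ?N"
      using m measurable_restrict_space1[OF g, of S'] by measurable
    finally show "{x \<in> space ?N. ?F x \<inter> E \<noteq> {}} \<in> sets ?N" .
  qed
  then obtain \<psi> where \<psi>: "\<psi> \<in> borel_measurable ?N" "\<And>x. x \<in> S' \<Longrightarrow> \<psi> x \<in> ?F x"
    unfolding spN by blast
  define \<theta> where "\<theta> x = (if x \<in> S' then \<psi> x else \<phi>0 x)" for x
  have "\<phi>0 \<in> borel_measurable (states_borel M)"
    using \<phi>0 unfolding stationary_def by (auto simp: measurable_restrict_space2_iff)
  then have "\<theta> \<in> borel_measurable (states_borel M)"
    unfolding \<theta>_def[abs_def] using S'_sets \<psi>(1) sets.sets_into_space[OF S'_sets]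
    by (subst measurable_If_restrict_space_iff)
      (auto intro: measurable_restrict_space1 simp: Int_absorb1 Int_def[symmetric])
  moreover have "\<theta> x \<in> avail M x" if "x \<in> S" for x
    using \<psi>(2) \<phi>0 that by (auto simp: \<theta>_def stationary_def)
  ultimately have "stationary M \<theta>"
    using avail_subset unfolding stationary_def
    by (auto simp: measurable_restrict_space2_iff space_restrict_space)
  moreover have "(x, \<theta> x) \<in> D \<and> pcost (x, \<theta> x) + \<gamma> * Q f (x, \<theta> x) \<le> g x"
    if "x \<in> S" "g x < top" for x
    using \<psi>(2)[of x] that by (auto simp: \<theta>_def S'_def sp)
  ultimately show ?thesis by blast
qed

end

section \<open>The controlled process\<close>

text \<open>Integrals over trajectories of functions of the first \<open>n\<close> steps reduce to the finite-horizon law.\<close>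

lemma (in Ionescu_Tulcea) nn_integral_lim:
  assumes f: "f \<in> borel_measurable (PiM {0..<n} M)"
  shows "(\<integral>\<^sup>+\<omega>. f (restrict \<omega> {0..<n}) \<partial>PF.lim) = (\<integral>\<^sup>+h. f h \<partial>C 0 n (\<lambda>_. undefined))"
proof -
  have up: "up_to {0..<n} = n"
    by (rule antisym) (simp add: up_to_iff, metis atLeastLessThan_iff finite_atLeastLessThan le0 less_irrefl
        linorder_not_le up_to_iff)
  have r: "(\<lambda>x. restrict x {0..<n}) \<in> measurable PF.lim (PiM {0..<n} M)"
    unfolding measurable_cong_sets[OF PF.sets_lim refl] by (rule measurable_restrict_subset) simp
  have "(\<integral>\<^sup>+\<omega>. f (restrict \<omega> {0..<n}) \<partial>PF.lim)
      = (\<integral>\<^sup>+h. f h \<partial>distr PF.lim (PiM {0..<n} M) (\<lambda>x. restrict x {0..<n}))"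
    by (rule nn_integral_distr[OF r, symmetric]) (use f in simp)
  also have "\<dots> = (\<integral>\<^sup>+h. f h \<partial>distr (C 0 n (\<lambda>_. undefined)) (PiM {0..<n} M) (\<lambda>f. restrict f {0..<n}))"
    by (simp add: distr_lim CI_def up)
  also have "distr (C 0 n (\<lambda>_. undefined)) (PiM {0..<n} M) (\<lambda>f. restrict f {0..<n}) = C 0 n (\<lambda>_. undefined)"
    using distr_C[of n n "\<lambda>_. undefined" 0] by simp
  finally show ?thesis .
qed

lemma (in Ionescu_Tulcea) nn_integral_lim_coordinate:
  assumes f: "f \<in> borel_measurable (M n)"
  shows "(\<integral>\<^sup>+\<omega>. f (\<omega> n) \<partial>PF.lim) = (\<integral>\<^sup>+h. f (h n) \<partial>C 0 (Suc n) (\<lambda>_. undefined))"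
    and "(\<integral>\<^sup>+\<omega>. f (\<omega> n) \<partial>PF.lim) = (\<integral>\<^sup>+h. (\<integral>\<^sup>+z. f z \<partial>P n h) \<partial>C 0 n (\<lambda>_. undefined))"
proof -
  have "(\<lambda>h. h n) \<in> measurable (PiM {0..<Suc n} M) (M n)"
    by (rule measurable_component_singleton) simp
  then have [measurable]: "(\<lambda>h. f (h n)) \<in> borel_measurable (PiM {0..<Suc n} M)"
    using f by (rule measurable_compose)
  show 1: "(\<integral>\<^sup>+\<omega>. f (\<omega> n) \<partial>PF.lim) = (\<integral>\<^sup>+h. f (h n) \<partial>C 0 (Suc n) (\<lambda>_. undefined))"
    using nn_integral_lim[of "\<lambda>h. f (h n)" "Suc n"] by simp
  also have "\<dots> = (\<integral>\<^sup>+h. (\<integral>\<^sup>+h'. f (h' n) \<partial>eP n h) \<partial>C 0 n (\<lambda>_. undefined))"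
    using measurable_eP[of n]
    by (simp add: nn_integral_bind[where B="PiM {0..<Suc n} M"] measurable_cong_sets[OF sets_C refl])
  also have "\<dots> = (\<integral>\<^sup>+h. (\<integral>\<^sup>+z. f z \<partial>P n h) \<partial>C 0 n (\<lambda>_. undefined))"
    by (intro nn_integral_cong) (simp add: nn_integral_eP space_C)
  finally show "(\<integral>\<^sup>+\<omega>. f (\<omega> n) \<partial>PF.lim) = (\<integral>\<^sup>+h. (\<integral>\<^sup>+z. f z \<partial>P n h) \<partial>C 0 n (\<lambda>_. undefined))" .
qed

text \<open>Pointwise, positive part plus \<open>l\<close> equals \<open>f\<close> plus negative part; the integral of the negative part is
at most \<open>l\<close>, hence finite, and may be moved to the other side.\<close>

lemma ereal_integral_shift:
  assumes "prob_space \<mu>" and f: "f \<in> borel_measurable \<mu>"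
    and g: "AE z in \<mu>. g z = enn2ereal (f z) - ereal l" and l: "0 \<le> l"
  shows "ereal_integral \<mu> g = enn2ereal (\<integral>\<^sup>+z. f z \<partial>\<mu>) - ereal l"
proof -
  interpret prob_space \<mu> by fact
  let ?p = "\<lambda>z. e2ennreal (enn2ereal (f z) - ereal l)" and ?m = "\<lambda>z. e2ennreal (- (enn2ereal (f z) - ereal l))"
  have [measurable]: "?p \<in> borel_measurable \<mu>" "?m \<in> borel_measurable \<mu>"
    using f by measurable
  have split: "?p z + ennreal l = f z + ?m z" for z
  proof (cases "f z")
    case (real r)
    then show ?thesis using l
      by (cases "l \<le> r") (auto simp: enn2ereal_ennreal ennreal_plus[symmetric] ennreal_neg simp del: ennreal_plus)
  qed auto
  have m_le: "?m z \<le> ennreal l" for z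
    using l by (cases "f z") (auto simp: enn2ereal_ennreal ennreal_leI e2ennreal_neg)
  have "(\<integral>\<^sup>+z. ?m z \<partial>\<mu>) \<le> (\<integral>\<^sup>+z. ennreal l \<partial>\<mu>)" by (rule nn_integral_mono) (rule m_le)
  also have "\<dots> = ennreal l" by (simp add: emeasure_space_1)
  finally obtain B where B: "(\<integral>\<^sup>+z. ?m z \<partial>\<mu>) = ennreal B" "0 \<le> B"
    by (cases "\<integral>\<^sup>+z. ?m z \<partial>\<mu>") (auto simp: top_unique)
  have "(\<integral>\<^sup>+z. ?p z \<partial>\<mu>) + ennreal l = (\<integral>\<^sup>+z. ?p z + ennreal l \<partial>\<mu>)"
    by (subst nn_integral_add) (auto simp: emeasure_space_1)
  also have "\<dots> = (\<integral>\<^sup>+z. f z \<partial>\<mu>) + ennreal B"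
    using f by (simp add: split nn_integral_add B)
  finally have eq: "(\<integral>\<^sup>+z. ?p z \<partial>\<mu>) + ennreal l = (\<integral>\<^sup>+z. f z \<partial>\<mu>) + ennreal B" .
  have "ereal_integral \<mu> g = enn2ereal (\<integral>\<^sup>+z. ?p z \<partial>\<mu>) - enn2ereal (\<integral>\<^sup>+z. ?m z \<partial>\<mu>)"
    unfolding ereal_integral_def using g by (intro arg_cong2[where f="(-)"] arg_cong[where f=enn2ereal] nn_integral_cong_AE) auto
  also have "\<dots> = enn2ereal (\<integral>\<^sup>+z. f z \<partial>\<mu>) - ereal l"
    using eq B l
    by (cases "\<integral>\<^sup>+z. ?p z \<partial>\<mu>"; cases "\<integral>\<^sup>+z. f z \<partial>\<mu>")
       (auto simp: enn2ereal_ennreal ennreal_plus[symmetric] simp del: ennreal_plus)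
  finally show ?thesis .
qed

lemma enn2ereal_shift_add:
  "(enn2ereal a - ereal r) + (enn2ereal b - ereal s) = enn2ereal (a + b) - ereal (r + s)"
  by (cases a; cases b) (auto simp: plus_ennreal.rep_eq enn2ereal_ennreal)

context shifted_MDP
begin

lemma space_states: "space (states_borel M) = S"
  by (simp add: space_restrict_space)

lemma steps_borel_into_borel: "(\<lambda>z. z) \<in> measurable (steps_borel M) borel"
proof -
  have "(\<lambda>z. (fst z, snd z)) \<in> measurable (steps_borel M) (borel \<Otimes>\<^sub>M borel)"
    by (intro measurable_Pair measurable_compose[OF measurable_fst] measurable_compose[OF measurable_snd]
        measurable_restrict_space1) auto
  then show ?thesis by (simp add: borel_prod)
qed

lemma pcost_steps [measurable]: "pcost \<in> borel_measurable (steps_borel M)"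
  by (rule measurable_compose[OF steps_borel_into_borel pcost_measurable])

lemma G_steps: "{z \<in> space (steps_borel M). z \<in> G} \<in> sets (steps_borel M)"
  using measurable_sets[OF steps_borel_into_borel gr_in_borel] by (simp add: vimage_def Int_def conj_commute)

text \<open>The transition law completed as in \<^const>\<open>state_law\<close>, which makes integrals against it measurable on
the full product space.\<close>

definition kernel :: "'x \<times> 'a \<Rightarrow> 'x measure" where
  "kernel z = (if z \<in> G then trans_prob M z else return (states_borel M) (fst z))"

lemma kernel_measurable: "kernel \<in> measurable (steps_borel M) (prob_algebra (states_borel M))"
  unfolding kernel_def[abs_def]
proof (subst measurable_If_restrict_space_iff[OF G_steps], intro conjI)
  have "(\<lambda>z. z) \<in> measurable (restrict_space (steps_borel M) {z. z \<in> G}) (restrict_space borel G)"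
    by (intro measurable_restrict_space2 measurable_restrict_space1 steps_borel_into_borel)
       (auto simp: space_restrict_space)
  from measurable_compose[OF this trans_prob_kernel]
  show "trans_prob M \<in> measurable (restrict_space (steps_borel M) {z. z \<in> G})
      (prob_algebra (states_borel M))" .
  show "(\<lambda>z. return (states_borel M) (fst z)) \<in> measurable
      (restrict_space (steps_borel M) {z. z \<notin> G}) (prob_algebra (states_borel M))"
    by (intro measurable_restrict_space1 measurable_compose[OF measurable_fst measurable_return_prob_space])
qed

lemma kernel_integral_measurable:
  assumes f: "f \<in> borel_measurable (states_borel M)"
  shows "(\<lambda>z. \<integral>\<^sup>+y. f y \<partial>kernel z) \<in> borel_measurable (steps_borel M)"
  by (rule measurable_compose[OF measurable_prob_algebraD[OF kernel_measurable]
        nn_integral_measurable_subprob_algebra[OF f]])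

context
  fixes \<pi> x
  assumes \<pi>: "\<pi> \<in> policies M" and x: "x \<in> S"
begin

interpretation IT: Ionescu_Tulcea "step_law M \<pi> x" "\<lambda>_. steps_borel M"
  by (rule Ionescu_Tulcea_step_law[OF \<pi> x])

abbreviation "P \<equiv> trajectory_law M \<pi> x"
abbreviation "hist n \<equiv> PiM {0..<n} (\<lambda>_. steps_borel M)"

lemma P_lim: "P = IT.PF.lim"
  by (simp add: trajectory_law_def)

lemma sets_P [measurable_cong]: "sets P = sets (PiM UNIV (\<lambda>_. steps_borel M))"
  unfolding P_lim by (rule IT.PF.sets_lim)

lemma prob_space_P: "prob_space P"
proof (rule prob_spaceI)
  have "(\<integral>\<^sup>+\<omega>. 1 \<partial>P) = (\<integral>\<^sup>+h. 1 \<partial>IT.C 0 0 (\<lambda>_. undefined))"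
    unfolding P_lim using IT.nn_integral_lim[of "\<lambda>_. 1" 0] by simp
  also have "\<dots> = 1"
    using prob_space.emeasure_space_1[OF IT.prob_space_C[of "\<lambda>_. undefined" 0 0]] by (simp add: space_PiM)
  finally show "emeasure P (space P) = 1" by simp
qed

lemma coordinate_measurable: "f \<in> borel_measurable (steps_borel M) \<Longrightarrow> (\<lambda>\<omega>. f (\<omega> n)) \<in> borel_measurable P"
  unfolding measurable_cong_sets[OF sets_P refl]
  by (rule measurable_compose[OF measurable_component_singleton]) auto

lemma state_law_space:
  assumes h: "h \<in> space (hist n)"
  shows "state_law M x n h \<in> space (prob_algebra (states_borel M))"
proof (cases n)
  case 0
  then show ?thesis using x
    by (auto simp: state_law_def space_states intro!: measurable_space[OF measurable_return_prob_space])
next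
  case (Suc m)
  then have "h m \<in> space (steps_borel M)" using h by (auto simp: space_PiM PiE_iff)
  from measurable_space[OF kernel_measurable this] show ?thesis
    using Suc by (auto simp: state_law_def kernel_def split: if_splits)
qed

lemma policy_measurable:
  assumes h: "h \<in> space (hist n)"
  shows "(\<lambda>y. \<pi> n (h, y)) \<in> measurable (states_borel M) (prob_algebra (actions_borel M))"
proof -
  have "\<pi> n \<in> measurable (hist n \<Otimes>\<^sub>M states_borel M) (prob_algebra (actions_borel M))"
    using \<pi> by (auto simp: policies_def histories_def)
  then show ?thesis using h by (rule measurable_compose_Pair1[rotated])
qed

text \<open>A step is drawn by first drawing the state and then the action, so the integral is iterated.\<close>

lemma nn_integral_step_law:
  assumes h: "h \<in> space (hist n)" and g [measurable]: "g \<in> borel_measurable (steps_borel M)"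
  shows "(\<integral>\<^sup>+z. g z \<partial>step_law M \<pi> x n h) =
    (\<integral>\<^sup>+y. (\<integral>\<^sup>+a. g (y, a) \<partial>\<pi> n (h, y)) \<partial>state_law M x n h)"
proof -
  have sl: "sets (state_law M x n h) = sets (states_borel M)"
    using state_law_space[OF h] by (simp add: space_prob_algebra)
  have sp: "space (state_law M x n h) = S"
    using sets_eq_imp_space_eq[OF sl] by (simp add: space_states)
  note [measurable] = policy_measurable[OF h]
  have k: "(\<lambda>y. \<pi> n (h, y) \<bind> (\<lambda>a. return (steps_borel M) (y, a)))
      \<in> measurable (states_borel M) (prob_algebra (steps_borel M))"
    by (rule measurable_bind_prob_space2[OF policy_measurable[OF h]])
      (auto intro!: measurable_compose[OF _ measurable_return_prob_space])
  have "(\<integral>\<^sup>+z. g z \<partial>step_law M \<pi> x n h) =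
      (\<integral>\<^sup>+y. (\<integral>\<^sup>+z. g z \<partial>(\<pi> n (h, y) \<bind> (\<lambda>a. return (steps_borel M) (y, a)))) \<partial>state_law M x n h)"
    unfolding step_law_def
    by (intro nn_integral_bind[OF g])
      (use measurable_prob_algebraD[OF k] in \<open>simp add: measurable_cong_sets[OF sl refl]\<close>)
  also have "\<dots> = (\<integral>\<^sup>+y. (\<integral>\<^sup>+a. g (y, a) \<partial>\<pi> n (h, y)) \<partial>state_law M x n h)"
  proof (rule nn_integral_cong)
    fix y assume "y \<in> space (state_law M x n h)"
    then have y: "y \<in> S" by (simp add: sp)
    have "\<pi> n (h, y) \<in> space (prob_algebra (actions_borel M))"
      using measurable_space[OF policy_measurable[OF h]] y by (simp add: space_states)
    then have sa: "sets (\<pi> n (h, y)) = sets (actions_borel M)" by (simp add: space_prob_algebra)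
    have pr: "(\<lambda>a. (y, a)) \<in> measurable (actions_borel M) (steps_borel M)"
      using y by (intro measurable_Pair1') (simp add: space_states)
    have "(\<integral>\<^sup>+z. g z \<partial>(\<pi> n (h, y) \<bind> (\<lambda>a. return (steps_borel M) (y, a))))
        = (\<integral>\<^sup>+a. (\<integral>\<^sup>+z. g z \<partial>return (steps_borel M) (y, a)) \<partial>\<pi> n (h, y))"
      using measurable_compose[OF pr return_measurable]
      by (intro nn_integral_bind[OF g]) (simp add: measurable_cong_sets[OF sa refl])
    also have "\<dots> = (\<integral>\<^sup>+a. g (y, a) \<partial>\<pi> n (h, y))"
      using measurable_space[OF pr] sets_eq_imp_space_eq[OF sa]
      by (intro nn_integral_cong nn_integral_return g) auto
    finally show "(\<integral>\<^sup>+z. g z \<partial>(\<pi> n (h, y) \<bind> (\<lambda>a. return (steps_borel M) (y, a)))) =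
        (\<integral>\<^sup>+a. g (y, a) \<partial>\<pi> n (h, y))" .
  qed
  finally show ?thesis .
qed

lemma nn_integral_P:
  assumes g: "g \<in> borel_measurable (steps_borel M)"
  shows "(\<integral>\<^sup>+\<omega>. g (\<omega> n) \<partial>P) = (\<integral>\<^sup>+h. (\<integral>\<^sup>+y. (\<integral>\<^sup>+a. g (y, a) \<partial>\<pi> n (h, y)) \<partial>state_law M x n h)
    \<partial>IT.C 0 n (\<lambda>_. undefined))"
  unfolding P_lim IT.nn_integral_lim_coordinate(2)[OF g]
  by (intro nn_integral_cong nn_integral_step_law[OF _ g]) (simp add: IT.space_C)

lemma policy_prob:
  assumes h: "h \<in> space (hist n)" and y: "y \<in> S"
  shows "prob_space (\<pi> n (h, y))" "sets (\<pi> n (h, y)) = sets (actions_borel M)"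
    "AE a in \<pi> n (h, y). a \<in> avail M y"
proof -
  have "\<pi> n (h, y) \<in> space (prob_algebra (actions_borel M))"
    using measurable_space[OF policy_measurable[OF h]] y by (simp add: space_states)
  then show p: "prob_space (\<pi> n (h, y))" and s: "sets (\<pi> n (h, y)) = sets (actions_borel M)"
    by (auto simp: space_prob_algebra)
  have "(h, y) \<in> space (histories M n)"
    using h y by (simp add: histories_def space_pair_measure space_states)
  then have one: "measure (\<pi> n (h, y)) (avail M y) = 1"
    using \<pi> unfolding policies_def by blast
  interpret prob_space "\<pi> n (h, y)" by (rule p)
  have "avail M y \<in> sets (\<pi> n (h, y))"
    unfolding s using avail_in_borel[OF y] avail_subset[OF y] actions_in_borel
    by (subst sets_restrict_space_iff) auto
  then show "AE a in \<pi> n (h, y). a \<in> avail M y"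
    using one by (simp add: prob_eq_1)
qed

lemma space_state_law: "h \<in> space (hist n) \<Longrightarrow> space (state_law M x n h) = S"
  using state_law_space[of h n] sets_eq_imp_space_eq[of "state_law M x n h" "states_borel M"]
  by (simp add: space_prob_algebra space_states)

text \<open>Policies choose available actions almost surely, given any history.\<close>

lemma AE_G: "AE \<omega> in P. \<omega> n \<in> G"
proof -
  let ?g = "\<lambda>z. indicator {z \<in> space (steps_borel M). z \<notin> G} z :: ennreal"
  have s: "{z \<in> space (steps_borel M). z \<notin> G} \<in> sets (steps_borel M)"
    using G_steps by (rule sets.sets_Collect_neg)
  then have g: "?g \<in> borel_measurable (steps_borel M)" by simp
  have "(\<integral>\<^sup>+\<omega>. ?g (\<omega> n) \<partial>P) = (\<integral>\<^sup>+h. 0 \<partial>IT.C 0 n (\<lambda>_. undefined))"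
    unfolding nn_integral_P[OF g]
  proof (rule nn_integral_cong)
    fix h assume "h \<in> space (IT.C 0 n (\<lambda>_. undefined))"
    then have h: "h \<in> space (hist n)" by (simp add: IT.space_C)
    have "(\<integral>\<^sup>+y. (\<integral>\<^sup>+a. ?g (y, a) \<partial>\<pi> n (h, y)) \<partial>state_law M x n h) = (\<integral>\<^sup>+y. 0 \<partial>state_law M x n h)"
    proof (rule nn_integral_cong)
      fix y assume "y \<in> space (state_law M x n h)"
      then have y: "y \<in> S" by (simp add: space_state_law[OF h])
      have "(\<integral>\<^sup>+a. ?g (y, a) \<partial>\<pi> n (h, y)) = (\<integral>\<^sup>+a. 0 \<partial>\<pi> n (h, y))"
        using policy_prob(3)[OF h y] y by (intro nn_integral_cong_AE) (auto simp: mem_G)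
      then show "(\<integral>\<^sup>+a. ?g (y, a) \<partial>\<pi> n (h, y)) = 0" by simp
    qed
    then show "(\<integral>\<^sup>+y. (\<integral>\<^sup>+a. ?g (y, a) \<partial>\<pi> n (h, y)) \<partial>state_law M x n h) = 0" by simp
  qed
  then have "AE \<omega> in P. ?g (\<omega> n) = 0"
    using nn_integral_0_iff_AE[OF coordinate_measurable[OF g, of n]] by simp
  moreover have "AE \<omega> in P. \<omega> n \<in> space (steps_borel M)"
    using sets_eq_imp_space_eq[OF sets_P] by (intro AE_I2) (auto simp: space_PiM PiE_iff)
  ultimately show ?thesis
    by eventually_elim (auto simp: indicator_def split: if_splits)
qed

lemma nn_integral_fst:
  assumes f [measurable]: "f \<in> borel_measurable (states_borel M)"
  shows "(\<integral>\<^sup>+\<omega>. f (fst (\<omega> n)) \<partial>P) = (\<integral>\<^sup>+h. (\<integral>\<^sup>+y. f y \<partial>state_law M x n h) \<partial>IT.C 0 n (\<lambda>_. undefined))"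
proof -
  have g: "(\<lambda>z. f (fst z)) \<in> borel_measurable (steps_borel M)" by measurable
  show ?thesis
    unfolding nn_integral_P[OF g]
    by (intro nn_integral_cong)
      (simp add: prob_space.emeasure_space_1[OF policy_prob(1)] space_state_law IT.space_C)
qed

lemma initial_state:
  assumes f: "f \<in> borel_measurable (states_borel M)"
  shows "(\<integral>\<^sup>+\<omega>. f (fst (\<omega> 0)) \<partial>P) = f x"
  unfolding nn_integral_fst[OF f] using x f
  by (simp add: state_law_def nn_integral_return space_states prob_space.emeasure_space_1[OF IT.prob_space_C] del: IT.C.simps)

text \<open>The Markov property in expectation: the state at time \<open>n + 1\<close> is distributed by the transition law of
the pair at time \<open>n\<close>. Together with \<open>AE_G\<close>, \<open>initial_state\<close> and \<open>stationary_action\<close> it carries every later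
argument about trajectories.\<close>

lemma next_state:
  assumes f: "f \<in> borel_measurable (states_borel M)"
  shows "(\<integral>\<^sup>+\<omega>. f (fst (\<omega> (Suc n))) \<partial>P) = (\<integral>\<^sup>+\<omega>. Q f (\<omega> n) \<partial>P)"
proof -
  have k: "(\<lambda>z. \<integral>\<^sup>+y. f y \<partial>kernel z) \<in> borel_measurable (steps_borel M)"
    by (rule kernel_integral_measurable[OF f])
  have "(\<integral>\<^sup>+\<omega>. f (fst (\<omega> (Suc n))) \<partial>P) = (\<integral>\<^sup>+h. (\<integral>\<^sup>+y. f y \<partial>kernel (h n)) \<partial>IT.C 0 (Suc n) (\<lambda>_. undefined))"
    unfolding nn_integral_fst[OF f] by (simp add: state_law_def kernel_def del: IT.C.simps cong: if_cong)
  also have "\<dots> = (\<integral>\<^sup>+\<omega>. (\<integral>\<^sup>+y. f y \<partial>kernel (\<omega> n)) \<partial>P)"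
    unfolding P_lim by (rule IT.nn_integral_lim_coordinate(1)[OF k, symmetric])
  also have "\<dots> = (\<integral>\<^sup>+\<omega>. Q f (\<omega> n) \<partial>P)"
    using AE_G[of n] by (intro nn_integral_cong_AE) (auto simp: kernel_def)
  finally show ?thesis .
qed

lemma stationary_action:
  assumes \<phi>: "stationary M \<phi>" and eq: "\<pi> = stationary_policy M \<phi>"
    and g: "g \<in> borel_measurable (steps_borel M)"
  shows "(\<integral>\<^sup>+\<omega>. g (\<omega> n) \<partial>P) = (\<integral>\<^sup>+\<omega>. g (fst (\<omega> n), \<phi> (fst (\<omega> n))) \<partial>P)"
proof -
  have \<phi>m [measurable]: "\<phi> \<in> measurable (states_borel M) (actions_borel M)"
    using \<phi> by (simp add: stationary_def)
  have m: "(\<lambda>y. g (y, \<phi> y)) \<in> borel_measurable (states_borel M)"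
    by (rule measurable_compose[OF _ g]) measurable
  show ?thesis
    unfolding nn_integral_P[OF g] nn_integral_fst[OF m]
  proof (intro nn_integral_cong)
    fix h y assume "h \<in> space (IT.C 0 n (\<lambda>_. undefined))" "y \<in> space (state_law M x n h)"
    then have y: "y \<in> S" by (simp add: space_state_law IT.space_C)
    have pr: "(\<lambda>a. g (y, a)) \<in> borel_measurable (actions_borel M)"
      using y by (intro measurable_compose[OF measurable_Pair1' g]) (simp add: space_states)
    show "(\<integral>\<^sup>+a. g (y, a) \<partial>\<pi> n (h, y)) = g (y, \<phi> y)"
      using measurable_space[OF \<phi>m, of y] y pr
      by (simp add: eq stationary_policy_def nn_integral_return space_states)
  qed
qed

lemma nn_integral_discounted:
  "(\<integral>\<^sup>+\<omega>. (\<Sum>n. ennreal (\<alpha> ^ n) * pcost (\<omega> n)) \<partial>P) = (\<Sum>n. ennreal (\<alpha> ^ n) * (\<integral>\<^sup>+\<omega>. pcost (\<omega> n) \<partial>P))"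
  using coordinate_measurable[OF pcost_steps]
  by (subst nn_integral_suminf) (auto simp: nn_integral_cmult)

lemma horizon_cost_shift:
  "horizon_cost M \<pi> N x = enn2ereal (\<Sum>n<N. \<integral>\<^sup>+\<omega>. pcost (\<omega> n) \<partial>P) - ereal (real N * L)"
proof -
  have [measurable]: "(\<lambda>\<omega>. pcost (\<omega> n)) \<in> borel_measurable P" for n
    by (rule coordinate_measurable[OF pcost_steps])
  have sum: "(\<Sum>n<N. cost M (\<omega> n)) = enn2ereal (\<Sum>n<N. pcost (\<omega> n)) - ereal (real N * L)"
    if "\<And>n. \<omega> n \<in> G" for \<omega>
  proof (induction N)
    case (Suc N)
    have "(\<Sum>n<Suc N. cost M (\<omega> n)) = enn2ereal (\<Sum>n<N. pcost (\<omega> n)) - ereal (real N * L) +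
        (enn2ereal (pcost (\<omega> N)) - ereal L)"
      using that by (simp add: Suc pcost_shift)
    also have "\<dots> = enn2ereal (\<Sum>n<Suc N. pcost (\<omega> n)) - ereal (real (Suc N) * L)"
      unfolding enn2ereal_shift_add by (simp add: algebra_simps)
    finally show ?case .
  qed (simp add: zero_ereal_def[symmetric] zero_ennreal.rep_eq)
  have "AE \<omega> in P. \<forall>n. \<omega> n \<in> G" by (simp add: AE_all_countable AE_G)
  then have "AE \<omega> in P. (\<Sum>n<N. cost M (\<omega> n)) = enn2ereal (\<Sum>n<N. pcost (\<omega> n)) - ereal (real N * L)"
    by eventually_elim (rule sum, blast)
  then have "horizon_cost M \<pi> N x = enn2ereal (\<integral>\<^sup>+\<omega>. (\<Sum>n<N. pcost (\<omega> n)) \<partial>P) - ereal (real N * L)"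
    unfolding horizon_cost_def using L_nonneg
    by (intro ereal_integral_shift prob_space_P) auto
  then show ?thesis by (simp add: nn_integral_sum)
qed

text \<open>The series of the costs is the difference of a series of nonnegative terms and a geometric series, first
for partial sums and then in the limit, as the geometric series is finite.\<close>

lemma discounted_cost_shift:
  assumes \<alpha>: "0 \<le> \<alpha>" "\<alpha> < 1"
  shows "discounted_cost M \<pi> \<alpha> x =
    enn2ereal (\<Sum>n. ennreal (\<alpha> ^ n) * (\<integral>\<^sup>+\<omega>. pcost (\<omega> n) \<partial>P)) - ereal (L / (1 - \<alpha>))"
proof -
  have [measurable]: "(\<lambda>\<omega>. pcost (\<omega> n)) \<in> borel_measurable P" for n
    by (rule coordinate_measurable[OF pcost_steps])
  have sum: "(\<Sum>n. ereal (\<alpha> ^ n) * cost M (\<omega> n)) =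
      enn2ereal (\<Sum>n. ennreal (\<alpha> ^ n) * pcost (\<omega> n)) - ereal (L / (1 - \<alpha>))"
    if "\<And>n. \<omega> n \<in> G" for \<omega>
  proof (rule sums_unique[symmetric])
    have part: "(\<Sum>n<N. ereal (\<alpha> ^ n) * cost M (\<omega> n)) =
        enn2ereal (\<Sum>n<N. ennreal (\<alpha> ^ n) * pcost (\<omega> n)) - ereal (\<Sum>n<N. \<alpha> ^ n * L)" for N
    proof (induction N)
      case (Suc N)
      have "ereal (\<alpha> ^ N) * cost M (\<omega> N) = enn2ereal (ennreal (\<alpha> ^ N) * pcost (\<omega> N)) - ereal (\<alpha> ^ N * L)"
        unfolding pcost_shift[OF that, symmetric] using \<alpha>
        by (cases "pcost (\<omega> N)"; cases "\<alpha> ^ N = 0")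
          (auto simp: times_ennreal.rep_eq enn2ereal_ennreal algebra_simps)
      then have "(\<Sum>n<Suc N. ereal (\<alpha> ^ n) * cost M (\<omega> n)) =
          enn2ereal (\<Sum>n<N. ennreal (\<alpha> ^ n) * pcost (\<omega> n)) - ereal (\<Sum>n<N. \<alpha> ^ n * L) +
          (enn2ereal (ennreal (\<alpha> ^ N) * pcost (\<omega> N)) - ereal (\<alpha> ^ N * L))"
        by (simp add: Suc)
      also have "\<dots> = enn2ereal (\<Sum>n<Suc N. ennreal (\<alpha> ^ n) * pcost (\<omega> n)) - ereal (\<Sum>n<Suc N. \<alpha> ^ n * L)"
        unfolding enn2ereal_shift_add by simp
      finally show ?case .
    qed (simp add: zero_ereal_def[symmetric] zero_ennreal.rep_eq)
    have "(\<lambda>n. \<alpha> ^ n * L) sums (1 / (1 - \<alpha>) * L)"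
      using \<alpha> by (intro sums_mult2 geometric_sums) auto
    then have 1: "(\<lambda>N. ereal (\<Sum>n<N. \<alpha> ^ n * L)) \<longlonglongrightarrow> ereal (L / (1 - \<alpha>))"
      by (auto simp: sums_def intro!: tendsto_ereal)
    have 2: "(\<lambda>N. enn2ereal (\<Sum>n<N. ennreal (\<alpha> ^ n) * pcost (\<omega> n)))
        \<longlonglongrightarrow> enn2ereal (\<Sum>n. ennreal (\<alpha> ^ n) * pcost (\<omega> n))"
      using summable_LIMSEQ[of "\<lambda>n. ennreal (\<alpha> ^ n) * pcost (\<omega> n)"]
      by (intro continuous_on_tendsto_compose[OF continuous_on_enn2ereal]) auto
    show "(\<lambda>n. ereal (\<alpha> ^ n) * cost M (\<omega> n)) sums
        (enn2ereal (\<Sum>n. ennreal (\<alpha> ^ n) * pcost (\<omega> n)) - ereal (L / (1 - \<alpha>)))"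
      unfolding sums_def part
      by (rule tendsto_diff_ereal_general[OF 2 1]) auto
  qed
  have "AE \<omega> in P. \<forall>n. \<omega> n \<in> G" by (simp add: AE_all_countable AE_G)
  then have "AE \<omega> in P. (\<Sum>n. ereal (\<alpha> ^ n) * cost M (\<omega> n)) =
      enn2ereal (\<Sum>n. ennreal (\<alpha> ^ n) * pcost (\<omega> n)) - ereal (L / (1 - \<alpha>))"
    by eventually_elim (rule sum, blast)
  then have "discounted_cost M \<pi> \<alpha> x = enn2ereal (\<integral>\<^sup>+\<omega>. (\<Sum>n. ennreal (\<alpha> ^ n) * pcost (\<omega> n)) \<partial>P) - ereal (L / (1 - \<alpha>))"
    unfolding discounted_cost_def using L_nonneg \<alpha>
    by (intro ereal_integral_shift prob_space_P) auto
  then show ?thesis by (simp add: nn_integral_discounted)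
qed

end

lemma stationary_policy_in_policies:
  assumes \<phi>: "stationary M \<phi>"
  shows "stationary_policy M \<phi> \<in> policies M"
  unfolding policies_def
proof (intro CollectI allI conjI ballI)
  fix n
  have \<phi>m: "\<phi> \<in> measurable (states_borel M) (actions_borel M)"
    using \<phi> by (simp add: stationary_def)
  have "(\<lambda>p. return (actions_borel M) (\<phi> (snd p))) \<in> measurable (histories M n) (prob_algebra (actions_borel M))"
    unfolding histories_def
    by (intro measurable_compose[OF measurable_snd] measurable_compose[OF \<phi>m] measurable_return_prob_space)
  then show "stationary_policy M \<phi> n \<in> measurable (histories M n) (prob_algebra (actions_borel M))"
    by (simp add: stationary_policy_def case_prod_beta')
  fix p assume p: "p \<in> space (histories M n)"
  obtain h y where [simp]: "p = (h, y)" by (cases p)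
  have y: "y \<in> S" using p by (simp add: histories_def space_pair_measure space_states)
  have "avail M y \<in> sets (actions_borel M)"
    using avail_in_borel[OF y] avail_subset[OF y] actions_in_borel
    by (subst sets_restrict_space_iff) auto
  then show "case p of (h, y) \<Rightarrow> measure (stationary_policy M \<phi> n (h, y)) (avail M y) = 1"
    using \<phi> y by (simp add: stationary_policy_def measure_return stationary_def)
qed

end

section \<open>Discounted costs and value iteration\<close>

lemma INF_enn2ereal_minus:
  assumes "I \<noteq> {}"
  shows "(INF i\<in>I. enn2ereal (f i) - ereal c) = enn2ereal (INF i\<in>I. f i) - ereal c"
proof -
  have "(INF i\<in>I. enn2ereal (f i) + ereal (- c)) = (INF i\<in>I. enn2ereal (f i)) + ereal (- c)"
    using assms by (intro INF_ereal_add_left) auto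
  then show ?thesis
    by (simp add: Inf_ennreal.rep_eq image_comp minus_ereal_def comp_def)
qed

context shifted_MDP
begin

definition stage_cost :: "('x, 'a) policy \<Rightarrow> 'x \<Rightarrow> nat \<Rightarrow> ennreal" where
  "stage_cost \<pi> x n = (\<integral>\<^sup>+\<omega>. pcost (\<omega> n) \<partial>trajectory_law M \<pi> x)"

definition disc_val :: "real \<Rightarrow> 'x \<Rightarrow> ennreal" where
  "disc_val \<alpha> x = (INF \<pi>\<in>policies M. \<Sum>n. ennreal (\<alpha> ^ n) * stage_cost \<pi> x n)"

lemma policies_nonempty: "policies M \<noteq> {}"
  using ex_stationary stationary_policy_in_policies by blast

lemma discounted_value_shift:
  assumes "x \<in> S" "0 \<le> \<alpha>" "\<alpha> < 1"
  shows "discounted_value M \<alpha> x = enn2ereal (disc_val \<alpha> x) - ereal (L / (1 - \<alpha>))"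
  unfolding discounted_value_def disc_val_def stage_cost_def INF_enn2ereal_minus[OF policies_nonempty, symmetric]
  using assms by (intro INF_cong refl discounted_cost_shift) auto

lemma one_step:
  assumes \<pi>: "\<pi> \<in> policies M" and x: "x \<in> S" and f: "f \<in> borel_measurable (states_borel M)"
  shows "(\<integral>\<^sup>+\<omega>. pcost (\<omega> n) + \<gamma> * Q f (\<omega> n) \<partial>trajectory_law M \<pi> x) =
    stage_cost \<pi> x n + \<gamma> * (\<integral>\<^sup>+\<omega>. f (fst (\<omega> (Suc n))) \<partial>trajectory_law M \<pi> x)"
proof -
  have k: "(\<lambda>z. \<integral>\<^sup>+y. f y \<partial>kernel z) \<in> borel_measurable (steps_borel M)"
    by (rule kernel_integral_measurable[OF f])
  note [measurable] = coordinate_measurable[OF \<pi> x k, of n] coordinate_measurable[OF \<pi> x pcost_steps, of n]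
  have eq: "AE \<omega> in trajectory_law M \<pi> x. Q f (\<omega> n) = (\<integral>\<^sup>+y. f y \<partial>kernel (\<omega> n))"
    using AE_G[OF \<pi> x, of n] by eventually_elim (simp add: kernel_def)
  have "(\<integral>\<^sup>+\<omega>. pcost (\<omega> n) + \<gamma> * Q f (\<omega> n) \<partial>trajectory_law M \<pi> x)
      = (\<integral>\<^sup>+\<omega>. pcost (\<omega> n) + \<gamma> * (\<integral>\<^sup>+y. f y \<partial>kernel (\<omega> n)) \<partial>trajectory_law M \<pi> x)"
    using eq by (intro nn_integral_cong_AE) auto
  also have "\<dots> = stage_cost \<pi> x n + \<gamma> * (\<integral>\<^sup>+\<omega>. (\<integral>\<^sup>+y. f y \<partial>kernel (\<omega> n)) \<partial>trajectory_law M \<pi> x)"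
    unfolding stage_cost_def by (simp add: nn_integral_add nn_integral_cmult)
  also have "(\<integral>\<^sup>+\<omega>. (\<integral>\<^sup>+y. f y \<partial>kernel (\<omega> n)) \<partial>trajectory_law M \<pi> x)
      = (\<integral>\<^sup>+\<omega>. Q f (\<omega> n) \<partial>trajectory_law M \<pi> x)"
    using eq by (intro nn_integral_cong_AE) auto
  finally show ?thesis by (simp add: next_state[OF \<pi> x f])
qed

text \<open>A pointwise inequality between the one-step value and \<open>w + f\<close> along a stationary policy becomes an
inequality between expectations. It is used with \<open>w = 0\<close> and \<open>\<gamma>\<close> the discount factor for the
optimality equation, and with \<open>\<gamma> = 1\<close> for the average-cost optimality inequality.\<close>

lemma stationary_step:
  assumes \<phi>: "stationary M \<phi>" and x: "x \<in> S" and f: "f \<in> borel_measurable (states_borel M)"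
    and le: "\<And>y. y \<in> S \<Longrightarrow> pcost (y, \<phi> y) + \<gamma> * Q f (y, \<phi> y) \<le> w + f y"
  shows "stage_cost (stationary_policy M \<phi>) x n
      + \<gamma> * (\<integral>\<^sup>+\<omega>. f (fst (\<omega> (Suc n))) \<partial>trajectory_law M (stationary_policy M \<phi>) x)
    \<le> w + (\<integral>\<^sup>+\<omega>. f (fst (\<omega> n)) \<partial>trajectory_law M (stationary_policy M \<phi>) x)"
proof -
  note \<pi> = stationary_policy_in_policies[OF \<phi>]
  let ?P = "trajectory_law M (stationary_policy M \<phi>) x"
  have k: "(\<lambda>z. \<integral>\<^sup>+y. f y \<partial>kernel z) \<in> borel_measurable (steps_borel M)"
    by (rule kernel_integral_measurable[OF f])
  have g: "(\<lambda>z. pcost z + \<gamma> * (\<integral>\<^sup>+y. f y \<partial>kernel z)) \<in> borel_measurable (steps_borel M)"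
    using k by measurable
  have fm: "(\<lambda>z. f (fst z)) \<in> borel_measurable (steps_borel M)"
    using f by measurable
  have "stage_cost (stationary_policy M \<phi>) x n + \<gamma> * (\<integral>\<^sup>+\<omega>. f (fst (\<omega> (Suc n))) \<partial>?P)
      = (\<integral>\<^sup>+\<omega>. pcost (\<omega> n) + \<gamma> * Q f (\<omega> n) \<partial>?P)"
    by (rule one_step[OF \<pi> x f, symmetric])
  also have "\<dots> = (\<integral>\<^sup>+\<omega>. pcost (\<omega> n) + \<gamma> * (\<integral>\<^sup>+y. f y \<partial>kernel (\<omega> n)) \<partial>?P)"
    using AE_G[OF \<pi> x, of n] by (intro nn_integral_cong_AE) (auto simp: kernel_def)
  also have "\<dots> = (\<integral>\<^sup>+\<omega>. pcost (fst (\<omega> n), \<phi> (fst (\<omega> n))) +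
      \<gamma> * (\<integral>\<^sup>+y. f y \<partial>kernel (fst (\<omega> n), \<phi> (fst (\<omega> n)))) \<partial>?P)"
    using stationary_action[OF \<pi> x \<phi> refl g, of n] by simp
  also have "\<dots> \<le> (\<integral>\<^sup>+\<omega>. w + f (fst (\<omega> n)) \<partial>?P)"
  proof (rule nn_integral_mono_AE)
    show "AE \<omega> in ?P. pcost (fst (\<omega> n), \<phi> (fst (\<omega> n))) +
      \<gamma> * (\<integral>\<^sup>+y. f y \<partial>kernel (fst (\<omega> n), \<phi> (fst (\<omega> n)))) \<le> w + f (fst (\<omega> n))"
      using AE_G[OF \<pi> x, of n]
    proof eventually_elim
      case (elim \<omega>)
      then have y: "fst (\<omega> n) \<in> S" by (auto simp: gr_def)
      then have "(fst (\<omega> n), \<phi> (fst (\<omega> n))) \<in> G" using \<phi> by (simp add: mem_G stationary_def)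
      then show ?case using le[OF y] by (simp add: kernel_def)
    qed
  qed
  also have "\<dots> = w + (\<integral>\<^sup>+\<omega>. f (fst (\<omega> n)) \<partial>?P)"
    using coordinate_measurable[OF \<pi> x fm, of n]
    by (simp add: nn_integral_add prob_space.emeasure_space_1[OF prob_space_P[OF \<pi> x]])
  finally show ?thesis .
qed

lemma bellman_le: "(x, a) \<in> G \<Longrightarrow> bellman UNIV \<gamma> f x \<le> pcost (x, a) + \<gamma> * Q f (x, a)"
  unfolding bellman_def by (rule INF_lower) (simp add: mem_G)

lemma bellman_mono:
  assumes "x \<in> S" "\<And>y. y \<in> S \<Longrightarrow> f y \<le> g y"
  shows "bellman UNIV \<gamma> f x \<le> bellman UNIV \<gamma> g x"
  unfolding bellman_def
proof (rule INF_mono)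
  fix a assume a: "a \<in> {a \<in> avail M x. (x, a) \<in> UNIV}"
  then have "Q f (x, a) \<le> Q g (x, a)" using assms by (intro Q_mono) (auto simp: mem_G)
  then show "\<exists>a'\<in>{a \<in> avail M x. (x, a) \<in> UNIV}.
      pcost (x, a') + \<gamma> * Q f (x, a') \<le> pcost (x, a) + \<gamma> * Q g (x, a)"
    using a by (auto intro!: bexI[of _ a] add_left_mono mult_left_mono)
qed

primrec val_iter :: "real \<Rightarrow> nat \<Rightarrow> 'x \<Rightarrow> ennreal" where
  "val_iter \<alpha> 0 = (\<lambda>_. 0)"
| "val_iter \<alpha> (Suc n) = bellman UNIV (ennreal \<alpha>) (val_iter \<alpha> n)"

lemma val_iter_lsc: "lsc_enn S (val_iter \<alpha> n)"
  by (induction n) (auto simp: bellman_lsc, simp add: joint_lower_def)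

lemma val_iter_mono: "j \<le> k \<Longrightarrow> x \<in> S \<Longrightarrow> val_iter \<alpha> j x \<le> val_iter \<alpha> k x"
proof -
  have step: "\<forall>x\<in>S. val_iter \<alpha> n x \<le> val_iter \<alpha> (Suc n) x" for n
  proof (induction n)
    case (Suc n)
    then show ?case by (auto intro: bellman_mono)
  qed simp
  show "j \<le> k \<Longrightarrow> x \<in> S \<Longrightarrow> val_iter \<alpha> j x \<le> val_iter \<alpha> k x"
    by (rule lift_Suc_mono_le[of "\<lambda>n. val_iter \<alpha> n x"]) (use step in auto)
qed

text \<open>The limit of value iteration, to be identified with the discounted value function.\<close>

definition val_limit :: "real \<Rightarrow> 'x \<Rightarrow> ennreal" where
  "val_limit \<alpha> x = (SUP n. val_iter \<alpha> n x)"

lemma val_limit_joint_lower: "joint_lower S (val_iter \<alpha>) (val_limit \<alpha>)"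
  unfolding val_limit_def[abs_def] by (rule lsc_enn_SUP[OF val_iter_lsc val_iter_mono])

lemma val_iter_le_limit: "val_iter \<alpha> n x \<le> val_limit \<alpha> x"
  unfolding val_limit_def by (rule SUP_upper) simp

lemma val_limit_lsc: "lsc_enn S (val_limit \<alpha>)"
  by (rule joint_lower_lsc[OF val_limit_joint_lower val_iter_le_limit])

lemma val_limit_le: "(x, a) \<in> G \<Longrightarrow> val_limit \<alpha> x \<le> pcost (x, a) + ennreal \<alpha> * Q (val_limit \<alpha>) (x, a)"
  unfolding val_limit_def[of \<alpha> x]
proof (rule SUP_least)
  fix n assume G: "(x, a) \<in> G"
  show "val_iter \<alpha> n x \<le> pcost (x, a) + ennreal \<alpha> * Q (val_limit \<alpha>) (x, a)"
  proof (cases n)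
    case (Suc m)
    have "val_iter \<alpha> n x \<le> pcost (x, a) + ennreal \<alpha> * Q (val_iter \<alpha> m) (x, a)"
      using G by (simp add: Suc bellman_le)
    also have "\<dots> \<le> pcost (x, a) + ennreal \<alpha> * Q (val_limit \<alpha>) (x, a)"
      by (intro add_left_mono mult_left_mono Q_mono G val_iter_le_limit) simp
    finally show ?thesis .
  qed simp
qed

text \<open>Minimum and increasing limit may be exchanged: minimisers of the \<open>n\<close>-th iterate have a limit point, and
since the iterates increase to a limit that is their joint lower limit, the limit principle applies.\<close>

lemma val_limit_attained:
  assumes x: "x \<in> S" and fin: "val_limit \<alpha> x < top"
  shows "\<exists>a\<in>avail M x. pcost (x, a) + ennreal \<alpha> * Q (val_limit \<alpha>) (x, a) \<le> val_limit \<alpha> x"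
proof -
  have "\<exists>a\<in>avail M x. pcost (x, a) + ennreal \<alpha> * Q (val_iter \<alpha> n) (x, a) \<le> val_limit \<alpha> x" for n
  proof -
    have le: "bellman UNIV (ennreal \<alpha>) (val_iter \<alpha> n) x \<le> val_limit \<alpha> x"
      using val_iter_le_limit[of \<alpha> "Suc n" x] by simp
    then have "bellman UNIV (ennreal \<alpha>) (val_iter \<alpha> n) x < top" using fin by (rule le_less_trans)
    from bellman_attained[OF val_iter_lsc closed_UNIV x this] obtain a where
      "a \<in> avail M x" "pcost (x, a) + ennreal \<alpha> * Q (val_iter \<alpha> n) (x, a) = bellman UNIV (ennreal \<alpha>) (val_iter \<alpha> n) x"
      by blast
    then show ?thesis using le by (intro bexI[of _ a]) simp_all
  qed
  then obtain as where as: "\<And>n. as n \<in> avail M x"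
      "\<And>n. pcost (x, as n) + ennreal \<alpha> * Q (val_iter \<alpha> n) (x, as n) \<le> val_limit \<alpha> x" by metis
  have "\<exists>a r. a \<in> avail M x \<and> strict_mono r \<and> (as \<circ> r) \<longlonglongrightarrow> a \<and>
      pcost (x, a) + ennreal \<alpha> * Q (val_limit \<alpha>) (x, a) \<le> val_limit \<alpha> x"
  proof (rule limit_action[OF val_limit_joint_lower _ x x tendsto_const as tendsto_const tendsto_const fin])
    show "\<forall>\<^sub>F n in sequentially. \<forall>z\<in>S. val_iter \<alpha> j z \<le> val_iter \<alpha> n z" for j
      unfolding eventually_sequentially by (rule exI[of _ j]) (auto intro: val_iter_mono)
  qed
  then show ?thesis by blast
qed

text \<open>The \<open>N\<close>-th iterate is a lower bound for the discounted cost of the first \<open>N\<close> steps under any policy, by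
replacing the iterates one at a time by the cost of an actual step. Starting from \<open>0\<close> no terminal
term remains.\<close>

lemma val_iter_le_cost:
  assumes \<pi>: "\<pi> \<in> policies M" and x: "x \<in> S" and \<alpha>: "0 \<le> \<alpha>"
  shows "val_iter \<alpha> N x \<le> (\<Sum>n<N. ennreal (\<alpha> ^ n) * stage_cost \<pi> x n)"
proof -
  let ?P = "trajectory_law M \<pi> x"
  have meas: "val_iter \<alpha> m \<in> borel_measurable (states_borel M)" for m
    by (rule lsc_enn_measurable[OF val_iter_lsc])
  have "val_iter \<alpha> N x \<le> (\<Sum>n<k. ennreal (\<alpha> ^ n) * stage_cost \<pi> x n) +
      ennreal (\<alpha> ^ k) * (\<integral>\<^sup>+\<omega>. val_iter \<alpha> (N - k) (fst (\<omega> k)) \<partial>?P)" if "k \<le> N" for k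
    using that
  proof (induction k)
    case 0
    show ?case using initial_state[OF \<pi> x meas] by simp
  next
    case (Suc k)
    then obtain m where m: "N - k = Suc m" "N - Suc k = m" by (metis Suc_diff_Suc Suc_le_lessD)
    have "(\<integral>\<^sup>+\<omega>. val_iter \<alpha> (Suc m) (fst (\<omega> k)) \<partial>?P) \<le> (\<integral>\<^sup>+\<omega>. pcost (\<omega> k) + ennreal \<alpha> * Q (val_iter \<alpha> m) (\<omega> k) \<partial>?P)"
    proof (rule nn_integral_mono_AE)
      show "AE \<omega> in ?P. val_iter \<alpha> (Suc m) (fst (\<omega> k)) \<le> pcost (\<omega> k) + ennreal \<alpha> * Q (val_iter \<alpha> m) (\<omega> k)"
        using AE_G[OF \<pi> x, of k]
      proof eventually_elim
        case (elim \<omega>)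
        obtain y a where ya: "\<omega> k = (y, a)" by (cases "\<omega> k")
        show ?case using elim by (simp add: ya bellman_le)
      qed
    qed
    also have "\<dots> = stage_cost \<pi> x k + ennreal \<alpha> * (\<integral>\<^sup>+\<omega>. val_iter \<alpha> m (fst (\<omega> (Suc k))) \<partial>?P)"
      by (rule one_step[OF \<pi> x meas])
    finally have le: "(\<integral>\<^sup>+\<omega>. val_iter \<alpha> (Suc m) (fst (\<omega> k)) \<partial>?P) \<le> \<dots>" .
    have "val_iter \<alpha> N x \<le> (\<Sum>n<k. ennreal (\<alpha> ^ n) * stage_cost \<pi> x n) +
      ennreal (\<alpha> ^ k) * (\<integral>\<^sup>+\<omega>. val_iter \<alpha> (Suc m) (fst (\<omega> k)) \<partial>?P)"
      using Suc m by (simp del: val_iter.simps)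
    also have "\<dots> \<le> (\<Sum>n<k. ennreal (\<alpha> ^ n) * stage_cost \<pi> x n) +
      ennreal (\<alpha> ^ k) * (stage_cost \<pi> x k + ennreal \<alpha> * (\<integral>\<^sup>+\<omega>. val_iter \<alpha> m (fst (\<omega> (Suc k))) \<partial>?P))"
      by (intro add_left_mono mult_left_mono le) simp
    also have "\<dots> = (\<Sum>n<Suc k. ennreal (\<alpha> ^ n) * stage_cost \<pi> x n) +
      ennreal (\<alpha> ^ Suc k) * (\<integral>\<^sup>+\<omega>. val_iter \<alpha> m (fst (\<omega> (Suc k))) \<partial>?P)"
      using \<alpha> by (simp add: distrib_left ennreal_mult mult_ac add_ac)
    finally show ?case by (simp only: m)
  qed
  from this[of N] show ?thesis by simp
qed

text \<open>The lower bound holds for every policy by \<open>val_iter_le_cost\<close>. It is reached by a stationary policy that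
selects minimisers for the limit: iterating the fixed-point equation along it and dropping the
nonnegative terminal term bounds its cost by the limit.\<close>

lemma disc_val_eq_limit:
  assumes x: "x \<in> S" and \<alpha>: "0 \<le> \<alpha>"
  shows "disc_val \<alpha> x = val_limit \<alpha> x"
proof (rule antisym)
  show "val_limit \<alpha> x \<le> disc_val \<alpha> x"
    unfolding val_limit_def disc_val_def
  proof (intro SUP_least INF_greatest)
    fix N \<pi> assume \<pi>: "\<pi> \<in> policies M"
    have "val_iter \<alpha> N x \<le> (\<Sum>n<N. ennreal (\<alpha> ^ n) * stage_cost \<pi> x n)" by (rule val_iter_le_cost[OF \<pi> x \<alpha>])
    also have "\<dots> \<le> (\<Sum>n. ennreal (\<alpha> ^ n) * stage_cost \<pi> x n)" by (rule sum_le_suminf) auto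
    finally show "val_iter \<alpha> N x \<le> (\<Sum>n. ennreal (\<alpha> ^ n) * stage_cost \<pi> x n)" .
  qed
  have meas: "val_limit \<alpha> \<in> borel_measurable (states_borel M)"
    by (rule lsc_enn_measurable[OF val_limit_lsc])
  obtain \<phi> where \<phi>: "stationary M \<phi>" and sel: "\<And>y. y \<in> S \<Longrightarrow> val_limit \<alpha> y < top \<Longrightarrow>
      pcost (y, \<phi> y) + ennreal \<alpha> * Q (val_limit \<alpha>) (y, \<phi> y) \<le> val_limit \<alpha> y"
  proof -
    have "{a \<in> avail M y. (y, a) \<in> UNIV \<and> pcost (y, a) + ennreal \<alpha> * Q (val_limit \<alpha>) (y, a) \<le> val_limit \<alpha> y} \<noteq> {}"
      if "y \<in> S" "val_limit \<alpha> y < top" for y using val_limit_attained[OF that] by blast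
    from sublevel_selection[OF val_limit_lsc closed_UNIV meas this] that show thesis by blast
  qed
  have le: "pcost (y, \<phi> y) + ennreal \<alpha> * Q (val_limit \<alpha>) (y, \<phi> y) \<le> 0 + val_limit \<alpha> y" if "y \<in> S" for y
    using sel[OF that] by (cases "val_limit \<alpha> y = top") (auto simp: less_top)
  let ?\<pi> = "stationary_policy M \<phi>" and ?P = "trajectory_law M (stationary_policy M \<phi>) x"
  note \<pi> = stationary_policy_in_policies[OF \<phi>]
  have "(\<Sum>n<N. ennreal (\<alpha> ^ n) * stage_cost ?\<pi> x n) +
      ennreal (\<alpha> ^ N) * (\<integral>\<^sup>+\<omega>. val_limit \<alpha> (fst (\<omega> N)) \<partial>?P) \<le> val_limit \<alpha> x" for N
  proof (induction N)
    case 0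
    show ?case using initial_state[OF \<pi> x meas] by simp
  next
    case (Suc N)
    have "(\<Sum>n<Suc N. ennreal (\<alpha> ^ n) * stage_cost ?\<pi> x n) +
        ennreal (\<alpha> ^ Suc N) * (\<integral>\<^sup>+\<omega>. val_limit \<alpha> (fst (\<omega> (Suc N))) \<partial>?P)
      = (\<Sum>n<N. ennreal (\<alpha> ^ n) * stage_cost ?\<pi> x n) + ennreal (\<alpha> ^ N) *
        (stage_cost ?\<pi> x N + ennreal \<alpha> * (\<integral>\<^sup>+\<omega>. val_limit \<alpha> (fst (\<omega> (Suc N))) \<partial>?P))"
      using \<alpha> by (simp add: distrib_left ennreal_mult mult_ac add_ac)
    also have "\<dots> \<le> (\<Sum>n<N. ennreal (\<alpha> ^ n) * stage_cost ?\<pi> x n) + ennreal (\<alpha> ^ N) *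
        (0 + (\<integral>\<^sup>+\<omega>. val_limit \<alpha> (fst (\<omega> N)) \<partial>?P))"
      by (intro add_left_mono mult_left_mono stationary_step[OF \<phi> x meas le]) auto
    also have "\<dots> \<le> val_limit \<alpha> x" using Suc by simp
    finally show ?case .
  qed
  note partial = this
  have "(\<Sum>n<N. ennreal (\<alpha> ^ n) * stage_cost ?\<pi> x n) \<le> val_limit \<alpha> x" for N
    using partial[of N] by (rule order_trans[rotated]) simp
  then have "(\<Sum>n. ennreal (\<alpha> ^ n) * stage_cost ?\<pi> x n) \<le> val_limit \<alpha> x"
    by (intro suminf_le_const) auto
  then show "disc_val \<alpha> x \<le> val_limit \<alpha> x"
    unfolding disc_val_def using \<pi> by (rule INF_lower2[rotated])
qed

lemma disc_val_measurable: "0 \<le> \<alpha> \<Longrightarrow> disc_val \<alpha> \<in> borel_measurable (states_borel M)"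
  using lsc_enn_measurable[OF val_limit_lsc[of \<alpha>]]
  by (rule measurable_cong[THEN iffD1, rotated]) (simp add: disc_val_eq_limit space_states)

lemma disc_val_attained:
  assumes x: "x \<in> S" and \<alpha>: "0 \<le> \<alpha>" and fin: "disc_val \<alpha> x < top"
  shows "\<exists>a\<in>avail M x. pcost (x, a) + ennreal \<alpha> * Q (disc_val \<alpha>) (x, a) = disc_val \<alpha> x"
proof -
  obtain a where a: "a \<in> avail M x" "pcost (x, a) + ennreal \<alpha> * Q (val_limit \<alpha>) (x, a) \<le> val_limit \<alpha> x"
    using val_limit_attained[OF x] fin disc_val_eq_limit[OF x \<alpha>] by auto
  have G: "(x, a) \<in> G" using x a by (simp add: mem_G)
  have "Q (val_limit \<alpha>) (x, a) = Q (disc_val \<alpha>) (x, a)" by (rule Q_cong[OF G]) (simp add: disc_val_eq_limit \<alpha>)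
  then have "pcost (x, a) + ennreal \<alpha> * Q (disc_val \<alpha>) (x, a) = disc_val \<alpha> x"
    using a(2) val_limit_le[OF G, of \<alpha>] by (simp add: disc_val_eq_limit[OF x \<alpha>])
  with a(1) show ?thesis by blast
qed

text \<open>The shift by \<open>L / (1 - \<alpha>)\<close> in the value function and the shift by \<open>L\<close> in the cost match, as
\<open>L + \<alpha> L / (1 - \<alpha>) = L / (1 - \<alpha>)\<close>.\<close>

lemma A_disc_memI:
  assumes x: "x \<in> S" and \<alpha>: "0 < \<alpha>" "\<alpha> < 1" and a: "a \<in> avail M x"
    and eq: "pcost (x, a) + ennreal \<alpha> * Q (disc_val \<alpha>) (x, a) = disc_val \<alpha> x"
  shows "a \<in> A_disc M \<alpha> x"
proof -
  have G: "(x, a) \<in> G" using x a by (simp add: mem_G)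
  have "ereal_integral (trans_prob M (x, a)) (discounted_value M \<alpha>)
      = enn2ereal (Q (disc_val \<alpha>) (x, a)) - ereal (L / (1 - \<alpha>))"
    using \<alpha> L_nonneg
    by (intro ereal_integral_shift trans_prob_space G borel_measurable_trans_prob disc_val_measurable AE_I2)
      (simp_all add: trans_prob_space(3)[OF G] discounted_value_shift)
  then have "cost M (x, a) + ereal \<alpha> * ereal_integral (trans_prob M (x, a)) (discounted_value M \<alpha>)
      = (enn2ereal (pcost (x, a)) - ereal L) +
        (enn2ereal (ennreal \<alpha> * Q (disc_val \<alpha>) (x, a)) - ereal (\<alpha> * (L / (1 - \<alpha>))))"
    unfolding pcost_shift[OF G] using \<alpha>
    by (cases "Q (disc_val \<alpha>) (x, a)")
      (auto simp: times_ennreal.rep_eq enn2ereal_ennreal algebra_simps)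
  also have "\<dots> = enn2ereal (disc_val \<alpha> x) - ereal (L + \<alpha> * (L / (1 - \<alpha>)))"
    unfolding enn2ereal_shift_add eq ..
  also have "L + \<alpha> * (L / (1 - \<alpha>)) = L / (1 - \<alpha>)"
    using \<alpha> by (simp add: field_simps)
  finally show ?thesis
    using a by (simp add: A_disc_def discounted_value_shift[OF x less_imp_le[OF \<alpha>(1)] \<alpha>(2)])
qed

section \<open>The Abelian estimate\<close>

text \<open>If the shifted averages are eventually below \<open>c = t + L\<close>, the partial sums \<open>s N\<close> of the stage costs are
at most \<open>c N + B\<close> for all \<open>N\<close>. Summation by parts then bounds the discounted sum by \<open>c / (1 - \<alpha>) + B\<close>.
The constant \<open>B\<close> does not depend on \<open>\<alpha>\<close>, so it disappears after multiplication by \<open>1 - \<alpha>\<close>.\<close>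

lemma disc_val_le_of_average_cost:
  assumes \<pi>: "\<pi> \<in> policies M" and x: "x \<in> S" and avg: "average_cost M \<pi> x < ereal t"
  shows "\<exists>B\<ge>0. 0 \<le> t + L \<and> (\<forall>\<alpha>. 0 < \<alpha> \<longrightarrow> \<alpha> < 1 \<longrightarrow> disc_val \<alpha> x \<le> ennreal ((t + L) / (1 - \<alpha>) + B))"
proof -
  have "\<forall>\<^sub>F N in sequentially. ereal (1 / real N) * horizon_cost M \<pi> N x < ereal t"
    using avg unfolding average_cost_def by (rule Limsup_lessD)
  then obtain N0 where N0: "\<And>N. N \<ge> N0 \<Longrightarrow> ereal (1 / real N) * horizon_cost M \<pi> N x < ereal t"
    by (auto simp: eventually_sequentially)
  have bound: "(\<Sum>n<N. stage_cost \<pi> x n) \<le> ennreal (real N * (t + L)) \<and> 0 \<le> t + L" if "N \<ge> N0" "N > 0" for N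
  proof -
    have lt: "ereal (1 / real N) * (enn2ereal (\<Sum>n<N. stage_cost \<pi> x n) - ereal (real N * L)) < ereal t"
      using N0[OF that(1)] unfolding horizon_cost_shift[OF \<pi> x] stage_cost_def .
    define y where "y = (\<Sum>n<N. stage_cost \<pi> x n)"
    note lt = lt[folded y_def]
    have "y \<le> ennreal (real N * (t + L)) \<and> 0 \<le> t + L"
    proof (cases y)
      case (real r)
      then have "(1 / real N) * (r - real N * L) < t" using lt by (simp add: enn2ereal_ennreal)
      then have *: "r < real N * (t + L)" using that(2) by (simp add: field_simps)
      then have "0 \<le> t + L" using real(1) that(2) by (smt (verit) mult_nonneg_nonpos of_nat_0_le_iff)
      then show ?thesis unfolding real(2) using * by (simp add: ennreal_leI)
    next
      case top
      then show ?thesis using lt that(2) by simp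
    qed
    then show ?thesis by (simp add: y_def)
  qed
  define e where "e n = enn2real (stage_cost \<pi> x n)" for n
  have e: "stage_cost \<pi> x n = ennreal (e n)" "0 \<le> e n" for n
  proof -
    have "stage_cost \<pi> x n \<le> (\<Sum>n<Suc (max n N0). stage_cost \<pi> x n)"
      by (rule member_le_sum[of n "{..<Suc (max n N0)}"]) auto
    also have "\<dots> \<le> ennreal (real (Suc (max n N0)) * (t + L))"
      using bound[of "Suc (max n N0)"] by (simp only: le_SucI max.cobounded2 zero_less_Suc)
    also have "\<dots> < top" by simp
    finally show "stage_cost \<pi> x n = ennreal (e n)" by (simp add: e_def)
  qed (simp add: e_def)
  define c where "c = t + L"
  have c: "0 \<le> c" using bound[of "Suc N0"] by (simp add: c_def)
  define s where "s N = (\<Sum>n<N. e n)" for N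
  have s_mono: "m \<le> n \<Longrightarrow> s m \<le> s n" for m n
    unfolding s_def using e(2) by (intro sum_mono2) auto
  define B where "B = s (Suc N0)"
  have B: "0 \<le> B" unfolding B_def s_def by (intro sum_nonneg) (simp add: e)
  have b: "s N \<le> c * real N + B" for N
  proof (cases "N \<ge> Suc N0")
    case True
    then have "(\<Sum>n<N. stage_cost \<pi> x n) \<le> ennreal (real N * (t + L))" using bound[of N] by simp
    then have "ennreal (s N) \<le> ennreal (real N * c)"
      by (simp add: e sum_ennreal s_def c_def)
    then have "s N \<le> real N * c" using c by (subst (asm) ennreal_le_iff) auto
    then show ?thesis using B by (simp add: mult.commute)
  next
    case False
    then have "s N \<le> B" unfolding B_def by (intro s_mono) simp
    then show ?thesis using c by (simp add: add_increasing)
  qed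
  have "disc_val \<alpha> x \<le> ennreal (c / (1 - \<alpha>) + B)" if \<alpha>: "0 < \<alpha>" "\<alpha> < 1" for \<alpha>
  proof -
    \<comment> \<open>summation by parts, with the nonnegative slack \<open>c N + B - s N\<close> at time \<open>N\<close>\<close>
    have part: "(\<Sum>n<N. \<alpha> ^ n * e n) \<le> c * (\<Sum>n<N. \<alpha> ^ n) + B - \<alpha> ^ N * (c * real N + B - s N)" for N
    proof (induction N)
      case 0 then show ?case by (simp add: s_def)
    next
      case (Suc N)
      have "\<alpha> ^ Suc N * (c * real (Suc N) + B - s (Suc N)) \<le> \<alpha> ^ N * (c * real (Suc N) + B - s (Suc N))"
        using \<alpha> b[of "Suc N"] by (intro mult_right_mono power_decreasing) auto
      moreover have "s (Suc N) = s N + e N" by (simp add: s_def)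
      ultimately show ?case using Suc by (simp add: algebra_simps)
    qed
    have part': "(\<Sum>n<N. \<alpha> ^ n * e n) \<le> c / (1 - \<alpha>) + B" for N
    proof -
      have "(\<Sum>n<N. \<alpha> ^ n) \<le> 1 / (1 - \<alpha>)"
        using \<alpha> by (simp add: sum_gp_strict divide_right_mono)
      then have "c * (\<Sum>n<N. \<alpha> ^ n) \<le> c * (1 / (1 - \<alpha>))" using c by (rule mult_left_mono)
      moreover have "0 \<le> \<alpha> ^ N * (c * real N + B - s N)" using \<alpha> b[of N] by simp
      ultimately show ?thesis using part[of N] by simp
    qed
    have "(\<Sum>n<N. ennreal (\<alpha> ^ n) * stage_cost \<pi> x n) \<le> ennreal (c / (1 - \<alpha>) + B)" for N
      using part'[of N] \<alpha> e(2) by (simp add: e(1) ennreal_mult[symmetric] sum_ennreal ennreal_leI)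
    then have "(\<Sum>n. ennreal (\<alpha> ^ n) * stage_cost \<pi> x n) \<le> ennreal (c / (1 - \<alpha>) + B)"
      by (intro suminf_le_const) auto
    then show ?thesis unfolding disc_val_def using \<pi> by (rule INF_lower2[rotated])
  qed
  then show ?thesis using B c unfolding c_def by blast
qed

definition least_disc_val :: "real \<Rightarrow> ennreal" where
  "least_disc_val \<alpha> = (INF x\<in>S. disc_val \<alpha> x)"

text \<open>The shifted upper limit of \<open>(1 - \<alpha>) m\<^sub>\<alpha>\<close>, written as the limit of a decreasing sequence so that the
suprema can serve as convergent bounds in the limit principle.\<close>

definition avg_bound :: ennreal where
  "avg_bound = (INF j. SUP \<alpha>\<in>{1 - 1 / (real j + 2)..<1}. ennreal (1 - \<alpha>) * least_disc_val \<alpha>)"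

text \<open>The intervals start at \<open>1 - 1 / (j + 2)\<close> in order to stay away from \<open>0\<close>: discount factors are positive
throughout.\<close>

lemma tail_pos: "\<alpha> \<in> {1 - 1 / (real j + 2)..<1} \<Longrightarrow> 0 < \<alpha> \<and> \<alpha> < 1"
proof -
  assume \<alpha>: "\<alpha> \<in> {1 - 1 / (real j + 2)..<1}"
  have "1 / (real j + 2) < 1" by simp
  then show ?thesis using \<alpha> unfolding atLeastLessThan_iff by linarith
qed

lemma ex_tail: "b < 1 \<Longrightarrow> \<exists>j. b < 1 - 1 / (real j + 2)"
proof -
  assume "b < 1"
  then obtain j where "inverse (real (Suc j)) < 1 - b" using reals_Archimedean[of "1 - b"] by auto
  moreover have "1 / (real j + 2) \<le> inverse (real (Suc j))" by (simp add: field_simps)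
  ultimately show ?thesis by (intro exI[of _ j]) linarith
qed

lemma tail_mono: "j \<le> k \<Longrightarrow> {1 - 1 / (real k + 2)..<1} \<subseteq> {1 - 1 / (real j + 2)..<1}"
proof -
  assume "j \<le> k"
  then have "1 / (real k + 2) \<le> 1 / (real j + 2)" by (intro divide_left_mono) auto
  then show ?thesis by auto
qed

lemma tail_lim: "(\<lambda>n. 1 - 1 / (real n + 2)) \<longlonglongrightarrow> 1"
proof -
  have "(\<lambda>n. 1 - 1 / real (n + 2)) \<longlonglongrightarrow> 1 - 0"
    by (intro tendsto_diff tendsto_const LIMSEQ_ignore_initial_segment[OF lim_1_over_n])
  then show ?thesis by (simp add: add.commute)
qed

lemma Limsup_least_disc_val: "Limsup (at_left (1::real)) (\<lambda>\<alpha>. ennreal (1 - \<alpha>) * least_disc_val \<alpha>) = avg_bound"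
proof (rule antisym)
  show "Limsup (at_left 1) (\<lambda>\<alpha>. ennreal (1 - \<alpha>) * least_disc_val \<alpha>) \<le> avg_bound"
    unfolding avg_bound_def
  proof (rule INF_greatest)
    fix j
    have "\<forall>\<^sub>F \<alpha> in at_left (1::real). \<alpha> \<in> {1 - 1 / (real j + 2)..<1}"
      by (rule eventually_mono[OF eventually_at_left_real[of "1 - 1 / (real j + 2)"]]) auto
    then show "Limsup (at_left 1) (\<lambda>\<alpha>. ennreal (1 - \<alpha>) * least_disc_val \<alpha>)
        \<le> (SUP \<alpha>\<in>{1 - 1 / (real j + 2)..<1}. ennreal (1 - \<alpha>) * least_disc_val \<alpha>)"
      by (intro Limsup_bounded) (auto elim!: eventually_mono intro!: SUP_upper)
  qed
  show "avg_bound \<le> Limsup (at_left 1) (\<lambda>\<alpha>. ennreal (1 - \<alpha>) * least_disc_val \<alpha>)"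
  proof (rule Limsup_greatest)
    fix R :: "real \<Rightarrow> bool" assume "eventually R (at_left 1)"
    then obtain b where b: "b < 1" "\<And>y. b < y \<Longrightarrow> y < 1 \<Longrightarrow> R y"
      by (subst (asm) eventually_at_left[of 0]) auto
    obtain j where j: "b < 1 - 1 / (real j + 2)" using ex_tail[OF b(1)] by auto
    have "avg_bound \<le> (SUP \<alpha>\<in>{1 - 1 / (real j + 2)..<1}. ennreal (1 - \<alpha>) * least_disc_val \<alpha>)"
      unfolding avg_bound_def by (rule INF_lower) simp
    also have "\<dots> \<le> (SUP \<alpha>\<in>Collect R. ennreal (1 - \<alpha>) * least_disc_val \<alpha>)"
      using j b(2) by (intro SUP_subset_mono) auto
    finally show "avg_bound \<le> (SUP \<alpha>\<in>Collect R. ennreal (1 - \<alpha>) * least_disc_val \<alpha>)" .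
  qed
qed

end

locale average_MDP = shifted_MDP M L for M :: "('x::polish_space, 'a::polish_space) mdp" and L +
  assumes B: "assumption_B_lower M"
begin

lemma states_nonempty: "S \<noteq> {}"
  using B by (auto simp: assumption_B_lower_def w_star_def top_ereal_def)

lemma min_value_shift:
  assumes "0 < \<alpha>" "\<alpha> < 1"
  shows "min_value M \<alpha> = enn2ereal (least_disc_val \<alpha>) - ereal (L / (1 - \<alpha>))"
  unfolding min_value_def least_disc_val_def INF_enn2ereal_minus[OF states_nonempty, symmetric]
  using assms by (intro INF_cong refl discounted_value_shift) auto

lemma w_upper_shift: "w_upper M = enn2ereal avg_bound - ereal L"
proof -
  have "w_upper M = Limsup (at_left (1::real)) (\<lambda>\<alpha>. enn2ereal (ennreal (1 - \<alpha>) * least_disc_val \<alpha>) - ereal L)"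
    unfolding w_upper_def
  proof (rule Limsup_eq)
    have "\<forall>\<^sub>F \<alpha> in at_left (1::real). \<alpha> \<in> {0<..<1}"
      by (rule eventually_at_left_real) simp
    then show "\<forall>\<^sub>F \<alpha> in at_left (1::real). ereal (1 - \<alpha>) * min_value M \<alpha>
        = enn2ereal (ennreal (1 - \<alpha>) * least_disc_val \<alpha>) - ereal L"
    proof eventually_elim
      case (elim \<alpha>)
      then show ?case
        by (cases "least_disc_val \<alpha>")
          (auto simp: min_value_shift times_ennreal.rep_eq enn2ereal_ennreal right_diff_distrib)
    qed
  qed
  also have "\<dots> = enn2ereal (Limsup (at_left (1::real)) (\<lambda>\<alpha>. ennreal (1 - \<alpha>) * least_disc_val \<alpha>)) - ereal L"
  proof (rule Limsup_compose_continuous_mono)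
    show "continuous_on UNIV (\<lambda>y. enn2ereal y - ereal L)"
      unfolding continuous_on_def
      by (intro ballI tendsto_diff_ereal_general tendsto_const
          continuous_on_enn2ereal[unfolded continuous_on_def, rule_format]) auto
    show "mono (\<lambda>y. enn2ereal y - ereal L)"
      by (intro monoI ereal_minus_mono) (auto simp: less_eq_ennreal.rep_eq)
  qed simp
  finally show ?thesis by (simp add: Limsup_least_disc_val)
qed

text \<open>Multiplying the Abelian estimate by \<open>1 - \<alpha>\<close> and letting \<open>\<alpha>\<close> tend to \<open>1\<close>.\<close>

lemma w_upper_le_average_cost:
  assumes \<pi>: "\<pi> \<in> policies M" and x: "x \<in> S"
  shows "w_upper M \<le> average_cost M \<pi> x"
proof (rule dense_ge)
  fix y assume y: "average_cost M \<pi> x < y"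
  show "w_upper M \<le> y"
  proof (cases y)
    case (real t)
    with y obtain b where b: "0 \<le> b" "0 \<le> t + L"
       "\<And>\<alpha>. 0 < \<alpha> \<Longrightarrow> \<alpha> < 1 \<Longrightarrow> disc_val \<alpha> x \<le> ennreal ((t + L) / (1 - \<alpha>) + b)"
      using disc_val_le_of_average_cost[OF \<pi> x, of t] by blast
    have "\<forall>\<^sub>F \<alpha> in at_left (1::real). \<alpha> \<in> {0<..<1}"
      by (rule eventually_at_left_real) simp
    then have "\<forall>\<^sub>F \<alpha> in at_left (1::real). ennreal (1 - \<alpha>) * least_disc_val \<alpha> \<le> ennreal ((t + L) + b * (1 - \<alpha>))"
    proof eventually_elim
      case (elim \<alpha>)
      have "least_disc_val \<alpha> \<le> ennreal ((t + L) / (1 - \<alpha>) + b)"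
        unfolding least_disc_val_def using elim by (intro INF_lower2[OF x] b) auto
      then have "ennreal (1 - \<alpha>) * least_disc_val \<alpha> \<le> ennreal (1 - \<alpha>) * ennreal ((t + L) / (1 - \<alpha>) + b)"
        by (rule mult_left_mono) simp
      also have "\<dots> = ennreal ((t + L) + b * (1 - \<alpha>))"
      proof -
        have "0 \<le> (t + L) / (1 - \<alpha>) + b" using elim b by simp
        moreover have "(1 - \<alpha>) * ((t + L) / (1 - \<alpha>) + b) = (t + L) + b * (1 - \<alpha>)"
        proof -
          have "(1 - \<alpha>) * (X / (1 - \<alpha>)) = X" for X using elim by simp
          then show ?thesis by (simp only: distrib_left mult.commute[of b])
        qed
        ultimately show ?thesis using elim by (simp add: ennreal_mult[symmetric])
      qed
      finally show ?case .
    qed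
    then have "avg_bound \<le> Limsup (at_left (1::real)) (\<lambda>\<alpha>. ennreal ((t + L) + b * (1 - \<alpha>)))"
      unfolding Limsup_least_disc_val[symmetric] by (rule Limsup_mono)
    also have "\<dots> = ennreal ((t + L) + b * (1 - 1))"
      by (intro lim_imp_Limsup tendsto_ennrealI tendsto_intros) simp
    finally have "enn2ereal avg_bound \<le> ereal (t + L)"
      using b by (simp add: less_eq_ennreal.rep_eq enn2ereal_ennreal)
    then show ?thesis
      unfolding w_upper_shift real by (cases "enn2ereal avg_bound") auto
  qed (use y in auto)
qed

lemma least_disc_val_finite:
  assumes "0 < \<alpha>" "\<alpha> < 1"
  shows "least_disc_val \<alpha> < top"
proof -
  obtain x \<pi> where x: "x \<in> S" "\<pi> \<in> policies M" "average_cost M \<pi> x < \<infinity>"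
    using B unfolding assumption_B_lower_def w_star_def average_value_def INF_less_iff by blast
  then obtain t where "average_cost M \<pi> x < ereal t" using less_PInf_Ex_of_nat[of "average_cost M \<pi> x"] by auto
  then obtain c where c: "disc_val \<alpha> x \<le> ennreal c"
    using disc_val_le_of_average_cost[OF x(2,1)] assms by blast
  have "least_disc_val \<alpha> \<le> disc_val \<alpha> x" unfolding least_disc_val_def using x(1) by (rule INF_lower)
  also note c
  also have "ennreal c < top" by simp
  finally show ?thesis .
qed

lemma avg_bound_finite: "avg_bound < top"
proof -
  obtain x \<pi> where x: "x \<in> S" "\<pi> \<in> policies M" "average_cost M \<pi> x < \<infinity>"
    using B unfolding assumption_B_lower_def w_star_def average_value_def INF_less_iff by blast
  from w_upper_le_average_cost[OF x(2,1)] x(3) have "w_upper M < \<infinity>" by (rule le_less_trans)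
  then show ?thesis unfolding w_upper_shift by (cases avg_bound) (auto simp: less_top)
qed

section \<open>The relative value functions and their joint lower limit\<close>

definition rel_val :: "real \<Rightarrow> 'x \<Rightarrow> ennreal" where
  "rel_val \<alpha> y = disc_val \<alpha> y - least_disc_val \<alpha>"

lemma disc_val_eq_rel_val:
  assumes "y \<in> S"
  shows "disc_val \<alpha> y = rel_val \<alpha> y + least_disc_val \<alpha>"
proof -
  have "least_disc_val \<alpha> \<le> disc_val \<alpha> y" unfolding least_disc_val_def using assms by (rule INF_lower)
  then show ?thesis unfolding rel_val_def by (metis add.commute add_diff_inverse_ennreal)
qed

lemma rel_val_measurable: "0 \<le> \<alpha> \<Longrightarrow> rel_val \<alpha> \<in> borel_measurable (states_borel M)"
  unfolding rel_val_def[abs_def] using disc_val_measurable[of \<alpha>] by measurable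

text \<open>The shifts of the value at \<open>y\<close> and of the least value cancel, as the least value is finite.\<close>

lemma relative_value_eq:
  assumes y: "y \<in> S" and \<alpha>: "0 < \<alpha>" "\<alpha> < 1"
  shows "relative_value M \<alpha> y = enn2ereal (rel_val \<alpha> y)"
proof -
  obtain m where m: "least_disc_val \<alpha> = ennreal m" "0 \<le> m" using least_disc_val_finite[OF \<alpha>] by (cases "least_disc_val \<alpha>") auto
  show ?thesis
    unfolding relative_value_def discounted_value_shift[OF y less_imp_le[OF \<alpha>(1)] \<alpha>(2)] min_value_shift[OF \<alpha>]
      disc_val_eq_rel_val[OF y]
    using m by (cases "rel_val \<alpha> y") (auto simp: plus_ennreal.rep_eq enn2ereal_ennreal)
qed

definition rel_lim :: "'x \<Rightarrow> ennreal" where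
  "rel_lim x = e2ennreal (u_lim M x)"

text \<open>The infimum inside the definition of \<^const>\<open>u_lim\<close>.\<close>

definition rel_val_inf :: "real \<Rightarrow> real \<Rightarrow> 'x \<Rightarrow> ereal" where
  "rel_val_inf \<beta> R x = (INF (\<alpha>, y) \<in> {\<beta>..<1} \<times> {y \<in> S. dist y x < R}. relative_value M \<alpha> y)"

lemma u_lim_eq: "u_lim M x = (SUP (\<beta>, R) \<in> {0..<1} \<times> {0<..}. rel_val_inf \<beta> R x)"
  unfolding u_lim_def rel_val_inf_def ..

lemma rel_val_inf_le_u_lim: "0 \<le> \<beta> \<Longrightarrow> \<beta> < 1 \<Longrightarrow> 0 < R \<Longrightarrow> rel_val_inf \<beta> R x \<le> u_lim M x"
  unfolding u_lim_eq by (rule SUP_upper2[of "(\<beta>, R)"]) auto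

lemma enn2ereal_rel_lim: "enn2ereal (rel_lim x) = u_lim M x"
proof -
  have "0 \<le> rel_val_inf (1 / 2) 1 x"
    unfolding rel_val_inf_def by (rule INF_greatest) (auto simp: relative_value_eq)
  also have "\<dots> \<le> u_lim M x" by (rule rel_val_inf_le_u_lim) auto
  finally show ?thesis by (simp add: rel_lim_def enn2ereal_e2ennreal)
qed

lemma less_rel_lim:
  assumes "t < rel_lim x"
  obtains \<beta> R where "0 \<le> \<beta>" "\<beta> < 1" "0 < R" "enn2ereal t < rel_val_inf \<beta> R x"
proof -
  have "enn2ereal t < u_lim M x" using assms by (simp add: less_ennreal.rep_eq enn2ereal_rel_lim)
  then show thesis unfolding u_lim_eq less_SUP_iff using that by auto
qed

text \<open>An increasing sequence below all later relative value functions, as \<open>joint_lower\<close> asks for.\<close>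

definition rel_val_low :: "nat \<Rightarrow> 'x \<Rightarrow> ennreal" where
  "rel_val_low j z = (INF \<alpha>\<in>{1 - 1 / (real j + 2)..<1}. rel_val \<alpha> z)"

lemma rel_val_low_joint_lower: "joint_lower S rel_val_low rel_lim"
  unfolding joint_lower_def
proof (intro conjI allI impI ballI)
  fix j k :: nat and z assume "j \<le> k"
  then show "rel_val_low j z \<le> rel_val_low k z"
    unfolding rel_val_low_def by (intro INF_superset_mono tail_mono) auto
next
  fix x t assume x: "x \<in> S" and "t < rel_lim x"
  then obtain \<beta> R where b: "0 \<le> \<beta>" "\<beta> < 1" "0 < R" "enn2ereal t < rel_val_inf \<beta> R x"
    by (rule_tac less_rel_lim)
  obtain j where j: "\<beta> < 1 - 1 / (real j + 2)" using ex_tail[OF b(2)] by auto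
  have "t \<le> rel_val_low j z" if z: "z \<in> S" "dist z x < R" for z
    unfolding rel_val_low_def
  proof (rule INF_greatest)
    fix \<alpha> assume \<alpha>: "\<alpha> \<in> {1 - 1 / (real j + 2)..<1}"
    have "enn2ereal t \<le> rel_val_inf \<beta> R x" using b(4) by simp
    also have "\<dots> \<le> relative_value M \<alpha> z"
      unfolding rel_val_inf_def using z \<alpha> j by (intro INF_lower2[of "(\<alpha>, z)"]) auto
    also have "\<dots> = enn2ereal (rel_val \<alpha> z)" using tail_pos[OF \<alpha>] z by (intro relative_value_eq) auto
    finally show "t \<le> rel_val \<alpha> z" by (simp add: less_eq_ennreal.rep_eq)
  qed
  then show "\<exists>j. \<exists>R>0. \<forall>z\<in>S. dist z x < R \<longrightarrow> t \<le> rel_val_low j z" using b(3) by blast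
qed

lemma rel_lim_lsc: "lsc_enn S rel_lim"
  unfolding joint_lower_def
proof (intro conjI allI impI ballI)
  fix x t assume x: "x \<in> S" and "t < rel_lim x"
  then obtain \<beta> R where b: "0 \<le> \<beta>" "\<beta> < 1" "0 < R" "enn2ereal t < rel_val_inf \<beta> R x"
    by (rule_tac less_rel_lim)
  have "t \<le> rel_lim z" if z: "z \<in> S" "dist z x < R / 2" for z
  proof -
    have "dist y x < R" if "dist y z < R / 2" for y
      using dist_triangle[of y x z] that z(2) by linarith
    then have "rel_val_inf \<beta> R x \<le> rel_val_inf \<beta> (R / 2) z"
      unfolding rel_val_inf_def by (intro INF_superset_mono) auto
    also have "\<dots> \<le> u_lim M z" using b by (intro rel_val_inf_le_u_lim) auto
    finally have "enn2ereal t \<le> enn2ereal (rel_lim z)" using b(4) unfolding enn2ereal_rel_lim by order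
    then show ?thesis by (simp add: less_eq_ennreal.rep_eq)
  qed
  then show "\<exists>j::nat. \<exists>R>0. \<forall>z\<in>S. dist z x < R \<longrightarrow> t \<le> rel_lim z"
    using b(3) by (intro exI[of _ 0] exI[of _ "R / 2"]) auto
qed auto

text \<open>The joint lower limit is at most the lower limit along \<open>y = x\<close>, which is finite by assumption.\<close>

lemma rel_lim_finite:
  assumes x: "x \<in> S"
  shows "rel_lim x < top"
proof -
  have "u_lim M x \<le> Liminf (at_left (1::real)) (\<lambda>\<alpha>. relative_value M \<alpha> x)"
    unfolding u_lim_eq
  proof (rule SUP_least, clarify)
    fix \<beta> R :: real assume b: "\<beta> \<in> {0..<1}" "0 < R"
    have "\<forall>\<^sub>F \<alpha> in at_left (1::real). \<alpha> \<in> {\<beta><..<1}"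
      using b by (intro eventually_at_left_real) auto
    then show "rel_val_inf \<beta> R x \<le> Liminf (at_left (1::real)) (\<lambda>\<alpha>. relative_value M \<alpha> x)"
    proof (intro Liminf_bounded, eventually_elim)
      case (elim \<alpha>)
      then show ?case
        unfolding rel_val_inf_def using b x by (intro INF_lower2[of "(\<alpha>, x)"]) auto
    qed
  qed
  also have "\<dots> < \<infinity>" using B x unfolding assumption_B_lower_def by blast
  finally show ?thesis unfolding enn2ereal_rel_lim[symmetric] by (cases "rel_lim x") auto
qed

text \<open>Discount factors tending to \<open>1\<close> and states tending to \<open>x\<close> along which the relative values exceed
the joint lower limit by a vanishing amount at most.\<close>

lemma near_minimizer:
  assumes x: "x \<in> S"
  shows "\<exists>\<alpha> y. \<alpha> \<in> {1 - 1 / (real n + 2)..<1} \<and> y \<in> S \<and> dist y x < inverse (Suc n) \<and>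
    rel_val \<alpha> y < rel_lim x + ennreal (inverse (Suc n))"
proof -
  have fin: "u_lim M x < \<infinity>" "0 \<le> u_lim M x"
    using rel_lim_finite[OF x] unfolding enn2ereal_rel_lim[symmetric] by (cases "rel_lim x"; simp)+
  have "rel_val_inf (1 - 1 / (real n + 2)) (inverse (Suc n)) x \<le> u_lim M x"
    by (rule rel_val_inf_le_u_lim) auto
  also have "\<dots> < u_lim M x + ereal (inverse (Suc n))"
    using fin by (cases "u_lim M x") auto
  finally obtain \<alpha> y where y: "\<alpha> \<in> {1 - 1 / (real n + 2)..<1}" "y \<in> S" "dist y x < inverse (Suc n)"
      "relative_value M \<alpha> y < u_lim M x + ereal (inverse (Suc n))"
    unfolding rel_val_inf_def INF_less_iff by auto
  have "enn2ereal (rel_val \<alpha> y) < enn2ereal (rel_lim x + ennreal (inverse (Suc n)))"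
    using y(4) tail_pos[OF y(1)] relative_value_eq[OF y(2), of \<alpha>]
    by (simp add: plus_ennreal.rep_eq enn2ereal_rel_lim enn2ereal_ennreal)
  then have "rel_val \<alpha> y < rel_lim x + ennreal (inverse (Suc n))" by (simp add: less_ennreal.rep_eq)
  with y show ?thesis by blast
qed

section \<open>Limits of discounted optimal actions\<close>

text \<open>The upper topological limit without its restriction to states and actions. As an intersection of
closures it is visibly closed.\<close>

definition disc_graph_lim :: "('x \<times> 'a) set" where
  "disc_graph_lim = (\<Inter>k. closure (\<Union>\<alpha>\<in>{1 - 1 / (real k + 2)<..<1}. gr M (A_disc M \<alpha>)))"

lemma closed_disc_graph_lim: "closed disc_graph_lim"
  unfolding disc_graph_lim_def by (intro closed_INT) auto

lemma disc_graph_lim_memI: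
  assumes "\<And>n. \<alpha> n < 1" "\<alpha> \<longlonglongrightarrow> (1::real)" "\<And>n. zs n \<in> gr M (A_disc M (\<alpha> n))" "zs \<longlonglongrightarrow> z"
  shows "z \<in> disc_graph_lim"
  unfolding disc_graph_lim_def
proof (rule INT_I)
  fix k :: nat
  have "\<forall>\<^sub>F n in sequentially. 1 - 1 / (real k + 2) < \<alpha> n"
    using assms(2) by (rule order_tendstoD) simp
  then have "\<forall>\<^sub>F n in sequentially. zs n \<in> closure (\<Union>\<alpha>\<in>{1 - 1 / (real k + 2)<..<1}. gr M (A_disc M \<alpha>))"
    by eventually_elim (use assms(1,3) closure_subset in fastforce)
  then show "z \<in> closure (\<Union>\<alpha>\<in>{1 - 1 / (real k + 2)<..<1}. gr M (A_disc M \<alpha>))"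
    by (rule Lim_in_closed_set[OF closed_closure _ _ assms(4)]) simp
qed

lemma upper_Lim_eq: "upper_Lim_gr_A_disc M = (S \<times> actions M) \<inter> disc_graph_lim"
proof (intro equalityI subsetI)
  fix z assume "z \<in> upper_Lim_gr_A_disc M"
  then obtain \<alpha> zs where z: "z \<in> S \<times> actions M" and \<alpha>: "range \<alpha> \<subseteq> {0<..<1}" "\<alpha> \<longlonglongrightarrow> (1::real)"
     "\<And>n. zs n \<in> gr M (A_disc M (\<alpha> n))" "zs \<longlonglongrightarrow> z"
    unfolding upper_Lim_gr_A_disc_def by blast
  have "\<alpha> n < 1" for n using \<alpha>(1) by (auto simp: image_subset_iff)
  then show "z \<in> (S \<times> actions M) \<inter> disc_graph_lim"
    using z disc_graph_lim_memI[of \<alpha> zs z] \<alpha> by blast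
next
  fix z assume z: "z \<in> (S \<times> actions M) \<inter> disc_graph_lim"
  have ex: "\<exists>\<alpha> w. b < \<alpha> \<and> 0 < \<alpha> \<and> \<alpha> < 1 \<and> w \<in> gr M (A_disc M \<alpha>) \<and> dist w z < e" if b: "b < 1" "0 < e" for b e
  proof -
    obtain k where k: "max b 0 < 1 - 1 / (real k + 2)" using ex_tail[of "max b 0"] b by auto
    have "z \<in> closure (\<Union>\<alpha>\<in>{1 - 1 / (real k + 2)<..<1}. gr M (A_disc M \<alpha>))"
      using z unfolding disc_graph_lim_def by blast
    then obtain w \<alpha> where w: "\<alpha> \<in> {1 - 1 / (real k + 2)<..<1}" "w \<in> gr M (A_disc M \<alpha>)" "dist w z < e"
      using b(2) unfolding closure_approachable by blast
    have "max b 0 < \<alpha>" using k w(1) unfolding greaterThanLessThan_iff by linarith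
    then show ?thesis using w by (intro exI[of _ \<alpha>] exI[of _ w]) auto
  qed
  define P where "P n p \<longleftrightarrow> 1 - 1 / (real n + 2) < fst p \<and> 0 < fst p \<and> fst p < 1 \<and>
    snd p \<in> gr M (A_disc M (fst p)) \<and> dist (snd p) z < inverse (Suc n)" for n :: nat and p
  have "\<exists>p. \<forall>n. P n (p n) \<and> fst (p n) < fst (p (Suc n))"
  proof (rule dependent_nat_choice)
    show "\<exists>p. P 0 p"
      unfolding P_def using ex[of "1 - 1 / (real 0 + 2)" "inverse (Suc 0)"] by auto
    fix p n assume "P n p"
    then show "\<exists>p'. P (Suc n) p' \<and> fst p < fst p'"
      unfolding P_def
      using ex[of "max (fst p) (1 - 1 / (real (Suc n) + 2))" "inverse (Suc (Suc n))"] by auto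
  qed
  then obtain p where p: "\<And>n. P n (p n)" "\<And>n. fst (p n) < fst (p (Suc n))" by blast
  have "(\<lambda>n. fst (p n)) \<longlonglongrightarrow> 1"
  proof (rule tendsto_sandwich[of "\<lambda>n. 1 - 1 / (real n + 2)" _ _ "\<lambda>_. 1"])
    show "(\<lambda>n. 1 - 1 / (real n + 2)) \<longlonglongrightarrow> 1" by (rule tail_lim)
  qed (use p(1) in \<open>auto simp: P_def less_imp_le intro!: always_eventually\<close>)
  moreover have "(\<lambda>n. snd (p n)) \<longlonglongrightarrow> z"
  proof (rule tendsto_dist_iff[THEN iffD2], rule Lim_null_comparison[rotated])
    show "(\<lambda>n. inverse (real (Suc n))) \<longlonglongrightarrow> 0" by (rule LIMSEQ_inverse_real_of_nat)
    show "\<forall>\<^sub>F n in sequentially. norm (dist (snd (p n)) z) \<le> inverse (real (Suc n))"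
      using p(1) by (intro always_eventually allI) (simp add: P_def less_imp_le)
  qed
  moreover have "incseq (\<lambda>n. fst (p n))" using p(2) by (intro incseq_SucI less_imp_le)
  ultimately show "z \<in> upper_Lim_gr_A_disc M"
    unfolding upper_Lim_gr_A_disc_def using z p(1)
    by (intro CollectI conjI exI[of _ "\<lambda>n. fst (p n)"] exI[of _ "\<lambda>n. snd (p n)"]) (auto simp: P_def)
qed

text \<open>Both sides of the optimality inequality are shifted by the same \<open>L\<close>.\<close>

lemma A_star_eq:
  assumes x: "x \<in> S"
  shows "A_star M x = {a \<in> avail M x. pcost (x, a) + 1 * Q rel_lim (x, a) \<le> avg_bound + rel_lim x}"
proof -
  have "cost M (x, a) + ereal_integral (trans_prob M (x, a)) (u_lim M) \<le> w_upper M + u_lim M x \<longleftrightarrow>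
      pcost (x, a) + 1 * Q rel_lim (x, a) \<le> avg_bound + rel_lim x" if a: "a \<in> avail M x" for a
  proof -
    have G: "(x, a) \<in> G" using x a by (simp add: mem_G)
    have "ereal_integral (trans_prob M (x, a)) (u_lim M) = enn2ereal (Q rel_lim (x, a)) - ereal 0"
      by (intro ereal_integral_shift trans_prob_space G borel_measurable_trans_prob
          lsc_enn_measurable[OF rel_lim_lsc] AE_I2) (simp_all add: enn2ereal_rel_lim zero_ereal_def[symmetric])
    then have "cost M (x, a) + ereal_integral (trans_prob M (x, a)) (u_lim M)
        = enn2ereal (pcost (x, a) + Q rel_lim (x, a)) - ereal (L + 0)"
      by (simp only: pcost_shift[OF G, symmetric] enn2ereal_shift_add)
    moreover have "w_upper M + u_lim M x = enn2ereal (avg_bound + rel_lim x) - ereal (L + 0)"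
      unfolding w_upper_shift enn2ereal_shift_add[symmetric] by (simp add: enn2ereal_rel_lim zero_ereal_def[symmetric])
    moreover have "a - ereal l \<le> b - ereal l \<longleftrightarrow> a \<le> b" for a b l
      by (cases a; cases b) auto
    ultimately show ?thesis by (simp add: less_eq_ennreal.rep_eq)
  qed
  then show ?thesis unfolding A_star_def by blast
qed

text \<open>This form is an instance of the sublevel sets treated above, with the closed constraint
\<open>disc_graph_lim\<close> and the finite bound \<open>avg_bound + rel_lim x\<close>.\<close>

lemma A_app_eq:
  assumes x: "x \<in> S"
  shows "A_app M x = {a \<in> avail M x. (x, a) \<in> disc_graph_lim \<and> pcost (x, a) + 1 * Q rel_lim (x, a) \<le> avg_bound + rel_lim x}"
  using avail_subset[OF x] x unfolding A_app_def A_star_eq[OF x] upper_Lim_eq by auto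

lemma avg_bound_plus_rel_lim_finite: "x \<in> S \<Longrightarrow> avg_bound + rel_lim x < top"
  using avg_bound_finite rel_lim_finite by simp

lemma A_app_compact: "x \<in> S \<Longrightarrow> compact (A_app M x)"
  unfolding A_app_eq by (rule sublevel_compact[OF rel_lim_lsc closed_disc_graph_lim _ avg_bound_plus_rel_lim_finite])

text \<open>Discounted optimal actions at near-minimisers of the relative values have a limit point that satisfies
the average-cost optimality inequality. Subtracting \<open>\<alpha>\<^sub>n m\<close> (with \<open>m\<close> the least value, which is
finite) from both sides of the discounted optimality equation turns it into one for relative values.\<close>

lemma A_app_nonempty:
  assumes x: "x \<in> S"
  shows "A_app M x \<noteq> {}"
proof -
  obtain \<alpha> ys where \<alpha>: "\<And>n. \<alpha> n \<in> {1 - 1 / (real n + 2)..<1}" and ys: "\<And>n. ys n \<in> S"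
    and near: "\<And>n. dist (ys n) x < inverse (Suc n)"
    and gap: "\<And>n. rel_val (\<alpha> n) (ys n) < rel_lim x + ennreal (inverse (Suc n))"
    using near_minimizer[OF x] by metis
  have \<alpha>01: "0 < \<alpha> n" "\<alpha> n < 1" for n using tail_pos[OF \<alpha>[of n]] by auto
  have \<alpha>_lim: "\<alpha> \<longlonglongrightarrow> 1"
  proof (rule tendsto_sandwich[of "\<lambda>n. 1 - 1 / (real n + 2)" _ _ "\<lambda>_. 1"])
    show "(\<lambda>n. 1 - 1 / (real n + 2)) \<longlonglongrightarrow> 1" by (rule tail_lim)
  qed (use \<alpha> in \<open>auto simp: less_imp_le intro!: always_eventually\<close>)
  have ys_lim: "ys \<longlonglongrightarrow> x"
  proof (rule tendsto_dist_iff[THEN iffD2], rule Lim_null_comparison[rotated])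
    show "(\<lambda>n. inverse (real (Suc n))) \<longlonglongrightarrow> 0" by (rule LIMSEQ_inverse_real_of_nat)
    show "\<forall>\<^sub>F n in sequentially. norm (dist (ys n) x) \<le> inverse (real (Suc n))"
      using near by (intro always_eventually allI) (simp add: less_imp_le)
  qed
  define T where "T n = (SUP \<alpha>\<in>{1 - 1 / (real n + 2)..<1}. ennreal (1 - \<alpha>) * least_disc_val \<alpha>)" for n
  have "decseq T" unfolding T_def by (intro antimonoI SUP_subset_mono tail_mono) auto
  then have T_lim: "T \<longlonglongrightarrow> avg_bound" unfolding avg_bound_def T_def[symmetric] by (rule LIMSEQ_INF)
  define K where "K n = T n + (rel_lim x + ennreal (inverse (Suc n)))" for n
  have "K \<longlonglongrightarrow> avg_bound + (rel_lim x + ennreal 0)"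
    unfolding K_def by (intro tendsto_add T_lim tendsto_const tendsto_ennrealI LIMSEQ_inverse_real_of_nat)
  then have K_lim: "K \<longlonglongrightarrow> avg_bound + rel_lim x" by simp
  have "disc_val (\<alpha> n) (ys n) < top" for n
  proof -
    have "rel_val (\<alpha> n) (ys n) < top" using gap[of n] by (rule less_le_trans) simp
    then show ?thesis unfolding disc_val_eq_rel_val[OF ys] using least_disc_val_finite[OF \<alpha>01] by simp
  qed
  then have "\<exists>a\<in>avail M (ys n). pcost (ys n, a) + ennreal (\<alpha> n) * Q (disc_val (\<alpha> n)) (ys n, a) = disc_val (\<alpha> n) (ys n)" for n
    using \<alpha>01 ys by (intro disc_val_attained) (auto simp: less_imp_le)
  then obtain as where as: "\<And>n. as n \<in> avail M (ys n)"
      "\<And>n. pcost (ys n, as n) + ennreal (\<alpha> n) * Q (disc_val (\<alpha> n)) (ys n, as n) = disc_val (\<alpha> n) (ys n)" by metis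
  have le: "pcost (ys n, as n) + ennreal (\<alpha> n) * Q (rel_val (\<alpha> n)) (ys n, as n) \<le> K n" for n
  proof -
    have G: "(ys n, as n) \<in> G" using ys as by (simp add: mem_G)
    interpret prob_space "trans_prob M (ys n, as n)" by (rule trans_prob_space[OF G])
    have "Q (disc_val (\<alpha> n)) (ys n, as n) = Q (\<lambda>y. rel_val (\<alpha> n) y + least_disc_val (\<alpha> n)) (ys n, as n)"
      by (rule Q_cong[OF G]) (rule disc_val_eq_rel_val)
    also have "\<dots> = Q (rel_val (\<alpha> n)) (ys n, as n) + least_disc_val (\<alpha> n)"
      using borel_measurable_trans_prob[OF G rel_val_measurable[of "\<alpha> n"]] \<alpha>01[of n]
      by (simp add: nn_integral_add emeasure_space_1)
    finally have QV: "Q (disc_val (\<alpha> n)) (ys n, as n) = Q (rel_val (\<alpha> n)) (ys n, as n) + least_disc_val (\<alpha> n)" .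
    \<comment> \<open>the part of the least value that stays on the right-hand side, and the part that cancels\<close>
    have split: "least_disc_val (\<alpha> n) = ennreal (1 - \<alpha> n) * least_disc_val (\<alpha> n) + ennreal (\<alpha> n) * least_disc_val (\<alpha> n)"
      using \<alpha>01[of n] by (simp add: distrib_right[symmetric] ennreal_plus[symmetric] del: ennreal_plus)
    have "(pcost (ys n, as n) + ennreal (\<alpha> n) * Q (rel_val (\<alpha> n)) (ys n, as n)) + ennreal (\<alpha> n) * least_disc_val (\<alpha> n)
        = disc_val (\<alpha> n) (ys n)"
      using as(2)[of n] by (simp add: QV distrib_left add.assoc)
    also have "\<dots> = (rel_val (\<alpha> n) (ys n) + ennreal (1 - \<alpha> n) * least_disc_val (\<alpha> n)) + ennreal (\<alpha> n) * least_disc_val (\<alpha> n)"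
      unfolding disc_val_eq_rel_val[OF ys] by (subst split) (simp add: add.assoc)
    finally have eq: "(pcost (ys n, as n) + ennreal (\<alpha> n) * Q (rel_val (\<alpha> n)) (ys n, as n)) + ennreal (\<alpha> n) * least_disc_val (\<alpha> n)
        = (rel_val (\<alpha> n) (ys n) + ennreal (1 - \<alpha> n) * least_disc_val (\<alpha> n)) + ennreal (\<alpha> n) * least_disc_val (\<alpha> n)" .
    have "pcost (ys n, as n) + ennreal (\<alpha> n) * Q (rel_val (\<alpha> n)) (ys n, as n)
        = rel_val (\<alpha> n) (ys n) + ennreal (1 - \<alpha> n) * least_disc_val (\<alpha> n)"
    proof -
      have "ennreal (\<alpha> n) * least_disc_val (\<alpha> n) \<noteq> top"
        using least_disc_val_finite[OF \<alpha>01, of n] by (simp add: ennreal_mult_eq_top_iff less_top[symmetric])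
      then show ?thesis using eq by simp
    qed
    also have "\<dots> \<le> (rel_lim x + ennreal (inverse (Suc n))) + T n"
      unfolding T_def using gap[of n] \<alpha>[of n] by (intro add_mono SUP_upper) (auto simp: less_imp_le)
    finally show ?thesis by (simp add: K_def add.commute)
  qed
  have "\<exists>a r. a \<in> avail M x \<and> strict_mono r \<and> (as \<circ> r) \<longlonglongrightarrow> a \<and>
      pcost (x, a) + ennreal 1 * Q rel_lim (x, a) \<le> avg_bound + rel_lim x"
  proof (rule limit_action[OF rel_val_low_joint_lower _ ys x ys_lim as(1) le _ K_lim avg_bound_plus_rel_lim_finite[OF x]])
    show "(\<lambda>n. ennreal (\<alpha> n)) \<longlonglongrightarrow> ennreal 1" by (intro tendsto_ennrealI \<alpha>_lim)
    show "\<forall>\<^sub>F n in sequentially. \<forall>z\<in>S. rel_val_low j z \<le> rel_val (\<alpha> n) z" for j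
      unfolding eventually_sequentially rel_val_low_def
      using \<alpha> tail_mono by (intro exI[of _ j] allI impI ballI INF_lower) blast
  qed
  then obtain a r where a: "a \<in> avail M x" "strict_mono r" "(as \<circ> r) \<longlonglongrightarrow> a"
      "pcost (x, a) + 1 * Q rel_lim (x, a) \<le> avg_bound + rel_lim x" by auto
  have "(x, a) \<in> disc_graph_lim"
  proof (rule disc_graph_lim_memI)
    show "(\<lambda>n. ((ys \<circ> r) n, (as \<circ> r) n)) \<longlonglongrightarrow> (x, a)"
      by (intro tendsto_Pair a(3) LIMSEQ_subseq_LIMSEQ[OF ys_lim a(2)])
    show "(\<alpha> \<circ> r) \<longlonglongrightarrow> 1" by (rule LIMSEQ_subseq_LIMSEQ[OF \<alpha>_lim a(2)])
    show "(\<alpha> \<circ> r) n < 1" for n using \<alpha>01 by simp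
    show "((ys \<circ> r) n, (as \<circ> r) n) \<in> gr M (A_disc M ((\<alpha> \<circ> r) n))" for n
      using A_disc_memI[OF ys \<alpha>01 as] ys by (simp add: gr_def)
  qed
  then show ?thesis unfolding A_app_eq[OF x] using a by blast
qed

lemma A_app_selection: "\<exists>\<phi>. stationary M \<phi> \<and> (\<forall>x\<in>S. \<phi> x \<in> A_app M x)"
proof -
  have g: "(\<lambda>x. avg_bound + rel_lim x) \<in> borel_measurable (states_borel M)"
    using lsc_enn_measurable[OF rel_lim_lsc] by measurable
  have "{a \<in> avail M x. (x, a) \<in> disc_graph_lim \<and> pcost (x, a) + 1 * Q rel_lim (x, a) \<le> avg_bound + rel_lim x} \<noteq> {}"
    if "x \<in> S" for x using A_app_nonempty[OF that] unfolding A_app_eq[OF that] .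
  from sublevel_selection[OF rel_lim_lsc closed_disc_graph_lim g this] obtain \<phi> where
    "stationary M \<phi>" "\<And>x. x \<in> S \<Longrightarrow> (x, \<phi> x) \<in> disc_graph_lim \<and> pcost (x, \<phi> x) + 1 * Q rel_lim (x, \<phi> x) \<le> avg_bound + rel_lim x"
    using avg_bound_plus_rel_lim_finite by blast
  then show ?thesis by (auto simp: A_app_eq stationary_def)
qed

lemma gr_A_app_borel: "gr M (A_app M) \<in> sets borel"
proof -
  let ?N = "restrict_space borel G"
  have um: "rel_lim \<in> borel_measurable (states_borel M)" by (rule lsc_enn_measurable[OF rel_lim_lsc])
  have Qu: "Q rel_lim \<in> borel_measurable ?N"
    by (rule measurable_compose[OF measurable_prob_algebraD[OF trans_prob_kernel]
          nn_integral_measurable_subprob_algebra[OF um]])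
  have "fst \<in> measurable (borel :: ('x \<times> 'a) measure) borel"
    by (intro borel_measurable_continuous_onI continuous_intros)
  then have "fst \<in> measurable ?N (states_borel M)"
    by (intro measurable_restrict_space2 measurable_restrict_space1) (auto simp: space_restrict_space gr_def)
  then have [measurable]: "(\<lambda>z. rel_lim (fst z)) \<in> borel_measurable ?N" by (rule measurable_compose[OF _ um])
  have [measurable]: "pcost \<in> borel_measurable ?N" by (intro measurable_restrict_space1 pcost_measurable)
  note [measurable] = Qu
  have L: "disc_graph_lim \<in> sets borel" by (intro borel_closed closed_disc_graph_lim)
  have "{z \<in> space ?N. pcost z + Q rel_lim z \<le> avg_bound + rel_lim (fst z)} \<in> sets ?N" by measurable
  then have "{z \<in> space ?N. pcost z + Q rel_lim z \<le> avg_bound + rel_lim (fst z)} \<in> sets borel"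
    using gr_in_borel by (simp add: sets_restrict_space_iff)
  then have "{z \<in> space ?N. pcost z + Q rel_lim z \<le> avg_bound + rel_lim (fst z)} \<inter> disc_graph_lim \<in> sets borel"
    using L by (rule sets.Int)
  also have "{z \<in> space ?N. pcost z + Q rel_lim z \<le> avg_bound + rel_lim (fst z)} \<inter> disc_graph_lim = gr M (A_app M)"
    by (auto simp: space_restrict_space gr_def A_app_eq)
  finally show ?thesis .
qed

section \<open>Average-cost optimality\<close>

text \<open>Iterating the optimality inequality bounds the cost over \<open>N\<close> steps by \<open>N\<close> times the bound plus the
initial value of \<open>rel_lim\<close>; the latter is finite and vanishes in the average.\<close>

lemma stationary_average_cost_le:
  assumes \<phi>: "stationary M \<phi>" and sel: "\<And>x. x \<in> S \<Longrightarrow> \<phi> x \<in> A_star M x" and x: "x \<in> S"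
  shows "average_cost M (stationary_policy M \<phi>) x \<le> w_upper M"
proof -
  let ?\<pi> = "stationary_policy M \<phi>" and ?P = "trajectory_law M (stationary_policy M \<phi>) x"
  note \<pi> = stationary_policy_in_policies[OF \<phi>]
  have um: "rel_lim \<in> borel_measurable (states_borel M)" by (rule lsc_enn_measurable[OF rel_lim_lsc])
  have le: "pcost (y, \<phi> y) + 1 * Q rel_lim (y, \<phi> y) \<le> avg_bound + rel_lim y" if "y \<in> S" for y
    using sel[OF that] unfolding A_star_eq[OF that] by blast
  have "(\<Sum>n<N. stage_cost ?\<pi> x n) + (\<integral>\<^sup>+\<omega>. rel_lim (fst (\<omega> N)) \<partial>?P) \<le> of_nat N * avg_bound + rel_lim x" for N
  proof (induction N)
    case 0
    show ?case using initial_state[OF \<pi> x um] by simp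
  next
    case (Suc N)
    have "(\<Sum>n<Suc N. stage_cost ?\<pi> x n) + (\<integral>\<^sup>+\<omega>. rel_lim (fst (\<omega> (Suc N))) \<partial>?P)
        \<le> (\<Sum>n<N. stage_cost ?\<pi> x n) + (avg_bound + (\<integral>\<^sup>+\<omega>. rel_lim (fst (\<omega> N)) \<partial>?P))"
      using stationary_step[OF \<phi> x um le, of N] by (simp add: add.assoc add_left_mono)
    also have "\<dots> \<le> avg_bound + (of_nat N * avg_bound + rel_lim x)"
      using add_left_mono[OF Suc, of avg_bound] by (simp add: ac_simps)
    finally show ?case by (simp add: algebra_simps)
  qed
  note partial = this
  obtain w where w: "avg_bound = ennreal w" "0 \<le> w" using avg_bound_finite by (cases avg_bound) auto
  obtain v where v: "rel_lim x = ennreal v" "0 \<le> v" using rel_lim_finite[OF x] by (cases "rel_lim x") auto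
  have "ereal (1 / real N) * horizon_cost M ?\<pi> N x \<le> ereal (w - L + v / real N)" if "0 < N" for N
  proof -
    have "(\<Sum>n<N. stage_cost ?\<pi> x n) \<le> of_nat N * avg_bound + rel_lim x"
      using partial[of N] by (rule order_trans[rotated]) simp
    also have "\<dots> = ennreal (real N * w + v)"
      using w v by (simp add: ennreal_of_nat_eq_real_of_nat ennreal_mult[symmetric])
    finally have bound: "(\<Sum>n<N. stage_cost ?\<pi> x n) \<le> ennreal (real N * w + v)" .
    define y where "y = (\<Sum>n<N. stage_cost ?\<pi> x n)"
    have "y < top" unfolding y_def using bound by (rule le_less_trans) simp
    then obtain s where s: "y = ennreal s" "0 \<le> s" by (cases y) auto
    have s_le: "s \<le> real N * w + v"
      using bound w(2) v(2) unfolding y_def[symmetric] s(1) by (subst (asm) ennreal_le_iff) auto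
    have "horizon_cost M ?\<pi> N x = ereal (s - real N * L)"
      unfolding horizon_cost_shift[OF \<pi> x] stage_cost_def[symmetric] y_def[symmetric] s(1) using s(2) by (simp add: enn2ereal_ennreal)
    moreover have "(1 / real N) * (s - real N * L) \<le> w - L + v / real N"
      using that s_le by (simp add: field_simps)
    ultimately show ?thesis by simp
  qed
  then have "average_cost M ?\<pi> x \<le> limsup (\<lambda>N. ereal (w - L + v / real N))"
    unfolding average_cost_def by (intro Limsup_mono) (auto simp: eventually_sequentially intro!: exI[of _ 1])
  also have "\<dots> = ereal (w - L)"
  proof (rule lim_imp_Limsup)
    have "(\<lambda>N. w - L + v / real N) \<longlonglongrightarrow> w - L + 0"
      by (intro tendsto_add tendsto_const lim_const_over_n)
    then show "(\<lambda>N. ereal (w - L + v / real N)) \<longlonglongrightarrow> ereal (w - L)" by (intro tendsto_ereal) simp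
  qed simp
  also have "\<dots> = w_upper M" using w by (simp add: w_upper_shift enn2ereal_ennreal)
  finally show ?thesis .
qed

lemma stationary_optimal:
  assumes \<phi>: "stationary M \<phi>" and sel: "\<And>x. x \<in> S \<Longrightarrow> \<phi> x \<in> A_star M x"
  shows "average_optimal M (stationary_policy M \<phi>)"
  unfolding average_optimal_def
proof (intro conjI ballI antisym)
  show \<pi>: "stationary_policy M \<phi> \<in> policies M" by (rule stationary_policy_in_policies[OF \<phi>])
  fix x assume x: "x \<in> S"
  show "average_value M x \<le> average_cost M (stationary_policy M \<phi>) x"
    unfolding average_value_def using \<pi> by (rule INF_lower)
  have "w_upper M \<le> average_value M x"
    unfolding average_value_def using x by (intro INF_greatest w_upper_le_average_cost)
  then show "average_cost M (stationary_policy M \<phi>) x \<le> average_value M x"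
    using stationary_average_cost_le[OF \<phi> _ x] sel by (meson order_trans)
qed

end

theorem theorem6p1:
  fixes M :: "('x::polish_space, 'a::polish_space) mdp"
  assumes "MDP M"
    and "assumption_W M"
    and "assumption_B_lower M"
  shows "gr M (A_app M) \<in> sets borel \<and>
    gr M (A_app M) \<subseteq> gr M (A_star M) \<and>
    (\<forall>x\<in>states M. A_app M x \<noteq> {} \<and> compact (A_app M x)) \<and>
    (\<exists>\<phi>. stationary M \<phi> \<and> (\<forall>x\<in>states M. \<phi> x \<in> A_app M x)) \<and>
    (\<forall>\<phi>. stationary M \<phi> \<and> (\<forall>x\<in>states M. \<phi> x \<in> A_app M x) \<longrightarrow>
       average_optimal M (stationary_policy M \<phi>))"
proof -
  interpret MDP M by fact
  obtain K :: real where K: "\<And>z. z \<in> gr M (avail M) \<Longrightarrow> ereal K \<le> cost M z"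
    using cost_bounded_below by (auto simp: bounded_below_on_def)
  \<comment> \<open>the shift has to be nonnegative and to dominate the lower bound of the cost\<close>
  interpret average_MDP M "max 0 (- K)"
  proof
    show "ereal (- max 0 (- K)) \<le> cost M z" if "z \<in> gr M (avail M)" for z
      using K[OF that] by (rule order_trans[rotated]) simp
  qed (use assms in auto)
  have sub: "A_app M x \<subseteq> A_star M x" for x by (auto simp: A_app_def)
  then have "gr M (A_app M) \<subseteq> gr M (A_star M)" by (auto simp: gr_def)
  moreover have "average_optimal M (stationary_policy M \<phi>)"
    if "stationary M \<phi> \<and> (\<forall>x\<in>states M. \<phi> x \<in> A_app M x)" for \<phi>
    using that sub by (intro stationary_optimal) auto
  ultimately show ?thesis
    using gr_A_app_borel A_app_nonempty A_app_compact A_app_selection by blast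
qed

end
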